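(* Let $a,b$ be integers such that $f(x)=x^7+ax+b$ is irreducible over $\mathbb{Q}$, let $\theta$ be a root of $f(x)$ and $K=\mathbb{Q}(\theta)$. If $a\equiv 15\pmod{72}$ and $b\equiv 12\pmod{72}$, then $i(K)=1$.
   Context: For a number field $K$ with ring of integers $\mathbb{O}_K$ and $\alpha\in\mathbb{O}_K$ with $K=\mathbb{Q}(\alpha)$, $\operatorname{ind}\alpha=[\mathbb{O}_K:\mathbb{Z}[\alpha]]$. The index of the field $K$ is $i(K)=\gcd\{\operatorname{ind}\alpha \mid \alpha\in\mathbb{O}_K,\ K=\mathbb{Q}(\alpha)\}$. *)

theory Defs
  imports
    "HOL-Algebra.Generated_Fields"
    "HOL-Algebra.Algebraic_Closure_Type"
    "HOL-Number_Theory.Cong"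
begin

text \<open>
  Number fields are subfields of a type \<open>'a\<close> of class \<open>field_char_0\<close>, such as the complex
  numbers; \<open>ring_of_type_algebra\<close> is that ambient field as a structure with explicit carrier.
\<close>

text \<open>The field \<open>\<rat>(\<alpha>)\<close>: in characteristic 0 the subfield generated by \<open>\<alpha>\<close> contains \<open>\<rat>\<close>.\<close>

definition rat_adjoin :: "'a::field_char_0 \<Rightarrow> 'a set" where
  "rat_adjoin \<alpha> = generate_field ring_of_type_algebra {\<alpha>}"

text \<open>The ring \<open>\<int>[\<alpha>]\<close>: \<open>generate_ring\<close> always includes 1, hence \<open>\<int>\<close>.\<close>

definition int_adjoin :: "'a::field_char_0 \<Rightarrow> 'a set" where
  "int_adjoin \<alpha> = generate_ring ring_of_type_algebra {\<alpha>}"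

definition ring_of_integers :: "'a::field_char_0 set \<Rightarrow> 'a ring" where
  "ring_of_integers K = ring_of_type_algebra\<lparr>carrier := {x \<in> K. algebraic_int x}\<rparr>"

text \<open>
  The index of \<open>\<int>[\<alpha>]\<close> as an additive subgroup of the ring of integers of \<open>K\<close>. It is used only
  when \<open>\<alpha>\<close> is an algebraic integer with \<open>K = \<rat>(\<alpha>)\<close>; the index is then finite, so the
  convention that infinite sets have cardinality 0 plays no role.
\<close>

definition ind :: "'a::field_char_0 set \<Rightarrow> 'a \<Rightarrow> nat" where
  "ind K \<alpha> = card (a_rcosets\<^bsub>ring_of_integers K\<^esub> (int_adjoin \<alpha>))"

definition field_index :: "'a::field_char_0 set \<Rightarrow> nat" where
  "field_index K =
     Gcd {ind K \<alpha> | \<alpha>. \<alpha> \<in> carrier (ring_of_integers K) \<and> K = rat_adjoin \<alpha>}"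

end

theory Submission
  imports Defs "HOL-Algebra.Sylow" "HOL-Number_Theory.Residues" "Jordan_Normal_Form.Char_Poly"
begin

text \<open>
  It suffices to find, for every prime \<open>p\<close>, an \<open>\<alpha>\<close> with \<open>p\<close> not dividing its index. If \<open>\<int>[\<alpha>] + p \<O> = \<O>\<close>,
  where \<open>\<O>\<close> is the ring of integers, then \<open>p\<close> acts surjectively on the finite group \<open>\<O> / \<int>[\<alpha>]\<close>, whose order
  is thus prime to \<open>p\<close>; replacing \<open>\<alpha>\<close> by \<open>\<alpha> + p m \<theta>\<close> for a suitable \<open>m\<close> makes it a generator of \<open>K\<close>.

  For \<open>p > n / 2\<close>, with \<open>n = 7\<close> the degree, \<open>\<O> / p \<O>\<close> is generated by one element unless there are \<open>p + 1\<close>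
  primes of degree one over \<open>p\<close>: generators of the residue fields can be translated by integers until
  no two of them are conjugate, which gives \<open>\<tau>\<close> generating \<open>\<O>\<close> modulo its \<open>p\<close>-radical \<open>J\<close>;
  the radical is principal modulo \<open>p\<close>, generated by some \<open>\<pi>\<close>; and a high Frobenius power of \<open>\<tau>\<^sup>q + \<pi>\<close>
  recovers \<open>\<tau>\<^sup>q\<close>, hence also \<open>\<pi>\<close>.

  This settles \<open>p \<ge> 7\<close>. For \<open>p = 5\<close>, six primes of degree one would force
  \<open>(z - l) (z\<^sup>5 - z) \<in> 5 \<O>\<close> for every \<open>z\<close> and some integer \<open>l\<close>, and \<open>z\<^sup>2 \<in> 5 \<O>\<close> for every \<open>z\<close> nilpotent modulo 5;
  the traces of powers of \<open>\<theta>\<close>, after dividing \<open>\<theta>\<close> by the largest possible power of 5, contradict this.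
  For \<open>p = 3\<close> the trinomial is an Eisenstein polynomial and \<open>\<theta>\<close> itself works. For \<open>p = 2\<close> the element
  \<open>\<alpha> = (\<theta>\<^sup>4 - \<theta>) / 2\<close> is integral with characteristic polynomial
  \<open>x (x\<^sup>2 + x + 1) (x\<^sup>4 + x\<^sup>3 + 1)\<close> modulo 2, a product of distinct irreducible factors.
\<close>

text \<open>Dedekind's obstruction shapes the proof: \<open>p\<close> divides every index once some
  residue degree occurs at more primes over \<open>p\<close> than there are irreducible polynomials
  of that degree modulo \<open>p\<close>. Residue degrees sum to at most \<open>n\<close>, and two
  translates of a generator are conjugate only if the minimal polynomial is invariant under a
  translation, hence of degree at least \<open>p\<close>; so \<open>n < 2 p\<close> confines the
  obstruction to degree one. For \<open>n = 7\<close> counting leaves \<open>p = 5\<close> open and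
  does not reach 2 and 3, where the congruences modulo 8 and 9 supply explicit generators. The field
  enters through one linear form, the trace, which sends the sum of r_k \<theta>^k to 7 r_0 - 6 a
  r_6 and maps multiples of \<open>p\<close> to multiples of \<open>p\<close>. For
  \<open>p = 5\<close> it is combined with the Newton polygon of the trinomial at 5. For
  \<open>p = 2\<close> the trinomial is X (X^3 - 1)^2 modulo 2, and \<alpha> is half of \<theta>
  (\<theta>^3 - 1). It is integral because the trinomial agrees with X^7 - X even modulo 4: \<alpha>
  (\<alpha> + \<theta>) = \<theta> (\<theta>^7 - \<theta>) / 4.\<close>

hide_const (open) up_ring.coeff up_ring.monom module.smult Polynomial.order Ring_Divisibility.mult_of

section \<open>Algebraic integers\<close>

definition zspan :: "'a::ring_1 set \<Rightarrow> 'a set" where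
  "zspan V = {\<Sum>v\<in>V. of_int (m v) * v | m. True}"

text \<open>Multiplication by \<open>x\<close> on the elements of \<open>V\<close>, which need not
  be independent, is given by an integer matrix with \<open>x\<close> as eigenvalue; the vector of
  these elements is an eigenvector, nonzero because of \<open>v0\<close>. The characteristic
  polynomial is monic over the integers.\<close>

lemma algebraic_int_eigen:
  fixes x :: "'a::field_char_0"
  assumes V: "finite V" "v0 \<in> V" "v0 \<noteq> 0" and sp: "\<And>v. v \<in> V \<Longrightarrow> x * v \<in> zspan V"
  shows "algebraic_int x"
proof -
  define n where "n = card V"
  obtain f where f: "bij_betw f {..<n} V"
    using ex_bij_betw_nat_finite[OF V(1)] by (auto simp: n_def atLeast0LessThan)
  have "\<exists>m. x * v = (\<Sum>w\<in>V. of_int (m w) * w)" if "v \<in> V" for v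
    using sp[OF that] by (auto simp: zspan_def)
  then obtain M where M: "\<And>v. v \<in> V \<Longrightarrow> x * v = (\<Sum>w\<in>V. of_int (M v w) * w)"
    by metis
  have fV: "f i \<in> V" if "i < n" for i
    using f that by (auto simp: bij_betw_def)
  have M': "x * f i = (\<Sum>j<n. of_int (M (f i) (f j)) * f j)" if "i < n" for i
    unfolding M[OF fV[OF that]] by (rule sum.reindex_bij_betw[OF f, symmetric])
  define B where "B = mat n n (\<lambda>(i,j). M (f i) (f j))"
  define C :: "'a mat" where "C = of_int_hom.mat_hom B"
  have B: "B \<in> carrier_mat n n" and C: "C \<in> carrier_mat n n"
    by (auto simp: B_def C_def)
  obtain i0 where i0: "i0 < n" "f i0 = v0"
    using f V(2) by (auto simp: bij_betw_def)
  have "eigenvector C (vec n f) x"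
    unfolding eigenvector_def
  proof (intro conjI)
    show "vec n f \<in> carrier_vec (dim_row C)" using C by auto
    show "vec n f \<noteq> 0\<^sub>v (dim_row C)"
      using C i0 V(3) by (metis carrier_matD(1) index_vec index_zero_vec(1))
    show "C *\<^sub>v vec n f = x \<cdot>\<^sub>v vec n f"
    proof (rule eq_vecI)
      fix i assume "i < dim_vec (x \<cdot>\<^sub>v vec n f)"
      then have i: "i < n" by auto
      have "(C *\<^sub>v vec n f) $ i = (\<Sum>j<n. of_int (M (f i) (f j)) * f j)"
        using i by (auto simp: C_def B_def scalar_prod_def atLeast0LessThan intro!: sum.cong)
      then show "(C *\<^sub>v vec n f) $ i = (x \<cdot>\<^sub>v vec n f) $ i"
        using M'[OF i] i by auto
    qed (use C in auto)
  qed
  then have "eigenvalue C x" unfolding eigenvalue_def by blast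
  then have "poly (char_poly C) x = 0" using eigenvalue_root_char_poly[OF C] by simp
  moreover have "char_poly C = map_poly of_int (char_poly B)"
    unfolding C_def by (rule of_int_hom.char_poly_hom[OF B])
  ultimately show ?thesis
    unfolding algebraic_int_altdef_ipoly using degree_monic_char_poly[OF B] by metis
qed

section \<open>Rings that are finitely generated as additive groups\<close>

definition finring :: "'a::comm_ring_1 set \<Rightarrow> bool" where
  "finring A \<longleftrightarrow> 1 \<in> A \<and> (\<forall>x\<in>A. \<forall>y\<in>A. x + y \<in> A \<and> x * y \<in> A \<and> - x \<in> A) \<and>
     (\<exists>V. finite V \<and> A = zspan V)"

lemma int_mult_mem:
  fixes B :: "'a::comm_ring_1 set"
  assumes "0 \<in> B" "\<And>x y. x \<in> B \<Longrightarrow> y \<in> B \<Longrightarrow> x + y \<in> B" "\<And>x. x \<in> B \<Longrightarrow> - x \<in> B" "x \<in> B"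
  shows "of_int m * x \<in> B"
proof -
  have *: "of_nat k * x \<in> B" for k
    by (induction k) (use assms in \<open>auto simp: algebra_simps\<close>)
  show ?thesis
  proof (cases "m \<ge> 0")
    case True
    then show ?thesis using *[of "nat m"] by simp
  next
    case False
    then have "of_int m * x = - (of_nat (nat (-m)) * x)" by simp
    then show ?thesis using * assms(3) by metis
  qed
qed

lemma zspan_subset:
  fixes B :: "'a::comm_ring_1 set"
  assumes "V \<subseteq> B" "0 \<in> B" "\<And>x y. x \<in> B \<Longrightarrow> y \<in> B \<Longrightarrow> x + y \<in> B" "\<And>x. x \<in> B \<Longrightarrow> - x \<in> B"
  shows "zspan V \<subseteq> B"
proof
  fix z assume "z \<in> zspan V"
  then obtain m where z: "z = (\<Sum>v\<in>V. of_int (m v) * v)" by (auto simp: zspan_def)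
  have "(\<Sum>v\<in>V. of_int (m v) * v) \<in> B"
    using assms(1)
    by (induction V rule: infinite_finite_induct)
       (auto intro!: assms(2-4) int_mult_mem)
  then show "z \<in> B" using z by simp
qed

lemma zspan_zero: "0 \<in> zspan V"
  unfolding zspan_def by (auto intro!: exI[of _ "\<lambda>_. 0"])

lemma zspan_add: "x \<in> zspan V \<Longrightarrow> y \<in> zspan V \<Longrightarrow> x + y \<in> zspan V"
proof -
  assume "x \<in> zspan V" "y \<in> zspan V"
  then obtain k l where "x = (\<Sum>v\<in>V. of_int (k v) * v)" "y = (\<Sum>v\<in>V. of_int (l v) * v)"
    by (auto simp: zspan_def)
  then have "x + y = (\<Sum>v\<in>V. of_int (k v + l v) * v)"
    by (simp add: sum.distrib algebra_simps)
  then show ?thesis unfolding zspan_def by (auto intro: exI[of _ "\<lambda>v. k v + l v"])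
qed

lemma zspan_sum: "(\<And>i. i \<in> I \<Longrightarrow> g i \<in> zspan V) \<Longrightarrow> (\<Sum>i\<in>I. g i) \<in> zspan V"
  by (induction I rule: infinite_finite_induct) (auto simp: zspan_zero zspan_add)

lemma zspan_of_int_mult:
  fixes V :: "'a::ring_1 set"
  assumes "finite V" "v \<in> V"
  shows "of_int k * v \<in> zspan V"
proof -
  have "(\<Sum>w\<in>V. of_int (if w = v then k else 0) * w) = of_int k * v"
    using assms by (subst sum.remove[of _ v]) auto
  then show ?thesis unfolding zspan_def by (intro CollectI exI[of _ "\<lambda>w. if w = v then k else 0"]) simp
qed

lemma zspan_superset: "finite V \<Longrightarrow> V \<subseteq> zspan V"
  using zspan_of_int_mult[of V _ 1] by auto

lemma zspan_times:
  fixes V :: "'a::idom set"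
  assumes "finite W" "(\<lambda>v. v * c) ` V \<subseteq> W" "x \<in> zspan V"
  shows "x * c \<in> zspan W"
proof -
  obtain k where k: "x = (\<Sum>v\<in>V. of_int (k v) * v)" using assms(3) by (auto simp: zspan_def)
  have "of_int (k v) * (v * c) \<in> zspan W" if "v \<in> V" for v
    using that assms(1,2) by (intro zspan_of_int_mult) auto
  then have "(\<Sum>v\<in>V. of_int (k v) * (v * c)) \<in> zspan W" by (rule zspan_sum)
  then show ?thesis unfolding k by (simp add: sum_distrib_right mult.assoc)
qed

lemma finring_algebraic_int:
  fixes x :: "'a::field_char_0"
  assumes "finring A" "x \<in> A"
  shows "algebraic_int x"
proof -
  obtain V where V: "finite V" "A = zspan V" using assms by (auto simp: finring_def)
  have "1 \<in> zspan V" using assms(1) V by (auto simp: finring_def)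
  then have "\<not> V \<subseteq> {0}"
  proof -
    obtain m where "1 = (\<Sum>v\<in>V. of_int (m v) * v)" using \<open>1 \<in> zspan V\<close> by (auto simp: zspan_def)
    then show ?thesis
      by (metis (no_types, lifting) mult_zero_right singletonD subsetD sum.neutral zero_neq_one)
  qed
  then obtain v0 where "v0 \<in> V" "v0 \<noteq> 0" by auto
  moreover have "x * v \<in> zspan V" if "v \<in> V" for v
  proof -
    have "v \<in> zspan V" using zspan_superset[OF V(1)] that by auto
    then show ?thesis using assms V(2) by (simp add: finring_def)
  qed
  ultimately show ?thesis using algebraic_int_eigen[OF V(1)] by blast
qed

text \<open>Division by the monic \<open>q\<close> of degree \<open>d\<close> reduces every
  polynomial in \<open>y\<close> to degree below \<open>d\<close> without leaving \<open>A\<close>,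
  so the products \<open>v * y ^ k\<close> with \<open>k < d\<close> generate the ring
  \<open>A[y]\<close> additively.\<close>

lemma finring_adjoin:
  fixes y :: "'a::idom"
  assumes A: "finring A" and q: "\<And>i. coeff q i \<in> A" "lead_coeff q = 1" "poly q y = 0"
  shows "\<exists>B. finring B \<and> A \<subseteq> B \<and> y \<in> B"
proof -
  obtain V where V: "finite V" "A = zspan V" using A by (auto simp: finring_def)
  have A1: "1 \<in> A" and Aadd: "\<And>x y. x \<in> A \<Longrightarrow> y \<in> A \<Longrightarrow> x + y \<in> A"
    and Amul: "\<And>x y. x \<in> A \<Longrightarrow> y \<in> A \<Longrightarrow> x * y \<in> A" and Aneg: "\<And>x. x \<in> A \<Longrightarrow> - x \<in> A"
    using A by (auto simp: finring_def)
  have A0: "0 \<in> A" using V zspan_zero by auto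
  have Adiff: "x - z \<in> A" if "x \<in> A" "z \<in> A" for x z
    using Aadd[OF that(1) Aneg[OF that(2)]] by simp
  have Asum: "sum g I \<in> A" if "\<And>i. i \<in> I \<Longrightarrow> g i \<in> A" for g :: "nat \<Rightarrow> 'a" and I
    using that by (induction I rule: infinite_finite_induct) (auto simp: A0 Aadd)
  define d where "d = degree q"
  have d: "d > 0"
  proof (rule ccontr)
    assume "\<not> d > 0"
    then obtain c where "q = [:c:]" unfolding d_def using degree_eq_zeroE by blast
    then show False using q(2,3) by auto
  qed
  define B where "B = {poly g y | g. \<forall>i. coeff g i \<in> A}"
  define W where "W = (\<lambda>(v,k). v * y ^ k) ` (V \<times> {..<d})"
  have W: "finite W" using V(1) by (auto simp: W_def)
  have AV: "V \<subseteq> A" using zspan_superset[OF V(1)] V(2) by simp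
  have Badd: "x + z \<in> B" if xz: "x \<in> B" "z \<in> B" for x z
  proof -
    obtain g h where "x = poly g y" "z = poly h y" "\<forall>i. coeff g i \<in> A" "\<forall>i. coeff h i \<in> A"
      using xz by (auto simp: B_def)
    then show ?thesis unfolding B_def by (auto intro!: exI[of _ "g + h"] Aadd)
  qed
  have Bmul: "x * z \<in> B" if xz: "x \<in> B" "z \<in> B" for x z
  proof -
    obtain g h where "x = poly g y" "z = poly h y" "\<forall>i. coeff g i \<in> A" "\<forall>i. coeff h i \<in> A"
      using xz by (auto simp: B_def)
    then show ?thesis unfolding B_def
      by (auto intro!: exI[of _ "g * h"] Asum Amul simp: coeff_mult)
  qed
  have Bneg: "- x \<in> B" if xz: "x \<in> B" for x
  proof -
    obtain g where "x = poly g y" "\<forall>i. coeff g i \<in> A"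
      using xz by (auto simp: B_def)
    then show ?thesis unfolding B_def
      by (auto intro!: exI[of _ "- g"] Aneg)
  qed
  have AB: "A \<subseteq> B"
  proof
    fix x assume "x \<in> A"
    then show "x \<in> B" unfolding B_def
      by (auto intro!: exI[of _ "[:x:]"] simp: coeff_pCons A0 split: nat.splits)
  qed
  have yB: "y \<in> B" unfolding B_def
    by (auto intro!: exI[of _ "[:0, 1:]"] simp: coeff_pCons A0 A1 split: nat.splits)
  have "poly g y \<in> zspan W" if "\<forall>i. coeff g i \<in> A" for g
    using that
  proof (induction "degree g" arbitrary: g rule: less_induct)
    case less
    show ?case
    proof (cases "degree g < d")
      case True
      then have "poly g y = (\<Sum>k<d. coeff g k * y ^ k)"
        unfolding poly_altdef by (intro sum.mono_neutral_left) (auto simp: coeff_eq_0)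
      also have "\<dots> \<in> zspan W"
      proof (rule zspan_sum)
        fix k assume k: "k \<in> {..<d}"
        show "coeff g k * y ^ k \<in> zspan W"
          by (rule zspan_times[OF W, where V = V]) (use less.prems V k in \<open>auto simp: W_def image_iff\<close>)
      qed
      finally show ?thesis .
    next
      case False
      define c where "c = lead_coeff g"
      define h where "h = g - monom c (degree g - d) * q"
      have hc: "coeff h i \<in> A" for i
      proof -
        have "coeff h i = coeff g i - (if i < degree g - d then 0 else c * coeff q (i - (degree g - d)))"
          by (simp add: h_def coeff_monom_mult)
        then show ?thesis using less.prems q(1) by (auto simp: c_def intro!: Adiff Amul A0)
      qed
      have val: "poly h y = poly g y" by (simp add: h_def q(3))
      show ?thesis
      proof (cases "degree h < degree g")
        case True
        then show ?thesis using less.hyps[of h] hc val by auto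
      next
        case nl: False
        have "c \<noteq> 0" using False d by (auto simp: c_def)
        have dm: "degree (monom c (degree g - d) * q) = degree g"
          using \<open>c \<noteq> 0\<close> q(2) False by (subst degree_mult_eq) (auto simp: degree_monom_eq d_def)
        have "degree h \<le> degree g"
          unfolding h_def by (rule degree_diff_le) (auto simp: dm)
        then have "degree h = degree g" using nl by auto
        moreover have "coeff h (degree g) = 0"
          using False q(2) by (simp add: h_def coeff_monom_mult c_def d_def)
        ultimately have "h = 0" by (metis leading_coeff_0_iff)
        then show ?thesis using val zspan_zero by auto
      qed
    qed
  qed
  then have "B \<subseteq> zspan W" by (auto simp: B_def)
  moreover have "zspan W \<subseteq> B"
  proof (rule zspan_subset)
    have "y ^ k \<in> B" for k
      by (induction k) (use AB A1 yB Bmul in auto)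
    then show "W \<subseteq> B" using AV AB Bmul by (auto simp: W_def)
  qed (use AB A0 Badd Bneg in auto)
  ultimately have "finring B"
    unfolding finring_def using AB A1 Badd Bmul Bneg W by (intro conjI exI[of _ W]) auto
  then show ?thesis using AB yB by blast
qed

lemma finring_Ints: "finring (\<int> :: 'a::comm_ring_1 set)"
proof -
  have "(\<int> :: 'a set) = zspan {1}"
    unfolding zspan_def Ints_def by (auto simp: image_iff)
  then show ?thesis unfolding finring_def by (auto intro: exI[of _ "{1}"])
qed

text \<open>The elements are adjoined one at a time. Sums and products of algebraic integers then
  lie in one such ring, all of whose elements are algebraic integers.\<close>

lemma finring_algebraic_ints:
  fixes C :: "'a::field_char_0 set"
  assumes "finite C" "\<And>c. c \<in> C \<Longrightarrow> algebraic_int c"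
  shows "\<exists>A. finring A \<and> C \<subseteq> A"
  using assms
proof (induction C rule: finite_induct)
  case empty
  then show ?case using finring_Ints by blast
next
  case (insert c C)
  obtain A where A: "finring A" "C \<subseteq> A" using insert by auto
  obtain q where q: "lead_coeff q = 1" "\<forall>i. coeff q i \<in> \<int>" "poly q c = 0"
    using insert.prems[of c] unfolding algebraic_int.simps[of c] by auto
  have "\<int> \<subseteq> A"
  proof
    fix x :: 'a assume "x \<in> \<int>"
    then obtain m where m: "x = of_int m" by (auto simp: Ints_def)
    have "0 \<in> A" using A zspan_zero by (auto simp: finring_def)
    then have "of_int m * 1 \<in> A"
      by (intro int_mult_mem) (use A in \<open>auto simp: finring_def\<close>)
    then show "x \<in> A" using m by simp
  qed
  then obtain B where "finring B" "A \<subseteq> B" "c \<in> B"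
    using finring_adjoin[OF A(1) _ q(1,3)] q(2) by blast
  then show ?case using A(2) by blast
qed

lemma algebraic_int_add:
  fixes x y :: "'a::field_char_0"
  assumes "algebraic_int x" "algebraic_int y"
  shows "algebraic_int (x + y)"
proof -
  obtain A where A: "finring A" "{x, y} \<subseteq> A"
    using finring_algebraic_ints[of "{x, y}"] assms by auto
  then have "x + y \<in> A" by (auto simp: finring_def)
  then show ?thesis by (rule finring_algebraic_int[OF A(1)])
qed

lemma algebraic_int_mult:
  fixes x y :: "'a::field_char_0"
  assumes "algebraic_int x" "algebraic_int y"
  shows "algebraic_int (x * y)"
proof -
  obtain A where A: "finring A" "{x, y} \<subseteq> A"
    using finring_algebraic_ints[of "{x, y}"] assms by auto
  then have "x * y \<in> A" by (auto simp: finring_def)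
  then show ?thesis by (rule finring_algebraic_int[OF A(1)])
qed

lemma algebraic_int_diff:
  fixes x y :: "'a::field_char_0"
  assumes "algebraic_int x" "algebraic_int y"
  shows "algebraic_int (x - y)"
  using algebraic_int_add[of x "- y"] assms by auto

lemma algebraic_int_sum:
  fixes g :: "'b \<Rightarrow> 'a::field_char_0"
  shows "(\<And>i. i \<in> I \<Longrightarrow> algebraic_int (g i)) \<Longrightarrow> algebraic_int (sum g I)"
  by (induction I rule: infinite_finite_induct) (auto intro: algebraic_int_add)

text \<open>Transitivity of integrality: the finitely many coefficients lie in one
  \<open>finring\<close>, to which the root \<open>x\<close> can be adjoined.\<close>

lemma algebraic_int_integral:
  fixes x :: "'a::field_char_0"
  assumes q: "\<And>i. algebraic_int (coeff q i)" "lead_coeff q = 1" "poly q x = 0"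
  shows "algebraic_int x"
proof -
  obtain A where A: "finring A" "coeff q ` {..degree q} \<subseteq> A"
    using finring_algebraic_ints[of "coeff q ` {..degree q}"] q(1) by auto
  have "coeff q i \<in> A" for i
  proof (cases "i \<le> degree q")
    case False
    then have "coeff q i = 0" by (simp add: coeff_eq_0)
    then show ?thesis using A zspan_zero by (auto simp: finring_def)
  qed (use A in auto)
  then obtain B where "finring B" "x \<in> B"
    using finring_adjoin[OF A(1) _ q(2,3)] by blast
  then show ?thesis using finring_algebraic_int by blast
qed

section \<open>Ideals above a prime\<close>

abbreviation int_eval :: "int poly \<Rightarrow> 'a::comm_ring_1 \<Rightarrow> 'a" where
  "int_eval g x \<equiv> poly (map_poly of_int g) x"

lemma int_eval_simps [simp]:
  "int_eval 0 x = 0" "int_eval 1 x = 1" "int_eval (pCons c g) x = of_int c + x * int_eval g x"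
  "int_eval (g + h) x = int_eval g x + int_eval h x" "int_eval (g - h) x = int_eval g x - int_eval h x" "int_eval (g * h) x = int_eval g x * int_eval h x"
  "int_eval (Polynomial.monom c k) x = of_int c * x ^ k"
  "int_eval (Polynomial.smult c g) x = of_int c * int_eval g x"
  by (simp_all add: of_int_hom.map_poly_pCons_hom of_int_poly_hom.hom_add of_int_poly_hom.hom_minus
      of_int_poly_hom.hom_mult poly_monom of_int_hom.map_poly_hom_smult map_poly_monom)

lemma int_eval_sum: "int_eval (\<Sum>i\<in>I. g i) x = (\<Sum>i\<in>I. int_eval (g i) x)"
  by (induction I rule: infinite_finite_induct) auto

lemma int_eval_pcompose: "int_eval (pcompose g h) x = int_eval g (int_eval h x)"
  by (induction g) (auto simp: pcompose_pCons)

text \<open>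
  \<open>R\<close> stands for the ring of integers of a number field of degree at most \<open>n\<close>. The degree is expressed by
  primitive integer relations, so that no vector space over the prime field is needed.
\<close>

locale p_order =
  fixes R :: "'a::field_char_0 set" and p n :: nat
  assumes prime_p: "prime p"
    and one_R [simp]: "1 \<in> R"
    and diff_R: "\<And>x y. x \<in> R \<Longrightarrow> y \<in> R \<Longrightarrow> x - y \<in> R"
    and mult_R: "\<And>x y. x \<in> R \<Longrightarrow> y \<in> R \<Longrightarrow> x * y \<in> R"
    and rank: "\<And>x :: nat \<Rightarrow> 'a. (\<And>i. i \<le> n \<Longrightarrow> x i \<in> R) \<Longrightarrow>
      \<exists>m :: nat \<Rightarrow> int. (\<exists>i\<le>n. \<not> int p dvd m i) \<and> (\<Sum>i\<le>n. of_int (m i) * x i) = 0"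
    and integrally_closed: "\<And>q t. (\<And>i. coeff q i \<in> R) \<Longrightarrow> lead_coeff q = 1 \<Longrightarrow> poly q t = 0 \<Longrightarrow>
      of_nat p * t \<in> R \<Longrightarrow> t \<in> R"
    and finite_mod: "\<exists>T. finite T \<and> T \<subseteq> R \<and> (\<forall>x\<in>R. \<exists>t\<in>T. \<exists>y\<in>R. x - t = of_nat p * y)"
    and not_inverse: "1 / of_nat p \<notin> R"
begin

lemma zero_R [simp]: "0 \<in> R"
  using diff_R[of 1 1] by simp

lemma minus_R: "x \<in> R \<Longrightarrow> - x \<in> R"
  using diff_R[of 0 x] by simp

lemma add_R: "x \<in> R \<Longrightarrow> y \<in> R \<Longrightarrow> x + y \<in> R"
  using diff_R[of x "- y"] minus_R by simp

lemma power_R: "x \<in> R \<Longrightarrow> x ^ k \<in> R"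
  by (induction k) (auto intro: mult_R)

lemma of_int_R [simp]: "of_int m \<in> R"
  using int_mult_mem[of R 1 m] add_R minus_R by simp

lemma of_nat_R [simp]: "of_nat m \<in> R"
  using of_int_R[of "int m"] by simp

lemma int_eval_R: "x \<in> R \<Longrightarrow> int_eval g x \<in> R"
  by (induction g) (auto intro!: add_R mult_R)

lemma p_pos: "p > 0" and p_gt_1: "p > 1"
  using prime_p prime_gt_0_nat prime_gt_1_nat by auto

lemma p_bezout:
  assumes "\<not> int p dvd m"
  shows "\<exists>u v. u * int p + v * m = 1"
proof -
  have "coprime (int p) m" using prime_p assms by (intro prime_imp_coprime) auto
  then show ?thesis by (metis bezout_int coprime_iff_gcd_eq_1)
qed

section \<open>Ideals containing \<open>p\<close>, and congruences modulo them\<close>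

definition pR :: "'a set" where "pR = (\<lambda>y. of_nat p * y) ` R"

definition p_ideal :: "'a set \<Rightarrow> bool" where
  "p_ideal I \<longleftrightarrow> pR \<subseteq> I \<and> I \<subseteq> R \<and> (\<forall>x\<in>I. \<forall>y\<in>I. x + y \<in> I) \<and> (\<forall>r\<in>R. \<forall>x\<in>I. r * x \<in> I)"

lemma p_idealD:
  assumes "p_ideal I"
  shows "x \<in> pR \<Longrightarrow> x \<in> I" "x \<in> I \<Longrightarrow> x \<in> R" "x \<in> I \<Longrightarrow> y \<in> I \<Longrightarrow> x + y \<in> I"
    "r \<in> R \<Longrightarrow> x \<in> I \<Longrightarrow> r * x \<in> I" "x \<in> I \<Longrightarrow> r \<in> R \<Longrightarrow> x * r \<in> I"
  using assms unfolding p_ideal_def by (auto simp: mult.commute)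

lemma p_ideal_uminus: "p_ideal I \<Longrightarrow> x \<in> I \<Longrightarrow> - x \<in> I"
  using p_idealD(4)[of I "- 1" x] minus_R[of 1] by simp

lemma p_ideal_diff: "p_ideal I \<Longrightarrow> x \<in> I \<Longrightarrow> y \<in> I \<Longrightarrow> x - y \<in> I"
  using p_idealD(3)[of I x "- y"] p_ideal_uminus[of I y] by simp

lemma p_ideal_zero: "p_ideal I \<Longrightarrow> 0 \<in> I"
  using p_idealD(1)[of I 0] zero_R unfolding pR_def image_iff by (metis mult_zero_right)

lemma p_ideal_sum: "p_ideal I \<Longrightarrow> (\<And>a. a \<in> A \<Longrightarrow> g a \<in> I) \<Longrightarrow> sum g A \<in> I"
  by (induction A rule: infinite_finite_induct) (auto simp: p_ideal_zero p_idealD(3))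

lemma p_ideal_p_mult: "p_ideal I \<Longrightarrow> y \<in> R \<Longrightarrow> of_nat p * y \<in> I"
  by (rule p_idealD(1)) (auto simp: pR_def)

lemma p_ideal_dvd: "p_ideal I \<Longrightarrow> int p dvd m \<Longrightarrow> y \<in> R \<Longrightarrow> of_int m * y \<in> I"
proof -
  assume a: "p_ideal I" "int p dvd m" "y \<in> R"
  then obtain k where "m = int p * k" by (auto elim: dvdE)
  then have *: "of_int m * y = of_nat p * (of_int k * y)" by simp
  show ?thesis unfolding * by (rule p_ideal_p_mult[OF a(1)]) (use a(3) in \<open>simp add: mult_R\<close>)
qed

lemma p_ideal_pR: "p_ideal pR"
  unfolding p_ideal_def pR_def
proof (intro conjI ballI)
  fix x y assume "x \<in> (*) (of_nat p) ` R" "y \<in> (*) (of_nat p) ` R"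
  then obtain u v where "x = of_nat p * u" "y = of_nat p * v" "u \<in> R" "v \<in> R" by auto
  then show "x + y \<in> (*) (of_nat p) ` R"
    by (intro image_eqI[of _ _ "u + v"]) (auto simp: distrib_left intro: add_R)
next
  fix r x assume "r \<in> R" "x \<in> (*) (of_nat p) ` R"
  then obtain u where "x = of_nat p * u" "u \<in> R" by auto
  then show "r * x \<in> (*) (of_nat p) ` R"
    using \<open>r \<in> R\<close> by (intro image_eqI[of _ _ "r * u"]) (auto intro: mult_R)
qed (auto intro: mult_R)

lemma one_notin_pR: "1 \<notin> pR"
proof
  assume "1 \<in> pR"
  then obtain y where y: "y \<in> R" "1 = of_nat p * y" unfolding pR_def by blast
  then have "y = 1 / of_nat p" using p_pos by (simp add: field_simps)
  then show False using not_inverse y by simp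
qed

lemma of_int_in_p_ideal:
  assumes "p_ideal I" "1 \<notin> I"
  shows "of_int m \<in> I \<longleftrightarrow> int p dvd m"
proof
  assume m: "of_int m \<in> I"
  show "int p dvd m"
  proof (rule ccontr)
    assume "\<not> int p dvd m"
    then have "coprime (int p) m" using prime_p by (intro prime_imp_coprime) auto
    then obtain u v where "u * int p + v * m = 1"
      by (metis bezout_int coprime_iff_gcd_eq_1)
    then have "(1 :: 'a) = of_int (int p * u + v * m)" by (simp add: mult.commute)
    also have "\<dots> = of_nat p * of_int u + of_int v * of_int m" by simp
    also have "\<dots> \<in> I" using m by (intro p_idealD(3,4)[OF assms(1)] p_ideal_p_mult[OF assms(1)]) auto
    finally show False using assms(2) by simp
  qed
qed (use p_ideal_dvd[OF assms(1), of m 1] in simp)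

lemma p_ideal_cong_trans: "p_ideal I \<Longrightarrow> x - y \<in> I \<Longrightarrow> y - z \<in> I \<Longrightarrow> x - z \<in> I"
  using p_idealD(3)[of I "x - y" "y - z"] by simp

lemma p_ideal_cong_mem: "p_ideal I \<Longrightarrow> x - y \<in> I \<Longrightarrow> x \<in> I \<longleftrightarrow> y \<in> I"
  using p_ideal_diff[of I x "x - y"] p_idealD(3)[of I "x - y" y] by auto

lemma p_ideal_cong_mult:
  assumes "p_ideal I" "x - x' \<in> I" "y - y' \<in> I" "x \<in> R" "y' \<in> R"
  shows "x * y - x' * y' \<in> I"
proof -
  have "x * y - x' * y' = x * (y - y') + (x - x') * y'" by (simp add: algebra_simps)
  then show ?thesis using assms by (simp add: p_idealD(3-5))
qed

lemma p_ideal_cong_power: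
  assumes "p_ideal I" "x - x' \<in> I" "x \<in> R" "x' \<in> R"
  shows "x ^ k - x' ^ k \<in> I"
  by (induction k) (use assms in \<open>auto intro!: p_ideal_cong_mult p_ideal_zero power_R\<close>)

lemma p_ideal_cong_int_eval:
  assumes "p_ideal I" "x - y \<in> I" "x \<in> R" "y \<in> R"
  shows "int_eval g x - int_eval g y \<in> I"
proof (induction g)
  case (pCons c g)
  then show ?case using p_ideal_cong_mult[OF assms(1,2) _ assms(3), of "int_eval g x" "int_eval g y"] assms
    by (auto simp: int_eval_R)
qed (use assms in \<open>auto intro: p_ideal_zero\<close>)

lemma p_ideal_adjoin:
  assumes I: "p_ideal I" and x: "x \<in> R"
  shows "p_ideal {i + x * r | i r. i \<in> I \<and> r \<in> R}" (is "p_ideal ?J")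
  unfolding p_ideal_def
proof (intro conjI ballI)
  have "u \<in> ?J" if "u \<in> I" for u
    using that by (intro CollectI exI[of _ u] exI[of _ 0]) simp
  then show "pR \<subseteq> ?J" using p_idealD(1)[OF I] by blast
  show "?J \<subseteq> R" using p_idealD(2)[OF I] x by (auto intro!: add_R mult_R)
  fix u assume u: "u \<in> ?J"
  then obtain i r where ir: "u = i + x * r" "i \<in> I" "r \<in> R" by auto
  {
    fix v assume "v \<in> ?J"
    then obtain j s where "v = j + x * s" "j \<in> I" "s \<in> R" by auto
    then show "u + v \<in> ?J" using ir
      by (intro CollectI exI[of _ "i + j"] exI[of _ "r + s"])
         (auto simp: algebra_simps intro: p_idealD(3)[OF I] add_R)
  }
  fix s assume s: "s \<in> R"
  have "s * u = s * i + x * (s * r)" using ir by (simp add: algebra_simps)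
  moreover have "s * i \<in> I" "s * r \<in> R" using ir s p_idealD(4)[OF I] mult_R by auto
  ultimately show "s * u \<in> ?J" by blast
qed

section \<open>Maximal ideals over \<open>p\<close> and Chinese remainders\<close>

lemma finite_p_ideals: "finite {I. p_ideal I}"
proof -
  obtain T where T: "finite T" "T \<subseteq> R" "\<And>x. x \<in> R \<Longrightarrow> \<exists>t\<in>T. \<exists>y\<in>R. x - t = of_nat p * y"
    using finite_mod by metis
  \<comment> \<open>An ideal containing \<open>pR\<close> is determined by the representatives of R
    / pR that it contains.\<close>
  have sub: "I \<subseteq> I'" if I: "p_ideal I" "p_ideal I'" "I \<inter> T = I' \<inter> T" for I I'
  proof
    fix x assume x: "x \<in> I"
    obtain t y where t: "t \<in> T" "y \<in> R" "x - t = of_nat p * y"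
      using T(3)[OF p_idealD(2)[OF I(1) x]] by auto
    then have "x - t \<in> I" "x - t \<in> I'" using p_ideal_p_mult I by auto
    then show "x \<in> I'" using p_ideal_cong_mem I t x by blast
  qed
  have "inj_on (\<lambda>I. I \<inter> T) {I. p_ideal I}"
    by (intro inj_onI) (use sub in blast)
  moreover have "(\<lambda>I. I \<inter> T) ` {I. p_ideal I} \<subseteq> Pow T" by auto
  ultimately show ?thesis using T(1) by (meson finite_Pow_iff finite_imageD finite_subset)
qed

text \<open>Maximality is encoded as invertibility of every element outside \<open>P\<close> modulo
  \<open>P\<close>, the form in which it is used throughout. These are the primes of
  \<open>R\<close> above \<open>p\<close>.\<close>

definition max_ideals :: "'a set set" where
  "max_ideals = {P. p_ideal P \<and> 1 \<notin> P \<and> (\<forall>x\<in>R. x \<notin> P \<longrightarrow> (\<exists>y\<in>R. 1 - x * y \<in> P))}"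

lemma max_ideal_p_ideal: "P \<in> max_ideals \<Longrightarrow> p_ideal P" and max_ideal_one: "P \<in> max_ideals \<Longrightarrow> 1 \<notin> P"
  and max_ideal_inverse: "P \<in> max_ideals \<Longrightarrow> x \<in> R \<Longrightarrow> x \<notin> P \<Longrightarrow> \<exists>y\<in>R. 1 - x * y \<in> P"
  by (auto simp: max_ideals_def)

lemma finite_max_ideals: "finite max_ideals"
  by (rule finite_subset[OF _ finite_p_ideals]) (auto simp: max_ideals_def)

lemma max_ideal_exists:
  assumes "p_ideal I" "1 \<notin> I"
  shows "\<exists>P\<in>max_ideals. I \<subseteq> P"
proof -
  have fin: "finite {J. p_ideal J \<and> 1 \<notin> J}" by (rule finite_subset[OF _ finite_p_ideals]) auto
  obtain P where P: "p_ideal P" "1 \<notin> P" "I \<subseteq> P" and max: "\<And>J. p_ideal J \<Longrightarrow> 1 \<notin> J \<Longrightarrow> P \<subseteq> J \<Longrightarrow> P = J"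
    using finite_has_maximal2[OF fin, of I] assms by auto
  have "\<exists>y\<in>R. 1 - x * y \<in> P" if x: "x \<in> R" "x \<notin> P" for x
  proof -
    define J where "J = {i + x * r | i r. i \<in> P \<and> r \<in> R}"
    have "p_ideal J" unfolding J_def by (rule p_ideal_adjoin[OF P(1) x(1)])
    moreover have "u \<in> J" if "u \<in> P" for u
      unfolding J_def using that by (intro CollectI exI[of _ u] exI[of _ 0]) simp
    moreover have "x \<in> J"
      unfolding J_def using p_ideal_zero[OF P(1)] by (intro CollectI exI[of _ 0] exI[of _ 1]) simp
    ultimately have "1 \<in> J" using max[of J] x(2) by blast
    then obtain i r where ir: "i \<in> P" "r \<in> R" "1 = i + x * r" unfolding J_def by blast
    then have "1 - x * r = i" by (metis add_diff_cancel_right')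
    then show ?thesis using ir by (intro bexI[of _ r]) simp_all
  qed
  then show ?thesis using P by (auto simp: max_ideals_def)
qed

lemma p_ideal_eq_R:
  assumes "p_ideal I" "\<And>P. P \<in> max_ideals \<Longrightarrow> \<not> I \<subseteq> P"
  shows "1 \<in> I"
  using max_ideal_exists assms by blast

lemma max_ideal_prime:
  assumes P: "P \<in> max_ideals" and "x \<in> R" "y \<in> R" "x * y \<in> P"
  shows "x \<in> P \<or> y \<in> P"
proof (rule disjCI)
  assume "y \<notin> P"
  then obtain z where z: "z \<in> R" "1 - y * z \<in> P" using max_ideal_inverse[OF P] assms by blast
  have "x = x * (1 - y * z) + (x * y) * z" by (simp add: algebra_simps)
  then show "x \<in> P" using z assms p_idealD[OF max_ideal_p_ideal[OF P]] by metis
qed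

lemma max_ideal_power: "P \<in> max_ideals \<Longrightarrow> x \<in> R \<Longrightarrow> x ^ k \<in> P \<Longrightarrow> x \<in> P"
  by (induction k) (auto simp: max_ideal_one dest: max_ideal_prime intro: power_R)

lemma max_ideal_subset_eq:
  assumes "P \<in> max_ideals" "P' \<in> max_ideals" "P' \<subseteq> P"
  shows "P' = P"
proof (rule ccontr)
  assume "P' \<noteq> P"
  then obtain x where x: "x \<in> P" "x \<notin> P'" using assms by auto
  then obtain y where y: "y \<in> R" "1 - x * y \<in> P'"
    using max_ideal_inverse[OF assms(2)] p_idealD(2)[OF max_ideal_p_ideal[OF assms(1)]] by blast
  then have "1 - x * y \<in> P" "x * y \<in> P" using assms x p_idealD(5)[OF max_ideal_p_ideal[OF assms(1)]] by auto
  then have "1 \<in> P" using p_idealD(3)[OF max_ideal_p_ideal[OF assms(1)], of "1 - x * y" "x * y"] by simp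
  then show False using max_ideal_one assms by auto
qed

text \<open>For each member of \<open>F\<close> some element of it avoids \<open>P\<close>; the
  product of these elements avoids \<open>P\<close> because \<open>P\<close> is prime.\<close>

lemma max_ideal_separate:
  assumes "finite F" "F \<subseteq> max_ideals" "P \<in> max_ideals" "P \<notin> F"
  shows "\<exists>e\<in>R. e \<notin> P \<and> (\<forall>P'\<in>F. e \<in> P')"
  using assms
proof (induction F rule: finite_induct)
  case empty
  then show ?case using max_ideal_one by (intro bexI[of _ 1]) auto
next
  case (insert Q F)
  obtain e where e: "e \<in> R" "e \<notin> P" "\<forall>P'\<in>F. e \<in> P'" using insert by auto
  obtain x where x: "x \<in> Q" "x \<notin> P" using max_ideal_subset_eq[of P Q] insert by auto
  have "x \<in> R" using x insert p_idealD(2)[OF max_ideal_p_ideal] by auto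
  then show ?case using x e insert max_ideal_prime[of P x e] p_idealD(4,5)[OF max_ideal_p_ideal]
    by (intro bexI[of _ "x * e"]) (auto intro: mult_R)
qed

lemma max_ideal_separate_one:
  assumes "finite F" "F \<subseteq> max_ideals" "P \<in> max_ideals" "P \<notin> F"
  shows "\<exists>e\<in>R. 1 - e \<in> P \<and> (\<forall>P'\<in>F. e \<in> P')"
proof -
  obtain e where e: "e \<in> R" "e \<notin> P" "\<forall>P'\<in>F. e \<in> P'" using max_ideal_separate[OF assms] by auto
  obtain y where "y \<in> R" "1 - e * y \<in> P" using max_ideal_inverse[OF assms(3) e(1,2)] by auto
  then show ?thesis using e assms(2) p_idealD(5)[OF max_ideal_p_ideal]
    by (intro bexI[of _ "e * y"]) (auto intro: mult_R)
qed

section \<open>Residue degrees sum to at most \<open>n\<close>\<close>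

lemma rank_finite:
  assumes "finite I" "card I > n" "\<And>i. i \<in> I \<Longrightarrow> x i \<in> R"
  shows "\<exists>m :: 'i \<Rightarrow> int. (\<exists>i\<in>I. \<not> int p dvd m i) \<and> (\<Sum>i\<in>I. of_int (m i) * x i) = 0"
proof -
  obtain I' where I': "I' \<subseteq> I" "card I' = Suc n"
    using assms(2) by (meson Suc_leI obtain_subset_with_card_n)
  then have fI': "finite I'" using assms(1) finite_subset by auto
  obtain f where "bij_betw f {0..<card I'} I'"
    using ex_bij_betw_nat_finite[OF fI'] by auto
  then have f: "bij_betw f {..n} I'" by (simp add: I'(2) atLeast0LessThan lessThan_Suc_atMost)
  have "x (f i) \<in> R" if "i \<le> n" for i
    using that f I'(1) assms(3) by (auto simp: bij_betw_def)
  then obtain m :: "nat \<Rightarrow> int" where m: "\<exists>i\<le>n. \<not> int p dvd m i"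
    "(\<Sum>i\<le>n. of_int (m i) * x (f i)) = 0"
    using rank[of "\<lambda>i. x (f i)"] by auto
  define g where "g = (\<lambda>i. if i \<in> I' then m (the_inv_into {..n} f i) else 0)"
  have inj: "inj_on f {..n}" using f by (simp add: bij_betw_def)
  have g: "g (f i) = m i" if "i \<le> n" for i
    using that f by (auto simp: g_def the_inv_into_f_f[OF inj] bij_betw_def)
  have "(\<Sum>i\<in>I. of_int (g i) * x i) = (\<Sum>i\<in>I'. of_int (g i) * x i)"
    by (rule sum.mono_neutral_right) (use I' assms in \<open>auto simp: g_def\<close>)
  also have "\<dots> = (\<Sum>i\<le>n. of_int (g (f i)) * x (f i))"
    by (rule sum.reindex_bij_betw[OF f, symmetric])
  also have "\<dots> = 0" using m(2) g by simp
  finally have "(\<Sum>i\<in>I. of_int (g i) * x i) = 0" .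
  moreover have "\<exists>i\<in>I. \<not> int p dvd g i"
    using m(1) g f I'(1) unfolding bij_betw_def by (metis atMost_iff image_eqI subsetD)
  ultimately show ?thesis by blast
qed

text \<open>Linear independence of 1, s, ..., s^(d-1) over the prime field modulo \<open>P\<close>,
  phrased with integer polynomials. For maximal \<open>P\<close> it says that the residue of
  \<open>s\<close> has a minimal polynomial of degree at least \<open>d\<close>; it is also used
  with \<open>pR\<close> in place of \<open>P\<close>.\<close>

definition indep :: "nat \<Rightarrow> 'a \<Rightarrow> 'a set \<Rightarrow> bool" where
  "indep d s P \<longleftrightarrow> (\<forall>g. degree g < d \<longrightarrow> int_eval g s \<in> P \<longrightarrow> (\<forall>i. int p dvd coeff g i))"

text \<open>With \<open>e P\<close> outside \<open>P\<close> but inside the other members of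
  \<open>F\<close>, more than \<open>n\<close> elements \<open>e P * s P ^ i\<close> would satisfy a
  primitive relation. Modulo \<open>P\<close> only the block belonging to \<open>P\<close> survives,
  and independence makes \<open>p\<close> divide all its coefficients.\<close>

lemma card_mult_indep_le:
  assumes F: "finite F" "F \<subseteq> max_ideals" and s: "\<And>P. P \<in> F \<Longrightarrow> s P \<in> R" "\<And>P. P \<in> F \<Longrightarrow> indep d (s P) P"
  shows "card F * d \<le> n"
proof (rule ccontr)
  assume "\<not> card F * d \<le> n"
  then have card: "card (F \<times> {..<d}) > n" by (simp add: card_cartesian_product)
  then have d: "d > 0" by (cases d) auto
  have "\<exists>e\<in>R. e \<notin> P \<and> (\<forall>P'\<in>F - {P}. e \<in> P')" if "P \<in> F" for P
    using max_ideal_separate[of "F - {P}" P] F that by auto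
  then obtain e where e: "\<And>P. P \<in> F \<Longrightarrow> e P \<in> R" "\<And>P. P \<in> F \<Longrightarrow> e P \<notin> P"
    "\<And>P P'. P \<in> F \<Longrightarrow> P' \<in> F \<Longrightarrow> P' \<noteq> P \<Longrightarrow> e P \<in> P'"
    by (metis Diff_iff singletonD)
  have R: "(case z of (P, i) \<Rightarrow> e P * s P ^ i) \<in> R" if "z \<in> F \<times> {..<d}" for z
    using that e s by (auto intro!: mult_R power_R)
  obtain m where m: "\<exists>z\<in>F \<times> {..<d}. \<not> int p dvd m z"
    "(\<Sum>z\<in>F \<times> {..<d}. of_int (m z) * (case z of (P, i) \<Rightarrow> e P * s P ^ i)) = 0"
    using rank_finite[OF _ card, of "\<lambda>(P, i). e P * s P ^ i"] R F(1) by blast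
  obtain P j where Pj: "P \<in> F" "j < d" "\<not> int p dvd m (P, j)" using m(1) by auto
  define g where "g Q = (\<Sum>i<d. Polynomial.monom (m (Q, i)) i)" for Q
  have cg: "coeff (g Q) i = (if i < d then m (Q, i) else 0)" for Q i
    by (simp add: g_def coeff_sum coeff_monom)
  have dg: "degree (g Q) < d" for Q
    using d by (intro degree_lessI) (auto simp: cg)
  have evg: "e Q * int_eval (g Q) (s Q) = (\<Sum>i<d. of_int (m (Q, i)) * (e Q * s Q ^ i))" for Q
    unfolding g_def int_eval_sum sum_distrib_left by (intro sum.cong) (simp_all add: poly_monom)
  have PI: "p_ideal P" "P \<in> max_ideals" using Pj F max_ideal_p_ideal by auto
  have "0 = (\<Sum>Q\<in>F. \<Sum>i<d. of_int (m (Q, i)) * (e Q * s Q ^ i))"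
    using m(2) by (simp add: sum.cartesian_product case_prod_unfold)
  also have "\<dots> = (\<Sum>Q\<in>F. e Q * int_eval (g Q) (s Q))" by (simp add: evg)
  also have "\<dots> = e P * int_eval (g P) (s P) + (\<Sum>Q\<in>F - {P}. e Q * int_eval (g Q) (s Q))"
    using F(1) Pj(1) by (simp add: sum.remove)
  finally have "e P * int_eval (g P) (s P) = - (\<Sum>Q\<in>F - {P}. e Q * int_eval (g Q) (s Q))"
    by (simp add: eq_neg_iff_add_eq_0)
  also have "\<dots> \<in> P"
    by (intro p_ideal_uminus p_ideal_sum PI) (use e s PI Pj F in \<open>auto intro!: p_idealD(5)[OF PI(1)] int_eval_R\<close>)
  finally have "int_eval (g P) (s P) \<in> P"
    using max_ideal_prime[OF PI(2) e(1)[OF Pj(1)] int_eval_R[OF s(1)[OF Pj(1)]]] e(2)[OF Pj(1)] by blast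
  then have "int p dvd coeff (g P) j" using s(2)[OF Pj(1)] dg[of P] by (auto simp: indep_def)
  then show False using Pj by (simp add: cg)
qed

lemma indep_one: "P \<in> max_ideals \<Longrightarrow> indep 1 s P"
  unfolding indep_def
proof (intro allI impI)
  fix g i assume P: "P \<in> max_ideals" and g: "degree g < 1" "int_eval g s \<in> P"
  then obtain c where c: "g = [:c:]" by (metis degree_eq_zeroE less_one)
  then have "int p dvd c" using g of_int_in_p_ideal[OF max_ideal_p_ideal[OF P] max_ideal_one[OF P]] by simp
  then show "int p dvd coeff g i" using c by (simp add: coeff_pCons split: nat.splits)
qed

end

section \<open>Generators modulo a prime\<close>

lemma int_eval_of_int: "int_eval g (of_int m) = of_int (poly g m)"
  by (induction g) auto

text \<open>\<open>m\<close> is only a bound on the degree, so that a vanishing top coefficient is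
  allowed and the induction on \<open>pCons\<close> goes through.\<close>

lemma coeff_pcompose_shift:
  fixes g :: "int poly"
  assumes "degree g \<le> m"
  shows "coeff (pcompose g [:c, 1:]) m = coeff g m \<and>
    (m > 0 \<longrightarrow> coeff (pcompose g [:c, 1:]) (m - 1) = coeff g (m - 1) + int m * c * coeff g m)"
  using assms
proof (induction g arbitrary: m)
  case 0
  then show ?case by simp
next
  case (pCons a g)
  define G where "G = pcompose g [:c, 1:]"
  have G: "pcompose (pCons a g) [:c, 1:] = [:a:] + Polynomial.smult c G + pCons 0 G"
    by (simp add: pcompose_pCons G_def)
  show ?case
  proof (cases m)
    case 0
    then have "g = 0" using pCons.prems by (cases "g = 0") auto
    then show ?thesis using 0 by simp
  next
    case (Suc k)
    have dg: "degree g \<le> k" using pCons.prems Suc by (cases "g = 0") auto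
    have dG: "degree G \<le> k" using dg by (simp add: G_def)
    have 1: "coeff G k = coeff g k" "k > 0 \<Longrightarrow> coeff G (k - 1) = coeff g (k - 1) + int k * c * coeff g k"
      using pCons.IH[OF dg] by (auto simp: G_def)
    have "coeff G (Suc k) = 0" using dG by (simp add: coeff_eq_0)
    then show ?thesis
      unfolding G using 1 Suc by (cases k) (auto simp: algebra_simps)
  qed
qed

context p_order
begin

section \<open>Generators of residue fields and their translates\<close>

definition generates :: "'a set \<Rightarrow> 'a \<Rightarrow> bool" where
  "generates P s \<longleftrightarrow> (\<forall>x\<in>R. \<exists>g. x - int_eval g s \<in> P)"

definition degree_one :: "'a set \<Rightarrow> bool" where
  "degree_one P \<longleftrightarrow> (\<forall>x\<in>R. \<exists>m::int. x - of_int m \<in> P)"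

text \<open>The residue field is finite, so its multiplicative group is cyclic; a lift of a group
  generator has every nonzero residue among its powers.\<close>

lemma residue_generator:
  assumes P: "P \<in> max_ideals"
  shows "\<exists>s\<in>R. generates P s"
proof -
  have PI: "p_ideal P" and P1: "1 \<notin> P" using P max_ideal_p_ideal max_ideal_one by auto
  define S :: "'a ring" where "S = ring_of_type_algebra\<lparr>carrier := R\<rparr>"
  have S [simp]: "carrier S = R" "x \<otimes>\<^bsub>S\<^esub> y = x * y" "x \<oplus>\<^bsub>S\<^esub> y = x + y" "\<one>\<^bsub>S\<^esub> = 1" "\<zero>\<^bsub>S\<^esub> = 0" for x y
    by (auto simp: S_def ring_of_type_algebra_def)
  interpret S: cring S
  proof (rule cringI)
    show "abelian_group S"
      by (rule abelian_groupI) (auto intro: add_R minus_R bexI[of _ "- _"] simp: add_ac)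
    show "comm_monoid S" by (rule comm_monoidI) (auto intro: mult_R simp: mult_ac)
  qed (auto simp: algebra_simps)
  have inv: "\<ominus>\<^bsub>S\<^esub> x = - x" if "x \<in> R" for x
    by (rule S.minus_equality) (use that in \<open>auto intro: minus_R\<close>)
  have "ideal P S"
  proof (rule idealI)
    show "ring S" by (rule S.ring_axioms)
    show "subgroup P (add_monoid S)"
    proof (rule S.add.subgroupI)
      show "P \<noteq> {}" using p_ideal_zero[OF PI] by auto
      show "\<ominus>\<^bsub>S\<^esub> x \<in> P" if "x \<in> P" for x
        using that p_ideal_uminus[OF PI] p_idealD(2)[OF PI] by (simp add: inv)
    qed (use p_idealD(2,3)[OF PI] in auto)
  qed (use p_idealD(4,5)[OF PI] in auto)
  then have "maximalideal P S"
  proof (rule maximalidealI)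
    show "carrier S \<noteq> P" using P1 by auto
    fix J assume J: "ideal J S" "P \<subseteq> J" "J \<subseteq> carrier S"
    interpret J: ideal J S by (rule J)
    show "J = P \<or> J = carrier S"
    proof (rule disjCI)
      assume "J \<noteq> carrier S"
      show "J = P"
      proof (rule ccontr)
        assume "J \<noteq> P"
        then obtain x where x: "x \<in> J" "x \<notin> P" using J by auto
        then obtain y where y: "y \<in> R" "1 - x * y \<in> P" using max_ideal_inverse[OF P] J(3) by auto
        have "x * y \<in> J" using J.I_r_closed[OF x(1)] y(1) by simp
        then have "(1 - x * y) + x * y \<in> J" using J.a_closed[of "1 - x * y" "x * y"] y J(2) by auto
        then have "1 \<in> J" by simp
        then show False using J.one_imp_carrier \<open>J \<noteq> carrier S\<close> by simp
      qed
    qed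
  qed
  then interpret M: maximalideal P S .
  interpret F: field "S Quot P" by (rule M.quotient_is_field[OF S.cring_axioms])
  interpret h: ring_hom_ring S "S Quot P" "(+>\<^bsub>S\<^esub>) P" by (rule M.rcos_ring_hom_ring)
  obtain T where T: "finite T" "T \<subseteq> R" "\<And>x. x \<in> R \<Longrightarrow> \<exists>t\<in>T. \<exists>y\<in>R. x - t = of_nat p * y"
    using finite_mod by metis
  have coset_eq: "P +>\<^bsub>S\<^esub> x = P +>\<^bsub>S\<^esub> y \<longleftrightarrow> x - y \<in> P" if "x \<in> R" "y \<in> R" for x y
  proof -
    have "P +>\<^bsub>S\<^esub> x = P +>\<^bsub>S\<^esub> y \<longleftrightarrow> x \<ominus>\<^bsub>S\<^esub> y \<in> P"
      using that S.quotient_eq_iff_same_a_r_cos[OF M.ideal_axioms, of x y] by auto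
    then show ?thesis using that by (simp add: a_minus_def inv)
  qed
  have carr: "carrier (S Quot P) = (\<lambda>x. P +>\<^bsub>S\<^esub> x) ` R"
    by (auto simp: FactRing_def A_RCOSETS_def')
  have "carrier (S Quot P) \<subseteq> (\<lambda>x. P +>\<^bsub>S\<^esub> x) ` T"
  proof
    fix A assume "A \<in> carrier (S Quot P)"
    then obtain x where x: "x \<in> R" "A = P +>\<^bsub>S\<^esub> x" using carr by auto
    obtain t y where "t \<in> T" "y \<in> R" "x - t = of_nat p * y" using T(3)[OF x(1)] by auto
    then have "x - t \<in> P" "t \<in> R" "t \<in> T" using p_ideal_p_mult[OF PI] T(2) by auto
    then show "A \<in> (\<lambda>x. P +>\<^bsub>S\<^esub> x) ` T" using coset_eq[of x t] x by simp
  qed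
  then have "finite (carrier (S Quot P))" by (rule finite_subset) (use T(1) in simp)
  from F.finite_field_mult_group_has_gen[OF this]
  obtain A where A: "A \<in> carrier (mult_of (S Quot P))"
    "carrier (mult_of (S Quot P)) = {A [^]\<^bsub>S Quot P\<^esub> i | i::nat. i \<in> UNIV}" by (elim bexE)
  obtain s where s: "s \<in> R" "A = P +>\<^bsub>S\<^esub> s" using A(1) carr by (auto simp: Multiplicative_Group.mult_of_def)
  have pow: "s [^]\<^bsub>S\<^esub> (i::nat) = s ^ i" for i
    by (induction i) auto
  have "\<exists>g. x - int_eval g s \<in> P" if x: "x \<in> R" for x
  proof (cases "x \<in> P")
    case True
    then show ?thesis by (intro exI[of _ 0]) simp
  next
    case False
    have "P +>\<^bsub>S\<^esub> x \<noteq> \<zero>\<^bsub>S Quot P\<^esub>"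
      using coset_eq[OF x zero_R] False h.hom_zero by auto
    then have "P +>\<^bsub>S\<^esub> x \<in> carrier (mult_of (S Quot P))"
      using x carr by (auto simp: Multiplicative_Group.mult_of_def)
    then obtain i :: nat where "P +>\<^bsub>S\<^esub> x = A [^]\<^bsub>S Quot P\<^esub> i" unfolding A(2) by blast
    also have "\<dots> = P +>\<^bsub>S\<^esub> (s [^]\<^bsub>S\<^esub> i)" using h.hom_nat_pow[of s i] s by simp
    finally have "x - s ^ i \<in> P" using coset_eq[OF x, of "s ^ i"] s pow by (simp add: power_R)
    then show ?thesis by (intro exI[of _ "Polynomial.monom 1 i"]) (simp add: poly_monom)
  qed
  then show ?thesis using s(1) unfolding generates_def by blast
qed

lemma generates_cong: "p_ideal P \<Longrightarrow> generates P s \<Longrightarrow> s - t \<in> P \<Longrightarrow> s \<in> R \<Longrightarrow> t \<in> R \<Longrightarrow> generates P t"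
  unfolding generates_def using p_ideal_cong_trans p_ideal_cong_int_eval by blast

lemma generates_shift: "generates P s \<Longrightarrow> generates P (s + of_int c)"
  unfolding generates_def
proof
  fix x assume "\<forall>x\<in>R. \<exists>g. x - int_eval g s \<in> P" "x \<in> R"
  then obtain g where g: "x - int_eval g s \<in> P" by auto
  have "int_eval (pcompose g [:- c, 1:]) (s + of_int c) = int_eval g s" by (simp add: int_eval_pcompose)
  then show "\<exists>g. x - int_eval g (s + of_int c) \<in> P" using g by metis
qed

lemma degree_oneI_generates:
  assumes P: "p_ideal P" and s: "s \<in> R" "generates P s" "s - of_int m \<in> P"
  shows "degree_one P"
  unfolding degree_one_def
proof
  fix x assume x: "x \<in> R"
  then obtain g where g: "x - int_eval g s \<in> P" using s by (auto simp: generates_def)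
  have "int_eval g s - int_eval g (of_int m) \<in> P" by (rule p_ideal_cong_int_eval[OF P s(3,1)]) simp
  then have "x - int_eval g (of_int m) \<in> P" by (rule p_ideal_cong_trans[OF P g])
  then show "\<exists>m::int. x - of_int m \<in> P" unfolding int_eval_of_int by blast
qed

text \<open>A relation of degree at most one with leading coefficient prime to \<open>p\<close>
  would make \<open>s\<close> congruent to an integer, and \<open>P\<close> would have degree
  one.\<close>

lemma indep_two:
  assumes P: "P \<in> max_ideals" and s: "s \<in> R" "generates P s" and ns: "\<not> degree_one P"
  shows "indep 2 s P"
  unfolding indep_def
proof (intro allI impI)
  fix g i assume g: "degree g < 2" "int_eval g s \<in> P"
  have PI: "p_ideal P" and P1: "1 \<notin> P" using P max_ideal_p_ideal max_ideal_one by auto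
  define a b where "a = coeff g 0" and "b = coeff g 1"
  have gab: "g = [:a, b:]"
    using g(1) by (intro poly_eqI) (auto simp: a_def b_def coeff_pCons coeff_eq_0 split: nat.splits)
  have ab: "of_int a + s * of_int b \<in> P" using g(2) by (simp add: gab)
  have b: "int p dvd b"
  proof (rule ccontr)
    assume "\<not> int p dvd b"
    then obtain u v where uv: "u * int p + v * b = 1" using p_bezout by blast
    have "s - of_int (- (v * a)) = of_int (u * int p + v * b) * s + of_int (v * a)"
      unfolding uv by simp
    also have "\<dots> = of_nat p * (of_int u * s) + of_int v * (of_int a + s * of_int b)"
      by (simp add: algebra_simps)
    also have "\<dots> \<in> P"
      by (rule p_idealD(3)[OF PI p_ideal_p_mult[OF PI] p_idealD(4)[OF PI _ ab]]) (use s in \<open>auto intro: mult_R\<close>)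
    finally show False using degree_oneI_generates[OF PI s] ns by blast
  qed
  then have "of_int b * s \<in> P" using p_ideal_dvd[OF PI _ s(1)] by simp
  then have "of_int a \<in> P" using p_ideal_diff[OF PI ab, of "of_int b * s"] by (simp add: mult.commute)
  then have "int p dvd a" using of_int_in_p_ideal[OF PI P1] by simp
  then show "int p dvd coeff g i" using b by (auto simp: gab coeff_pCons split: nat.splits)
qed

text \<open>
  The difference \<open>g(X + c) - g\<close> has smaller degree than \<open>g\<close>, and its leading coefficient is the one of \<open>g\<close>
  multiplied by \<open>c\<close> and the degree, both prime to \<open>p\<close>.
\<close>

lemma indep_shift_invariant:
  assumes P: "P \<in> max_ideals" and s: "s \<in> R" and c: "\<not> int p dvd c"
    and inv: "\<And>g. int_eval g s \<in> P \<Longrightarrow> int_eval g (s + of_int c) \<in> P"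
  shows "indep p s P"
proof -
  have PI: "p_ideal P" and P1: "1 \<notin> P" using P max_ideal_p_ideal max_ideal_one by auto
  have "int p dvd coeff g i" if "degree g \<le> m" "m < p" "int_eval g s \<in> P" for g m i
    using that
  proof (induction m arbitrary: g i)
    case 0
    then show ?case using indep_one[OF P, of s] unfolding indep_def by auto
  next
    case (Suc m)
    define h where "h = pcompose g [:c, 1:] - g"
    define l where "l = coeff g (Suc m)"
    have cs: "coeff (pcompose g [:c, 1:]) (Suc m) = l"
      "coeff (pcompose g [:c, 1:]) m = coeff g m + int (Suc m) * c * l"
      using coeff_pcompose_shift[OF Suc.prems(1), of c] by (auto simp: l_def)
    have "degree h \<le> Suc m" unfolding h_def
      by (rule degree_diff_le) (use Suc.prems in auto)
    moreover have "coeff h (Suc m) = 0" by (simp add: h_def cs l_def)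
    ultimately have "degree h \<le> m"
      by (metis coeff_0 degree_0 le_SucE leading_coeff_0_iff zero_le)
    moreover have "int_eval h s \<in> P"
      using p_ideal_diff[OF PI inv[OF Suc.prems(3)] Suc.prems(3)]
      by (simp add: h_def int_eval_pcompose add.commute)
    ultimately have "int p dvd coeff h m" using Suc.IH Suc.prems(2) by auto
    \<comment> \<open>The two copies of \<open>coeff g m\<close> cancel. Of the remaining factors,
      \<open>c\<close> is prime to \<open>p\<close> by assumption and \<open>Suc m\<close> because
      it is positive and below \<open>p\<close>.\<close>
    then have "int p dvd int (Suc m) * c * l" by (simp only: h_def coeff_diff cs) simp
    then have l: "int p dvd l"
      using prime_p c Suc.prems(2) by (auto simp: prime_dvd_mult_iff simp del: of_nat_Suc dest: dvd_imp_le)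
    \<comment> \<open>Removing a leading term divisible by \<open>p\<close> keeps the value in
      \<open>P\<close> and lowers the degree bound.\<close>
    define g' where "g' = g - Polynomial.monom l (Suc m)"
    have "degree g' \<le> Suc m" unfolding g'_def
      by (rule degree_diff_le) (use Suc.prems degree_monom_le in auto)
    moreover have "coeff g' (Suc m) = 0" by (simp add: g'_def l_def)
    ultimately have dg: "degree g' \<le> m"
      by (metis coeff_0 degree_0 le_SucE leading_coeff_0_iff zero_le)
    have "int_eval g' s \<in> P"
      using p_ideal_diff[OF PI Suc.prems(3) p_ideal_dvd[OF PI l power_R[OF s, of "Suc m"]]]
      by (simp add: g'_def poly_monom)
    then have "int p dvd coeff g' i" using Suc.IH[OF dg] Suc.prems(2) by auto
    then show ?case using l by (auto simp: g'_def l_def coeff_monom split: if_splits)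
  qed
  note * = this
  show ?thesis unfolding indep_def
  proof (intro allI impI)
    fix g i assume "degree g < p" "int_eval g s \<in> P"
    then show "int p dvd coeff g i" using *[of g "degree g"] by simp
  qed
qed

text \<open>As \<open>s\<close> generates the residue field, the integer polynomials with value in
  \<open>P\<close> at \<open>s\<close> form a maximal ideal, so an inclusion of such kernels is an
  equality. Concretely, the inverse of \<open>int_eval g s\<close> modulo \<open>P\<close> is again
  a polynomial in \<open>s\<close>, and \<open>1 - g * h\<close> is carried over to
  \<open>t\<close>.\<close>

lemma equivalent_if_subset:
  assumes P: "P \<in> max_ideals" "Q \<in> max_ideals" and s: "s \<in> R" "t \<in> R" "generates P s"
    and sub: "\<And>g. int_eval g s \<in> P \<Longrightarrow> int_eval g t \<in> Q"
  shows "int_eval g s \<in> P \<longleftrightarrow> int_eval g t \<in> Q"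
proof
  assume t: "int_eval g t \<in> Q"
  show "int_eval g s \<in> P"
  proof (rule ccontr)
    assume "int_eval g s \<notin> P"
    then obtain y where y: "y \<in> R" "1 - int_eval g s * y \<in> P" using max_ideal_inverse[OF P(1)] int_eval_R s by blast
    then obtain h where h: "y - int_eval h s \<in> P" using s by (auto simp: generates_def)
    have PI: "p_ideal P" and QI: "p_ideal Q" using P max_ideal_p_ideal by auto
    have "1 - int_eval g s * int_eval h s = (1 - int_eval g s * y) + int_eval g s * (y - int_eval h s)" by (simp add: algebra_simps)
    also have "\<dots> \<in> P" using y h by (intro p_idealD(3)[OF PI] p_idealD(4)[OF PI] int_eval_R s) auto
    finally have "int_eval (1 - g * h) s \<in> P" by simp
    then have "int_eval (1 - g * h) t \<in> Q" by (rule sub)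
    then have "1 - int_eval g t * int_eval h t \<in> Q" by simp
    moreover have "int_eval g t * int_eval h t \<in> Q" by (intro p_idealD(5)[OF QI t] int_eval_R s)
    ultimately have "1 \<in> Q" using p_idealD(3)[OF QI, of "1 - int_eval g t * int_eval h t" "int_eval g t * int_eval h t"] by simp
    then show False using max_ideal_one P by auto
  qed
qed (rule sub)

text \<open>If no translate works, each of the \<open>p\<close> translates of \<open>s\<close> has
  at \<open>P0\<close> the same kernel as \<open>t\<close> has at some \<open>Q c\<close> in
  \<open>F\<close>. If two translates share a prime, this kernel is invariant under a nonzero shift,
  and two primes of residue degree at least \<open>p\<close> exceed \<open>n\<close>. Otherwise
  there are \<open>p + 1\<close> primes of equal residue degree: degree one contradicts
  \<open>nsp\<close>, larger degree would need 2 (p + 1) \<le> n.\<close>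

lemma good_shift:
  assumes small: "n < 2 * p" and nsp: "\<And>F. F \<subseteq> max_ideals \<Longrightarrow> card F = p + 1 \<Longrightarrow> \<exists>P\<in>F. \<not> degree_one P"
    and F: "F \<subseteq> max_ideals" "P0 \<in> max_ideals" "P0 \<notin> F" and t: "t \<in> R" "\<And>P. P \<in> F \<Longrightarrow> generates P t"
    and s: "s \<in> R" "generates P0 s"
  shows "\<exists>c::nat. c < p \<and> (\<forall>P\<in>F. \<exists>g. (int_eval g t \<in> P) \<noteq> (int_eval g (s + of_nat c) \<in> P0))"
proof (rule ccontr)
  assume "\<not> ?thesis"
  then have "\<forall>c<p. \<exists>P\<in>F. \<forall>g. int_eval g t \<in> P \<longleftrightarrow> int_eval g (s + of_nat c) \<in> P0" by auto
  then obtain Q where Q: "\<And>c. c < p \<Longrightarrow> Q c \<in> F"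
    "\<And>c g. c < p \<Longrightarrow> int_eval g t \<in> Q c \<longleftrightarrow> int_eval g (s + of_nat c) \<in> P0" by metis
  have finF: "finite F" using F finite_max_ideals finite_subset by blast
  have sc: "s + of_nat c \<in> R" for c :: nat using s by (auto intro: add_R)
  have gc: "generates P0 (s + of_nat c)" for c :: nat using generates_shift[OF s(2), of "int c"] by simp
  have inj: "inj_on Q {..<p}"
  proof (rule inj_onI, rule ccontr)
    fix c d assume cd: "c \<in> {..<p}" "d \<in> {..<p}" "Q c = Q d" "c \<noteq> d"
    define \<delta> where "\<delta> = int d - int c"
    have "\<bar>\<delta>\<bar> < int p" "\<delta> \<noteq> 0" using cd by (auto simp: \<delta>_def)
    then have nd: "\<not> int p dvd \<delta>" using dvd_imp_le_int[of \<delta> "int p"] by auto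
    have inv: "int_eval g (s + of_nat c) \<in> P0 \<longleftrightarrow> int_eval g (s + of_nat d) \<in> P0" for g
      using Q(2)[of c g] Q(2)[of d g] cd by auto
    have 1: "indep p (s + of_nat c) P0"
    proof (rule indep_shift_invariant[OF F(2) sc nd])
      fix g assume "int_eval g (s + of_nat c) \<in> P0"
      then have "int_eval g (s + of_nat d) \<in> P0" using inv by simp
      then show "int_eval g (s + of_nat c + of_int \<delta>) \<in> P0" by (simp add: \<delta>_def)
    qed
    then have 2: "indep p t (Q c)" using Q(2)[of c] cd by (auto simp: indep_def)
    have "card {P0, Q c} * p \<le> n"
      by (rule card_mult_indep_le[where s = "\<lambda>P. if P = P0 then s + of_nat c else t"])
         (use 1 2 F Q(1)[of c] cd sc t in auto)
    moreover have "P0 \<noteq> Q c" using F Q(1)[of c] cd by auto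
    ultimately show False using small by simp
  qed
  define G where "G = insert P0 (Q ` {..<p})"
  have G: "G \<subseteq> max_ideals" "finite G" using F Q(1) by (auto simp: G_def)
  have "P0 \<notin> Q ` {..<p}" using F Q(1) by auto
  then have cG: "card G = p + 1" unfolding G_def using card_image[OF inj] by simp
  show False
  proof (cases "degree_one P0")
    case True
    have "degree_one (Q c)" if c: "c < p" for c
      unfolding degree_one_def
    proof
      fix x assume x: "x \<in> R"
      obtain h where h: "x - int_eval h t \<in> Q c" using t(2)[OF Q(1)[OF c]] x by (auto simp: generates_def)
      obtain m where "int_eval h (s + of_nat c) - of_int m \<in> P0"
        using True int_eval_R[OF sc[of c], of h] unfolding degree_one_def by blast
      then have "int_eval (h - [:m:]) (s + of_nat c) \<in> P0" by simp
      then have "int_eval (h - [:m:]) t \<in> Q c" using Q(2)[OF c] by blast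
      then have "int_eval h t - of_int m \<in> Q c" by simp
      then have "x - of_int m \<in> Q c" using p_ideal_cong_trans[OF max_ideal_p_ideal h] Q(1)[OF c] F by blast
      then show "\<exists>m::int. x - of_int m \<in> Q c" by blast
    qed
    then show False using nsp[OF G(1) cG] True by (auto simp: G_def)
  next
    case False
    have i: "indep 2 (s + of_nat c) P0" for c :: nat by (rule indep_two[OF F(2) sc gc False])
    then have "indep 2 t (Q c)" if "c < p" for c using Q(2)[OF that] by (auto simp: indep_def)
    then have "card G * 2 \<le> n"
      by (intro card_mult_indep_le[where s = "\<lambda>P. if P = P0 then s else t"] G)
         (use i[of 0] s t in \<open>auto simp: G_def\<close>)
    then show False using cG small by simp
  qed
qed

text \<open>Besides generating every residue field, \<open>t\<close> must have different kernels at
  different primes: this is what later lets polynomials in \<open>t\<close> separate the primes. A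
  suitable translate of a generator at the new prime preserves that condition.\<close>

lemma common_generator:
  assumes small: "n < 2 * p" and nsp: "\<And>F. F \<subseteq> max_ideals \<Longrightarrow> card F = p + 1 \<Longrightarrow> \<exists>P\<in>F. \<not> degree_one P"
    and "finite F" "F \<subseteq> max_ideals"
  shows "\<exists>t\<in>R. (\<forall>P\<in>F. generates P t) \<and> (\<forall>P\<in>F. \<forall>Q\<in>F. P \<noteq> Q \<longrightarrow> (\<exists>g. int_eval g t \<in> P \<and> int_eval g t \<notin> Q))"
  using assms(3,4)
proof (induction F rule: finite_induct)
  case empty
  then show ?case using one_R by blast
next
  case (insert P0 F)
  have P0: "P0 \<in> max_ideals" and F: "F \<subseteq> max_ideals" using insert.prems by auto
  obtain t where t': "t \<in> R" "\<forall>P\<in>F. generates P t"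
    "\<forall>P\<in>F. \<forall>Q\<in>F. P \<noteq> Q \<longrightarrow> (\<exists>g. int_eval g t \<in> P \<and> int_eval g t \<notin> Q)"
    using insert.IH[OF F] by (elim bexE conjE)
  have t: "t \<in> R" "\<And>P. P \<in> F \<Longrightarrow> generates P t"
    "\<And>P Q. P \<in> F \<Longrightarrow> Q \<in> F \<Longrightarrow> P \<noteq> Q \<Longrightarrow> \<exists>g. int_eval g t \<in> P \<and> int_eval g t \<notin> Q"
    using t' by simp_all
  obtain s where s: "s \<in> R" "generates P0 s" using residue_generator[OF P0] by auto
  obtain c where c: "\<And>P. P \<in> F \<Longrightarrow> \<exists>g. (int_eval g t \<in> P) \<noteq> (int_eval g (s + of_nat c) \<in> P0)"
    using good_shift[OF small nsp F P0 insert.hyps(2) t(1,2) s] by blast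
  define r where "r = s + of_nat c"
  have r: "r \<in> R" "generates P0 r" using s generates_shift[OF s(2), of "int c"] by (auto simp: r_def intro: add_R)
  obtain e where e: "e \<in> R" "1 - e \<in> P0" "\<And>P. P \<in> F \<Longrightarrow> e \<in> P"
    using max_ideal_separate_one[OF insert.hyps(1) F P0 insert.hyps(2)] by blast
  \<comment> \<open>By the choice of \<open>e\<close>, \<open>u\<close> is congruent to
    \<open>r\<close> modulo \<open>P0\<close> and to \<open>t\<close> modulo every member of
    \<open>F\<close>.\<close>
  define u where "u = t + e * (r - t)"
  have u: "u \<in> R" using t e r by (auto simp: u_def intro!: add_R mult_R diff_R)
  have u0: "u - r \<in> P0"
  proof -
    have "u - r = (1 - e) * (t - r)" by (simp add: u_def algebra_simps)
    then show ?thesis using e t r p_idealD(5)[OF max_ideal_p_ideal[OF P0]] diff_R by simp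
  qed
  have uP: "u - t \<in> P" if "P \<in> F" for P
    using e(3)[OF that] t r p_idealD(5)[OF max_ideal_p_ideal] that F diff_R by (auto simp: u_def)
  have ev0: "int_eval g u \<in> P0 \<longleftrightarrow> int_eval g r \<in> P0" for g
    using p_ideal_cong_int_eval[OF max_ideal_p_ideal[OF P0] u0 u r(1)] p_ideal_cong_mem[OF max_ideal_p_ideal[OF P0]] by blast
  have evP: "int_eval g u \<in> P \<longleftrightarrow> int_eval g t \<in> P" if "P \<in> F" for g P
    using p_ideal_cong_int_eval[OF max_ideal_p_ideal uP[OF that] u t(1)] p_ideal_cong_mem[OF max_ideal_p_ideal] that F by blast
  have g0: "generates P0 u"
    using generates_cong[OF max_ideal_p_ideal[OF P0] r(2) _ r(1) u] p_ideal_uminus[OF max_ideal_p_ideal[OF P0] u0] by simp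
  have gP: "generates P u" if "P \<in> F" for P
    using generates_cong[OF max_ideal_p_ideal t(2)[OF that] _ t(1) u] p_ideal_uminus[OF max_ideal_p_ideal uP[OF that]] that F by auto
  have sep: "\<exists>g. int_eval g u \<in> P \<and> int_eval g u \<notin> P0" "\<exists>g. int_eval g u \<in> P0 \<and> int_eval g u \<notin> P" if "P \<in> F" for P
  proof -
    have PM: "P \<in> max_ideals" using that F by auto
    show "\<exists>g. int_eval g u \<in> P \<and> int_eval g u \<notin> P0"
      using equivalent_if_subset[OF PM P0 u u gP[OF that]] c[OF that] ev0 evP[OF that]
      unfolding r_def by blast
    show "\<exists>g. int_eval g u \<in> P0 \<and> int_eval g u \<notin> P"
      using equivalent_if_subset[OF P0 PM u u g0] c[OF that] ev0 evP[OF that]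
      unfolding r_def by blast
  qed
  show ?case
  proof (intro bexI[of _ u] conjI ballI impI)
    fix P Q assume "P \<in> insert P0 F" "Q \<in> insert P0 F" "P \<noteq> Q"
    then show "\<exists>g. int_eval g u \<in> P \<and> int_eval g u \<notin> Q" using sep t(3)[of P Q] evP[of P] evP[of Q] by auto
  qed (use u g0 gP in auto)
qed

section \<open>Iterates of the Frobenius map modulo \<open>p\<close>\<close>

lemma frobenius_add:
  assumes "x \<in> R" "y \<in> R"
  shows "(x + y) ^ p - (x ^ p + y ^ p) \<in> pR"
proof -
  have "(x + y) ^ p = (\<Sum>k\<le>p. of_nat (p choose k) * x ^ k * y ^ (p - k))"
    by (rule binomial_ring)
  also have "{..p} = insert 0 (insert p {1..<p})" using p_pos by auto
  also have "(\<Sum>k\<in>\<dots>. of_nat (p choose k) * x ^ k * y ^ (p - k)) =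
      y ^ p + (x ^ p + (\<Sum>k\<in>{1..<p}. of_nat (p choose k) * x ^ k * y ^ (p - k)))"
    using p_pos by simp
  finally have "(x + y) ^ p - (x ^ p + y ^ p) =
      (\<Sum>k\<in>{1..<p}. of_int (int (p choose k)) * (x ^ k * y ^ (p - k)))"
    by (simp add: mult.assoc)
  also have "\<dots> \<in> pR"
  proof (rule p_ideal_sum[OF p_ideal_pR], rule p_ideal_dvd[OF p_ideal_pR])
    fix k assume k: "k \<in> {1..<p}"
    then show "int p dvd int (p choose k)"
      using prime_p by (auto intro!: dvd_choose_prime)
    show "x ^ k * y ^ (p - k) \<in> R" using assms by (intro mult_R power_R)
  qed
  finally show ?thesis .
qed

lemma frobenius_power_add:
  assumes "x \<in> R" "y \<in> R"
  shows "(x + y) ^ (p ^ N) - (x ^ (p ^ N) + y ^ (p ^ N)) \<in> pR"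
proof (induction N)
  case 0
  then show ?case using p_ideal_zero[OF p_ideal_pR] by simp
next
  case (Suc N)
  define u v where "u = x ^ (p ^ N)" and "v = y ^ (p ^ N)"
  have uv: "u \<in> R" "v \<in> R" using assms by (auto simp: u_def v_def intro: power_R)
  have "((x + y) ^ (p ^ N)) ^ p - (u + v) ^ p \<in> pR"
    by (rule p_ideal_cong_power[OF p_ideal_pR]) (use Suc assms in \<open>auto simp: u_def v_def intro!: add_R power_R\<close>)
  then have "((x + y) ^ (p ^ N)) ^ p - (u ^ p + v ^ p) \<in> pR"
    using p_ideal_cong_trans[OF p_ideal_pR] frobenius_add[OF uv] by blast
  then show ?case by (simp add: u_def v_def mult.commute flip: power_mult)
qed

lemma frobenius_power_diff:
  assumes "x \<in> R" "y \<in> R"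
  shows "(x - y) ^ (p ^ N) - (x ^ (p ^ N) - y ^ (p ^ N)) \<in> pR"
proof -
  have "x ^ (p ^ N) - ((x - y) ^ (p ^ N) + y ^ (p ^ N)) \<in> pR"
    using frobenius_power_add[of "x - y" y N] assms diff_R by simp
  from p_ideal_uminus[OF p_ideal_pR this] show ?thesis by (simp add: algebra_simps)
qed

text \<open>By finiteness of R / pR the sequence x, x^p, x^(p^2), ... is eventually periodic modulo
  \<open>p\<close>; a common \<open>N\<close> makes the \<open>N\<close>-th iterate of Frobenius
  idempotent.\<close>

lemma frobenius_periodic:
  "\<exists>N>0. \<forall>x\<in>R. x ^ (p ^ N * p ^ N) - x ^ (p ^ N) \<in> pR"
proof -
  obtain T where T: "finite T" "T \<subseteq> R" "\<And>x. x \<in> R \<Longrightarrow> \<exists>t\<in>T. \<exists>y\<in>R. x - t = of_nat p * y"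
    using finite_mod by metis
  have "\<forall>x. \<exists>t. x \<in> R \<longrightarrow> t \<in> T \<and> x - t \<in> pR"
  proof
    fix x show "\<exists>t. x \<in> R \<longrightarrow> t \<in> T \<and> x - t \<in> pR"
      using T(3)[of x] unfolding pR_def by blast
  qed
  then obtain r where r: "\<And>x. x \<in> R \<Longrightarrow> r x \<in> T" "\<And>x. x \<in> R \<Longrightarrow> x - r x \<in> pR"
    by metis
  \<comment> \<open>The factorial is a multiple of every possible period and at least as large as
    every preperiod, so one exponent serves all \<open>x\<close>.\<close>
  define M N where "M = card T" and "N = (fact M :: nat)"
  have "x ^ (p ^ N * p ^ N) - x ^ (p ^ N) \<in> pR" if x: "x \<in> R" for x
  proof -
    have cong: "x ^ (p ^ i) - x ^ (p ^ j) \<in> pR" if "r (x ^ (p ^ i)) = r (x ^ (p ^ j))" for i j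
      using r(2)[OF power_R[OF x, of "p ^ i"]] p_ideal_uminus[OF p_ideal_pR r(2)[OF power_R[OF x, of "p ^ j"]]]
        p_ideal_cong_trans[OF p_ideal_pR] that by (metis minus_diff_eq)
    have "\<not> inj_on (\<lambda>k. r (x ^ (p ^ k))) {..M}"
    proof
      assume "inj_on (\<lambda>k. r (x ^ (p ^ k))) {..M}"
      then have "card {..M} \<le> card T"
        using T(1) r(1) power_R[OF x] by (intro card_inj_on_le) auto
      then show False by (simp add: M_def)
    qed
    then obtain i j where ij: "i < j" "j \<le> M" "r (x ^ (p ^ i)) = r (x ^ (p ^ j))"
      unfolding inj_on_def by (metis atMost_iff linorder_neqE_nat)
    define d where "d = j - i"
    have d: "d dvd N" "0 < d" using ij by (auto simp: d_def N_def intro!: dvd_fact)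
    have iN: "i \<le> N" using ij fact_ge_self[of M] by (auto simp: N_def)
    have step: "x ^ (p ^ (k + d)) - x ^ (p ^ k) \<in> pR" if "i \<le> k" for k
    proof -
      have "(x ^ (p ^ j)) ^ (p ^ (k - i)) - (x ^ (p ^ i)) ^ (p ^ (k - i)) \<in> pR"
        by (rule p_ideal_cong_power[OF p_ideal_pR cong]) (use ij x in \<open>auto intro: power_R\<close>)
      moreover have "j + (k - i) = k + d" "i + (k - i) = k" using that ij by (auto simp: d_def)
      ultimately show ?thesis by (simp flip: power_mult power_add)
    qed
    have "x ^ (p ^ (N + d * l)) - x ^ (p ^ N) \<in> pR" for l
    proof (induction l)
      case (Suc l)
      have "x ^ (p ^ (N + d * l + d)) - x ^ (p ^ (N + d * l)) \<in> pR" using step iN by simp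
      from p_ideal_cong_trans[OF p_ideal_pR this Suc] show ?case by (simp add: algebra_simps)
    qed (simp add: p_ideal_zero[OF p_ideal_pR])
    from this[of "N div d"] show ?thesis using d by (simp add: power_add)
  qed
  moreover have "N > 0" by (simp add: N_def)
  ultimately show ?thesis by blast
qed

lemma unit_mod_p:
  assumes "x \<in> R" "\<And>P. P \<in> max_ideals \<Longrightarrow> x \<notin> P"
  shows "\<exists>y\<in>R. 1 - x * y \<in> pR"
proof -
  define J where "J = {i + x * r | i r. i \<in> pR \<and> r \<in> R}"
  have J: "p_ideal J" unfolding J_def by (rule p_ideal_adjoin[OF p_ideal_pR assms(1)])
  have "x \<in> J"
    unfolding J_def using p_ideal_zero[OF p_ideal_pR] by (intro CollectI exI[of _ 0] exI[of _ 1]) simp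
  then have "1 \<in> J" using assms(2) by (intro p_ideal_eq_R[OF J]) auto
  then obtain i r where ir: "i \<in> pR" "r \<in> R" "1 = i + x * r" unfolding J_def by blast
  then have "1 - x * r = i" by (metis add_diff_cancel_right')
  then show ?thesis using ir by (intro bexI[of _ r]) simp_all
qed

text \<open>With q = p^N, the product of x^q and x^(q (q - 1)) - 1 lies in \<open>pR\<close>. For
  \<open>x\<close> in every maximal ideal the second factor is a unit modulo \<open>p\<close>, so
  x^q is in \<open>pR\<close>. For arbitrary \<open>x\<close> the q-th power of x^q - x lies in
  \<open>pR\<close>, so x^q - x lies in every maximal ideal.\<close>

lemma frobenius_radical:
  "\<exists>N>0. (\<forall>x\<in>R. x ^ (p ^ N * p ^ N) - x ^ (p ^ N) \<in> pR) \<and>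
     (\<forall>x\<in>R. (\<forall>P\<in>max_ideals. x \<in> P) \<longrightarrow> x ^ (p ^ N) \<in> pR) \<and> (\<forall>x\<in>R. \<forall>P\<in>max_ideals. x ^ (p ^ N) - x \<in> P)"
proof -
  obtain N where N: "N > 0" "\<And>x. x \<in> R \<Longrightarrow> x ^ (p ^ N * p ^ N) - x ^ (p ^ N) \<in> pR"
    using frobenius_periodic by blast
  define q where "q = p ^ N"
  have q: "q > 1" unfolding q_def by (rule one_less_power[OF p_gt_1 N(1)])
  have qq: "q * q = q + q * (q - 1)" using q by (simp add: algebra_simps)
  have xqq: "x ^ (q * q) - x ^ q = x ^ q * (x ^ (q * (q - 1)) - 1)" for x :: 'a
    by (simp only: qq power_add right_diff_distrib mult_1_right)
  have "x ^ q \<in> pR" if x: "x \<in> R" "\<forall>P\<in>max_ideals. x \<in> P" for x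
  proof -
    define u where "u = x ^ (q * (q - 1)) - 1"
    have u: "u \<in> R" using x by (auto simp: u_def intro!: diff_R power_R)
    have xu: "x ^ q * u \<in> pR"
      using N(2)[OF x(1)] by (simp only: q_def[symmetric] xqq u_def)
    have "u \<notin> P" if P: "P \<in> max_ideals" for P
    proof
      assume "u \<in> P"
      have "x * x ^ (q * (q - 1) - 1) \<in> P"
        using p_idealD(5)[OF max_ideal_p_ideal[OF P]] x P power_R by blast
      moreover have "q * (q - 1) > 0" using q by simp
      ultimately have "x ^ (q * (q - 1)) \<in> P" by (simp add: power_eq_if)
      from p_ideal_diff[OF max_ideal_p_ideal[OF P] this \<open>u \<in> P\<close>] show False using max_ideal_one[OF P] by (simp add: u_def)
    qed
    then obtain y where y: "y \<in> R" "1 - u * y \<in> pR" using unit_mod_p[OF u] by blast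
    have "x ^ q = x ^ q * (1 - u * y) + (x ^ q * u) * y" by (simp add: algebra_simps)
    also have "\<dots> \<in> pR"
      by (rule p_idealD(3)[OF p_ideal_pR p_idealD(4)[OF p_ideal_pR] p_idealD(5)[OF p_ideal_pR xu]])
         (use x y in \<open>auto intro: power_R\<close>)
    finally show ?thesis .
  qed
  moreover have "x ^ q - x \<in> P" if x: "x \<in> R" and P: "P \<in> max_ideals" for x P
  proof -
    have "(x ^ q - x) ^ q - ((x ^ q) ^ q - x ^ q) \<in> pR"
      unfolding q_def using x by (intro frobenius_power_diff power_R)
    moreover have "(x ^ q) ^ q - x ^ q \<in> pR" using N(2)[OF x] by (simp add: q_def power_mult)
    ultimately have "(x ^ q - x) ^ q \<in> pR" using p_ideal_cong_mem[OF p_ideal_pR] by blast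
    then have "(x ^ q - x) ^ q \<in> P" using p_idealD(1)[OF max_ideal_p_ideal[OF P]] by simp
    from max_ideal_power[OF P _ this] show ?thesis using x by (simp add: diff_R power_R)
  qed
  ultimately show ?thesis using N by (intro exI[of _ N]) (auto simp: q_def)
qed

section \<open>Uniformizers, and principality of the radical modulo \<open>p\<close>\<close>

lemma integral_if_powers_bounded:
  assumes t: "\<And>k. of_nat p * t ^ k \<in> R"
  shows "t \<in> R"
proof -
  have p0: "of_nat p \<noteq> (0 :: 'a)" using p_pos by simp
  obtain m :: "nat \<Rightarrow> int" where m: "\<exists>i\<le>n. \<not> int p dvd m i"
    "(\<Sum>i\<le>n. of_int (m i) * (of_nat p * t ^ i)) = 0"
    using rank[of "\<lambda>i. of_nat p * t ^ i"] t by blast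
  have "(\<Sum>i\<le>n. of_int (m i) * (of_nat p * t ^ i)) = of_nat p * (\<Sum>i\<le>n. of_int (m i) * t ^ i)"
    by (simp add: sum_distrib_left mult_ac)
  then have rel: "(\<Sum>i\<le>n. of_int (m i) * t ^ i) = 0" using m(2) p0 by simp
  \<comment> \<open>\<open>j\<close> is the last exponent with coefficient prime to
    \<open>p\<close>. The terms beyond it are integer multiples of \<open>of_nat p * t ^ i\<close>,
    hence in \<open>R\<close>, and can be moved into a constant term.\<close>
  define j where "j = Max {i. i \<le> n \<and> \<not> int p dvd m i}"
  have fin: "finite {i. i \<le> n \<and> \<not> int p dvd m i}" by simp
  have j: "j \<le> n" "\<not> int p dvd m j"
    using Max_in[OF fin] m(1) by (auto simp: j_def)
  have big: "int p dvd m i" if "j < i" "i \<le> n" for i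
  proof (rule ccontr)
    assume "\<not> int p dvd m i"
    then have "i \<le> j" using Max_ge[OF fin, of i] that by (simp add: j_def)
    then show False using that by simp
  qed
  obtain u v where uv: "u * int p + v * m j = 1" using p_bezout j  by blast
  \<comment> \<open>The relation is multiplied by \<open>v\<close>, inverse to \<open>m j\<close>
    modulo \<open>p\<close>, and by \<open>t\<close>: raising all exponents by one frees the
    constant slot for \<open>w\<close>. The subtracted term turns the leading coefficient
    \<open>v * m j\<close> into 1.\<close>
  define w where "w = (\<Sum>i\<in>{j<..n}. of_int (v * m i) * t ^ Suc i) - of_int u * (of_nat p * t ^ Suc j)"
  have pt: "of_int k * t ^ i \<in> R" if "int p dvd k" for k i
  proof -
    obtain l where "k = int p * l" using \<open>int p dvd k\<close> by (auto elim: dvdE)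
    then have "of_int k * t ^ i = of_int l * (of_nat p * t ^ i)" by simp
    then show ?thesis using t[of i] mult_R of_int_R by metis
  qed
  have w: "w \<in> R"
    unfolding w_def
  proof (rule diff_R)
    have "sum g A \<in> R" if "\<And>i. i \<in> A \<Longrightarrow> g i \<in> R" for g :: "nat \<Rightarrow> 'a" and A
      using that by (induction A rule: infinite_finite_induct) (auto intro: add_R)
    note * = this
    show "(\<Sum>i\<in>{j<..n}. of_int (v * m i) * t ^ Suc i) \<in> R"
    proof -
      have "of_int (v * m i) * t ^ Suc i \<in> R" if "i \<in> {j<..n}" for i
        by (rule pt) (use big that in simp)
      then show ?thesis by (rule *)
    qed
    show "of_int u * (of_nat p * t ^ Suc j) \<in> R"
      by (rule mult_R[OF of_int_R t])
  qed
  define h where "h = (\<Sum>i<j. Polynomial.monom (of_int (v * m i) :: 'a) (Suc i)) + [:w:]"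
  define q where "q = Polynomial.monom 1 (Suc j) + h"
  have ch: "coeff h k = (if 0 < k \<and> k \<le> j then of_int (v * m (k - 1)) else if k = 0 then w else 0)" for k
  proof (cases k)
    case 0
    then show ?thesis by (simp add: h_def coeff_sum coeff_monom)
  next
    case (Suc l)
    have "(\<Sum>i<j. if i = l then of_int (v * m i) else (0::'a)) = (if l < j then of_int (v * m l) else 0)"
      by simp
    then show ?thesis using Suc by (simp add: h_def coeff_sum coeff_monom)
  qed
  have dh: "degree h \<le> j" by (rule degree_le) (auto simp: ch)
  have dq: "degree q = Suc j"
    unfolding q_def using dh by (subst degree_add_eq_left) (auto simp: degree_monom_eq)
  show ?thesis
  proof (rule integrally_closed)
    show "coeff q i \<in> R" for i using w by (auto simp: q_def coeff_monom ch intro!: add_R of_int_R simp del: of_int_mult)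
    show "lead_coeff q = 1" using dh by (simp add: dq) (simp add: q_def coeff_eq_0)
    show "of_nat p * t \<in> R" using t[of 1] by simp
    have "sum F {..n} = sum F {..<j} + F j + sum F {j<..n}" for F :: "nat \<Rightarrow> 'a"
    proof -
      have "{..n} = {..<j} \<union> insert j {j<..n}" using j by auto
      moreover have "sum F ({..<j} \<union> insert j {j<..n}) = sum F {..<j} + sum F (insert j {j<..n})"
        by (rule sum.union_disjoint) auto
      ultimately show ?thesis by (simp add: add.assoc)
    qed
    then have eS: "(\<Sum>i\<le>n. of_int (v * m i) * t ^ Suc i) =
      (\<Sum>i<j. of_int (v * m i) * t ^ Suc i) + of_int (v * m j) * t ^ Suc j + (\<Sum>i\<in>{j<..n}. of_int (v * m i) * t ^ Suc i)" .
    have "(\<Sum>i\<le>n. of_int (v * m i) * t ^ Suc i) = of_int v * t * (\<Sum>i\<le>n. of_int (m i) * t ^ i)"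
      by (simp add: sum_distrib_left mult_ac)
    then have e0: "(\<Sum>i\<le>n. of_int (v * m i) * t ^ Suc i) = 0" using rel by simp
    have "of_int (u * int p + v * m j) * t ^ Suc j = t ^ Suc j" unfolding uv by simp
    then have eT: "t ^ Suc j = of_int u * (of_nat p * t ^ Suc j) + of_int (v * m j) * t ^ Suc j"
      by (simp del: power_Suc add: distrib_right mult.assoc)
    have aux: "T + (S1 + (S2 - U)) = 0" if "S = S1 + A + S2" "S = 0" "T = U + A"
      for S S1 S2 A T U :: 'a
    proof -
      have "T + (S1 + (S2 - U)) = S1 + A + S2" unfolding that(3) by (simp add: add_ac)
      then show ?thesis using that(1,2) by metis
    qed
    have "poly q t = t ^ Suc j + ((\<Sum>i<j. of_int (v * m i) * t ^ Suc i) + w)"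
      by (simp add: q_def h_def poly_sum poly_monom)
    also have "\<dots> = 0" unfolding w_def by (rule aux[OF eS e0 eT])
    finally show "poly q t = 0" .
  qed
qed

text \<open>
  Choose \<open>c\<close> outside \<open>p R\<close> with \<open>c P \<subseteq> p R\<close> and let \<open>t = c / p\<close>. If \<open>t P \<subseteq> P\<close>, then \<open>p t\<^sup>k \<in> R\<close> for all \<open>k\<close>,
  so \<open>t\<close> would be integral.
\<close>

lemma local_uniformizer:
  assumes P: "P \<in> max_ideals"
  shows "\<exists>t. (\<forall>x\<in>P. t * x \<in> R) \<and> (\<exists>\<pi>\<in>P. t * \<pi> \<notin> P)"
proof -
  have PI: "p_ideal P" and P1: "1 \<notin> P" using P max_ideal_p_ideal max_ideal_one by auto
  \<comment> \<open>\<open>C c\<close> is the annihilator of \<open>c\<close> in R / pR. As for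
    associated primes, one takes a maximal one among the annihilators contained in \<open>P\<close>
    and shows that it equals \<open>P\<close>.\<close>
  define C where "C c = {x \<in> R. x * c \<in> pR}" for c
  have C: "p_ideal (C c)" if "c \<in> R" for c
    unfolding p_ideal_def C_def
  proof (intro conjI ballI)
    show "pR \<subseteq> {x \<in> R. x * c \<in> pR}" using p_idealD(2,5)[OF p_ideal_pR] that by blast
    fix x assume x: "x \<in> {x \<in> R. x * c \<in> pR}"
    {
      fix y assume "y \<in> {x \<in> R. x * c \<in> pR}"
      then show "x + y \<in> {x \<in> R. x * c \<in> pR}"
        using x p_idealD(3)[OF p_ideal_pR] by (auto simp: distrib_right intro: add_R)
    }
    fix r assume "r \<in> R"
    then show "r * x \<in> {x \<in> R. x * c \<in> pR}"
      using x p_idealD(4)[OF p_ideal_pR] by (auto simp: mult.assoc intro: mult_R)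
  qed auto
  define A where "A = {C c | c. c \<in> R \<and> C c \<subseteq> P}"
  have "finite A" unfolding A_def by (rule finite_subset[OF _ finite_p_ideals]) (use C in auto)
  moreover have "C 1 \<subseteq> P" using p_idealD(1)[OF PI] by (auto simp: C_def)
  then have "C 1 \<in> A" unfolding A_def using one_R by blast
  ultimately obtain I where I: "I \<in> A" "\<forall>J\<in>A. I \<le> J \<longrightarrow> I = J"
    using finite_has_maximal2[of A "C 1"] by auto
  from I(1) obtain c where c: "c \<in> R" "C c \<subseteq> P" "I = C c" unfolding A_def by blast
  have max: "C c = C d" if "d \<in> R" "C d \<subseteq> P" "C c \<subseteq> C d" for d
    using I(2) that c unfolding A_def by blast
  have mono: "C d \<subseteq> C (s * d)" if "s \<in> R" for s d
    using that p_idealD(4)[OF p_ideal_pR] by (auto simp: C_def mult.left_commute[of _ s])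
  have "P \<subseteq> C c"
  proof
    fix x assume x: "x \<in> P"
    have xR: "x \<in> R" using x p_idealD(2)[OF PI] by simp
    show "x \<in> C c"
    proof (cases "\<exists>k. \<not> C (x ^ k * c) \<subseteq> P")
      case True
      \<comment> \<open>At the first power whose annihilator leaves \<open>P\<close>, some
        \<open>s\<close> outside \<open>P\<close> satisfies \<open>s * (x * d) \<in> pR\<close>. The
        annihilator of \<open>s * d\<close> stays inside \<open>P\<close>, equals \<open>C c\<close>
        by maximality, and contains \<open>x\<close>.\<close>
      define k where "k = (LEAST k. \<not> C (x ^ k * c) \<subseteq> P)"
      have k: "\<not> C (x ^ k * c) \<subseteq> P" unfolding k_def using True by (rule LeastI_ex)
      then have "k \<noteq> 0" using c by (cases k) auto
      then obtain l where l: "k = Suc l" using not0_implies_Suc by auto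
      define d where "d = x ^ l * c"
      have d: "d \<in> R" using c xR by (auto simp: d_def intro: mult_R power_R)
      have "C d \<subseteq> P" using not_less_Least[of l "\<lambda>k. \<not> C (x ^ k * c) \<subseteq> P"] l by (auto simp: d_def k_def)
      then have cd: "C c = C d" using max[OF d] mono[of "x ^ l" c] xR by (auto simp: d_def power_R)
      have "x ^ k * c = x * d" by (simp add: l d_def mult.assoc)
      then obtain s where s: "s \<in> R" "s * (x * d) \<in> pR" "s \<notin> P" using k by (auto simp: C_def)
      have "C (s * d) \<subseteq> P"
      proof
        fix y assume "y \<in> C (s * d)"
        then have "y * s \<in> C d" "y \<in> R" using s by (auto simp: C_def mult.assoc intro: mult_R)
        then show "y \<in> P" using \<open>C d \<subseteq> P\<close> max_ideal_prime[OF P _ s(1)] s(3) by blast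
      qed
      then have "C c = C (s * d)" using max[of "s * d"] mono[OF s(1), of d] cd d s by (auto intro: mult_R)
      moreover have "x \<in> C (s * d)" using s xR by (simp add: C_def mult_ac)
      ultimately show ?thesis by simp
    next
      case False
      obtain N where N: "N > 0" "\<And>x. x \<in> R \<Longrightarrow> x ^ (p ^ N * p ^ N) - x ^ (p ^ N) \<in> pR"
        using frobenius_periodic by blast
      define q where "q = p ^ N"
      have q: "q > 1" unfolding q_def by (rule one_less_power[OF p_gt_1 N(1)])
      have qq: "q * q = q + q * (q - 1)" using q by (simp add: algebra_simps)
      have xqq: "x ^ (q * q) - x ^ q = x ^ q * (x ^ (q * (q - 1)) - 1)" for x :: 'a
    by (simp only: qq power_add right_diff_distrib mult_1_right)
      \<comment> \<open>\<open>u\<close> annihilates x^q c modulo \<open>p\<close>; if all these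
        annihilators lay in \<open>P\<close>, then \<open>u\<close> would be in \<open>P\<close>,
        which is impossible since \<open>x\<close> is in \<open>P\<close> and \<open>u\<close> is
        congruent to -1.\<close>
      define u where "u = x ^ (q * (q - 1)) - 1"
      have uR: "u \<in> R" using xR by (auto simp: u_def intro!: diff_R power_R)
      have "u * x ^ q \<in> pR"
        using N(2)[OF xR] by (simp only: q_def[symmetric] xqq u_def mult.commute[of "x ^ q"])
      from p_idealD(5)[OF p_ideal_pR this c(1)] have "u * (x ^ q * c) \<in> pR" by (simp add: mult.assoc)
      then have "u \<in> P" using False uR by (auto simp: C_def)
      have "x * x ^ (q * (q - 1) - 1) \<in> P"
        using p_idealD(5)[OF PI x] xR power_R by blast
      moreover have "q * (q - 1) > 0" using q by simp
      ultimately have "x ^ (q * (q - 1)) \<in> P" by (simp add: power_eq_if)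
      from p_ideal_diff[OF PI this \<open>u \<in> P\<close>] show ?thesis using P1 by (simp add: u_def)
    qed
  qed
  then have PC: "C c = P" using c by auto
  define t where "t = c / of_nat p"
  have pt: "of_nat p * t = c" using p_pos by (simp add: t_def)
  have tP: "t * x \<in> R" if "x \<in> P" for x
  proof -
    have "x * c \<in> pR" using that PC by (auto simp: C_def)
    then obtain y where "y \<in> R" "x * c = of_nat p * y" by (auto simp: pR_def)
    moreover then have "t * x = y" using p_pos by (simp add: t_def field_simps)
    ultimately show ?thesis by simp
  qed
  have "t \<notin> R"
  proof
    assume "t \<in> R"
    then have "c \<in> pR" using pt unfolding pR_def by blast
    then have "1 \<in> C c" by (simp add: C_def)
    then show False using PC P1 by simp
  qed
  have "\<exists>\<pi>\<in>P. t * \<pi> \<notin> P"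
  proof (rule ccontr)
    assume "\<not> ?thesis"
    then have st: "t * x \<in> P" if "x \<in> P" for x using that by blast
    have "of_nat p * t ^ k \<in> P" for k
    proof (induction k)
      case 0
      then show ?case using p_ideal_p_mult[OF PI one_R] by simp
    next
      case (Suc k)
      from st[OF this] show ?case by (simp add: mult_ac)
    qed
    then have "of_nat p * t ^ k \<in> R" for k using p_idealD(2)[OF PI] by blast
    then show False using integral_if_powers_bounded \<open>t \<notin> R\<close> by blast
  qed
  then show ?thesis using tP by blast
qed

text \<open>Local uniformizers are combined by Chinese remainders. In the squares of
  \<open>e Q\<close>, one factor makes \<open>t P * e Q\<close> lie in \<open>R\<close> and the
  other keeps the term in \<open>P\<close>, so \<open>t P * \<pi>\<close> stays outside
  \<open>P\<close>. For \<open>x\<close> in the radical, the \<open>y\<close> with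
  \<open>y * x\<close> in the ideal of \<pi> and \<open>p\<close> form an ideal containing every
  \<open>t P * \<pi>\<close>, hence 1.\<close>

lemma radical_principal:
  "\<exists>\<pi>\<in>R. (\<forall>P\<in>max_ideals. \<pi> \<in> P) \<and> (\<forall>x\<in>R. (\<forall>P\<in>max_ideals. x \<in> P) \<longrightarrow> (\<exists>r\<in>R. x - \<pi> * r \<in> pR))"
proof -
  obtain t where t: "\<And>P x. P \<in> max_ideals \<Longrightarrow> x \<in> P \<Longrightarrow> t P * x \<in> R" "\<And>P. P \<in> max_ideals \<Longrightarrow> \<exists>w\<in>P. t P * w \<notin> P"
    using local_uniformizer by metis
  then obtain w where w: "\<And>P. P \<in> max_ideals \<Longrightarrow> w P \<in> P" "\<And>P. P \<in> max_ideals \<Longrightarrow> t P * w P \<notin> P"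
    by metis
  have wR: "w P \<in> R" if "P \<in> max_ideals" for P using p_idealD(2)[OF max_ideal_p_ideal w(1)] that by blast
  have "\<forall>P\<in>max_ideals. \<exists>e. e \<in> R \<and> e \<notin> P \<and> (\<forall>P'\<in>max_ideals - {P}. e \<in> P')"
    using max_ideal_separate[of "max_ideals - {P}" P for P] finite_max_ideals by auto
  from bchoice[OF this] obtain e where
    e': "\<forall>P\<in>max_ideals. e P \<in> R \<and> e P \<notin> P \<and> (\<forall>P'\<in>max_ideals - {P}. e P \<in> P')" by (elim exE)
  have e: "\<And>P. P \<in> max_ideals \<Longrightarrow> e P \<in> R" "\<And>P. P \<in> max_ideals \<Longrightarrow> e P \<notin> P"
    "\<And>P P'. P \<in> max_ideals \<Longrightarrow> P' \<in> max_ideals \<Longrightarrow> P' \<noteq> P \<Longrightarrow> e P \<in> P'"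
    using e' by auto
  define \<pi> where "\<pi> = (\<Sum>P\<in>max_ideals. e P ^ 2 * w P)"
  have piP: "\<pi> \<in> P" if P: "P \<in> max_ideals" for P
    unfolding \<pi>_def
  proof (rule p_ideal_sum[OF max_ideal_p_ideal[OF P]])
    fix Q assume Q: "Q \<in> max_ideals"
    show "e Q ^ 2 * w Q \<in> P"
    proof (cases "Q = P")
      case True
      then show ?thesis using p_idealD(4)[OF max_ideal_p_ideal[OF P]] w(1)[OF P] e(1)[OF P] by (simp add: power_R)
    next
      case False
      then have "e Q * (e Q * w Q) \<in> P"
        using p_idealD(5)[OF max_ideal_p_ideal[OF P] e(3)[OF Q P]] wR[OF Q] e(1)[OF Q] by (auto intro: mult_R)
      then show ?thesis by (simp add: power2_eq_square mult.assoc)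
    qed
  qed
  obtain P0 where "P0 \<in> max_ideals" using max_ideal_exists[OF p_ideal_pR one_notin_pR] by blast
  then have piR: "\<pi> \<in> R" using piP p_idealD(2)[OF max_ideal_p_ideal] by blast
  have tpi: "t P * \<pi> \<notin> P" if P: "P \<in> max_ideals" for P
  proof
    assume a: "t P * \<pi> \<in> P"
    have PI: "p_ideal P" using P max_ideal_p_ideal by auto
    have "t P * \<pi> = e P ^ 2 * (t P * w P) + (\<Sum>Q\<in>max_ideals - {P}. (t P * e Q) * (e Q * w Q))"
      unfolding \<pi>_def sum_distrib_left using finite_max_ideals P
      by (subst sum.remove[of _ P]) (auto simp: power2_eq_square mult_ac intro!: sum.cong)
    moreover have "(\<Sum>Q\<in>max_ideals - {P}. (t P * e Q) * (e Q * w Q)) \<in> P"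
    proof (rule p_ideal_sum[OF PI])
      fix Q assume Q: "Q \<in> max_ideals - {P}"
      then have "e Q \<in> P" using e(3)[of Q P] P by auto
      then show "(t P * e Q) * (e Q * w Q) \<in> P"
        using t(1)[OF P] p_idealD(4,5)[OF PI] wR Q by auto
    qed
    ultimately have "e P ^ 2 * (t P * w P) \<in> P"
      using p_ideal_diff[OF PI a, of "\<Sum>Q\<in>max_ideals - {P}. (t P * e Q) * (e Q * w Q)"] by simp
    then have "e P ^ 2 \<in> P"
      using max_ideal_prime[OF P power_R[OF e(1)[OF P]] t(1)[OF P w(1)[OF P]]] w(2)[OF P] by blast
    then show False using max_ideal_power[OF P e(1)[OF P]] e(2)[OF P] by blast
  qed
  have "\<exists>r\<in>R. x - \<pi> * r \<in> pR" if x: "x \<in> R" "\<forall>P\<in>max_ideals. x \<in> P" for x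
  proof -
    define B where "B = {i + \<pi> * r | i r. i \<in> pR \<and> r \<in> R}"
    have B: "p_ideal B" unfolding B_def by (rule p_ideal_adjoin[OF p_ideal_pR piR])
    define I where "I = {y \<in> R. y * x \<in> B}"
    have I: "p_ideal I"
      unfolding p_ideal_def I_def
    proof (intro conjI ballI)
      show "pR \<subseteq> {y \<in> R. y * x \<in> B}"
        using p_idealD(1,5)[OF B] p_idealD(2)[OF p_ideal_pR] x by blast
      fix u assume u: "u \<in> {y \<in> R. y * x \<in> B}"
      {
        fix v assume "v \<in> {y \<in> R. y * x \<in> B}"
        then show "u + v \<in> {y \<in> R. y * x \<in> B}"
          using u p_idealD(3)[OF B] by (auto simp: distrib_right intro: add_R)
      }
      fix r assume "r \<in> R"
      then show "r * u \<in> {y \<in> R. y * x \<in> B}"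
        using u p_idealD(4)[OF B] by (auto simp: mult.assoc intro: mult_R)
    qed auto
    have "1 \<in> I"
    proof (rule p_ideal_eq_R[OF I])
      fix P assume P: "P \<in> max_ideals"
      have "t P * \<pi> * x = 0 + \<pi> * (t P * x)" by simp
      moreover have "t P * x \<in> R" using t(1)[OF P] x P by blast
      ultimately have "t P * \<pi> * x \<in> B" using p_ideal_zero[OF p_ideal_pR] unfolding B_def by blast
      then have "t P * \<pi> \<in> I" using t(1)[OF P piP[OF P]] by (simp add: I_def)
      then show "\<not> I \<subseteq> P" using tpi[OF P] by blast
    qed
    then have "x \<in> B" by (simp add: I_def)
    then obtain i r where "i \<in> pR" "r \<in> R" "x = i + \<pi> * r" unfolding B_def by blast
    then show ?thesis by (intro bexI[of _ r]) simp_all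
  qed
  then show ?thesis using piP piR by blast
qed

theorem monogenic_mod_p:
  assumes small: "n < 2 * p" and nsp: "\<And>F. F \<subseteq> max_ideals \<Longrightarrow> card F = p + 1 \<Longrightarrow> \<exists>P\<in>F. \<not> degree_one P"
  shows "\<exists>\<alpha>\<in>R. \<forall>x\<in>R. \<exists>g. x - int_eval g \<alpha> \<in> pR"
proof -
  obtain t where t': "t \<in> R" "\<forall>P\<in>max_ideals. generates P t"
    "\<forall>P\<in>max_ideals. \<forall>Q\<in>max_ideals. P \<noteq> Q \<longrightarrow> (\<exists>g. int_eval g t \<in> P \<and> int_eval g t \<notin> Q)"
    using common_generator[OF small _ finite_max_ideals subset_refl] nsp by (elim meta_impE bexE conjE)
  have t: "t \<in> R" "\<And>P. P \<in> max_ideals \<Longrightarrow> generates P t"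
    "\<And>P Q. P \<in> max_ideals \<Longrightarrow> Q \<in> max_ideals \<Longrightarrow> P \<noteq> Q \<Longrightarrow> \<exists>g. int_eval g t \<in> P \<and> int_eval g t \<notin> Q"
    using t' by simp_all
  \<comment> \<open>Chinese remainders inside the ring of polynomials in \<open>t\<close>: the
    separating elements must themselves be values at \<open>t\<close>.\<close>
  have sep: "\<exists>g. int_eval g t \<notin> P \<and> (\<forall>Q\<in>F. int_eval g t \<in> Q)"
    if "finite F" "P \<in> max_ideals" "F \<subseteq> max_ideals - {P}" for F P
    using that
  proof (induction F rule: finite_induct)
    case empty
    then show ?case using max_ideal_one by (intro exI[of _ 1]) simp
  next
    case (insert Q F)
    obtain g where g: "int_eval g t \<notin> P" "\<forall>Q\<in>F. int_eval g t \<in> Q" using insert by auto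
    obtain h where h: "int_eval h t \<in> Q" "int_eval h t \<notin> P" using t(3)[of Q P] insert by auto
    have "int_eval (g * h) t \<notin> P"
      using max_ideal_prime[OF insert.prems(1) int_eval_R[OF t(1), of g] int_eval_R[OF t(1), of h]] g h by auto
    moreover have "int_eval (g * h) t \<in> Q'" if "Q' \<in> insert Q F" for Q'
    proof -
      have "p_ideal Q'" using that insert.prems(2) by (intro max_ideal_p_ideal) auto
      then show ?thesis using that g h p_idealD(4,5)[of Q'] int_eval_R[OF t(1)] by auto
    qed
    ultimately show ?case by blast
  qed
  have "\<exists>g. 1 - int_eval g t \<in> P \<and> (\<forall>Q\<in>max_ideals - {P}. int_eval g t \<in> Q)" if P: "P \<in> max_ideals" for P
  proof -
    have PI: "p_ideal P" using P max_ideal_p_ideal by auto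
    obtain g where g: "int_eval g t \<notin> P" "\<forall>Q\<in>max_ideals - {P}. int_eval g t \<in> Q"
      using sep[of "max_ideals - {P}" P] finite_max_ideals P by auto
    obtain y where y: "y \<in> R" "1 - int_eval g t * y \<in> P" using max_ideal_inverse[OF P int_eval_R[OF t(1)] g(1)] by blast
    obtain h where h: "y - int_eval h t \<in> P" using t(2)[OF P] y by (auto simp: generates_def)
    have "1 - int_eval g t * int_eval h t = (1 - int_eval g t * y) + int_eval g t * (y - int_eval h t)" by (simp add: algebra_simps)
    also have "\<dots> \<in> P" using y h by (intro p_idealD(3)[OF PI] p_idealD(4)[OF PI] int_eval_R t) auto
    finally have "1 - int_eval (g * h) t \<in> P" by simp
    moreover have "int_eval (g * h) t \<in> Q" if "Q \<in> max_ideals - {P}" for Q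
      using g that p_idealD(5)[OF max_ideal_p_ideal, of Q] int_eval_R[OF t(1)] by simp
    ultimately show ?thesis by blast
  qed
  then have "\<forall>P\<in>max_ideals. \<exists>g. 1 - int_eval g t \<in> P \<and> (\<forall>Q\<in>max_ideals - {P}. int_eval g t \<in> Q)" by blast
  from bchoice[OF this] obtain f where
    f': "\<forall>P\<in>max_ideals. 1 - int_eval (f P) t \<in> P \<and> (\<forall>Q\<in>max_ideals - {P}. int_eval (f P) t \<in> Q)" by (elim exE)
  have f: "\<And>P. P \<in> max_ideals \<Longrightarrow> 1 - int_eval (f P) t \<in> P"
    "\<And>P Q. P \<in> max_ideals \<Longrightarrow> Q \<in> max_ideals \<Longrightarrow> Q \<noteq> P \<Longrightarrow> int_eval (f P) t \<in> Q"
    using f' by auto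
  have gen_all: "\<exists>g. \<forall>P\<in>max_ideals. x - int_eval g t \<in> P" if x: "x \<in> R" for x
  proof -
    have "\<forall>P\<in>max_ideals. \<exists>g. x - int_eval g t \<in> P" using t(2) x unfolding generates_def by blast
    from bchoice[OF this] obtain h where h': "\<forall>P\<in>max_ideals. x - int_eval (h P) t \<in> P" by (elim exE)
    have h: "\<And>P. P \<in> max_ideals \<Longrightarrow> x - int_eval (h P) t \<in> P" using h' by simp
    define g where "g = (\<Sum>P\<in>max_ideals. f P * h P)"
    have "x - int_eval g t \<in> P" if P: "P \<in> max_ideals" for P
    proof -
      have PI: "p_ideal P" using P max_ideal_p_ideal by auto
      have "int_eval g t = int_eval (f P) t * int_eval (h P) t + (\<Sum>Q\<in>max_ideals - {P}. int_eval (f Q) t * int_eval (h Q) t)"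
        unfolding g_def int_eval_sum using finite_max_ideals P by (simp add: sum.remove)
      then have "x - int_eval g t = ((x - int_eval (h P) t) + (1 - int_eval (f P) t) * int_eval (h P) t)
          - (\<Sum>Q\<in>max_ideals - {P}. int_eval (f Q) t * int_eval (h Q) t)"
        by (simp add: algebra_simps)
      also have "\<dots> \<in> P"
      proof (rule p_ideal_diff[OF PI p_idealD(3)[OF PI h[OF P] p_idealD(5)[OF PI f(1)[OF P] int_eval_R[OF t(1)]]] p_ideal_sum[OF PI]])
        fix Q assume "Q \<in> max_ideals - {P}"
        then show "int_eval (f Q) t * int_eval (h Q) t \<in> P" using f(2)[of Q P] P p_idealD(5)[OF PI] int_eval_R[OF t(1)] by auto
      qed
      finally show ?thesis .
    qed
    then show ?thesis by blast
  qed
  obtain \<pi> where pi': "\<pi> \<in> R" "\<forall>P\<in>max_ideals. \<pi> \<in> P"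
    "\<forall>x\<in>R. (\<forall>P\<in>max_ideals. x \<in> P) \<longrightarrow> (\<exists>r\<in>R. x - \<pi> * r \<in> pR)"
    using radical_principal by (elim bexE conjE)
  have pi: "\<pi> \<in> R" "\<And>P. P \<in> max_ideals \<Longrightarrow> \<pi> \<in> P"
    "\<And>x. x \<in> R \<Longrightarrow> \<forall>P\<in>max_ideals. x \<in> P \<Longrightarrow> \<exists>r\<in>R. x - \<pi> * r \<in> pR"
    using pi' by simp_all
  obtain N where N': "\<forall>x\<in>R. x ^ (p ^ N * p ^ N) - x ^ (p ^ N) \<in> pR"
    "\<forall>x\<in>R. (\<forall>P\<in>max_ideals. x \<in> P) \<longrightarrow> x ^ (p ^ N) \<in> pR" "\<forall>x\<in>R. \<forall>P\<in>max_ideals. x ^ (p ^ N) - x \<in> P"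
    using frobenius_radical by (elim exE conjE)
  have N: "\<And>x. x \<in> R \<Longrightarrow> x ^ (p ^ N * p ^ N) - x ^ (p ^ N) \<in> pR"
    "\<And>x. x \<in> R \<Longrightarrow> \<forall>P\<in>max_ideals. x \<in> P \<Longrightarrow> x ^ (p ^ N) \<in> pR" "\<And>x P. x \<in> R \<Longrightarrow> P \<in> max_ideals \<Longrightarrow> x ^ (p ^ N) - x \<in> P"
    using N' by simp_all
  define q where "q = p ^ N"
  \<comment> \<open>\<open>s\<close> has the residues of \<open>t\<close> at all maximal ideals and
    is in addition fixed by the \<open>q\<close>-th power modulo \<open>p\<close>.\<close>
  define s where "s = t ^ q"
  define \<alpha> where "\<alpha> = s + \<pi>"
  have sR: "s \<in> R" and aR: "\<alpha> \<in> R" using t pi by (auto simp: s_def \<alpha>_def intro!: add_R power_R)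
  have piq: "\<pi> ^ q \<in> pR" using N(2)[OF pi(1)] pi(2) by (simp add: q_def)
  have aq: "\<alpha> ^ q - s \<in> pR"
  proof -
    have "\<alpha> ^ q - (s ^ q + \<pi> ^ q) \<in> pR"
      unfolding \<alpha>_def q_def by (rule frobenius_power_add[OF sR pi(1)])
    moreover have "s ^ q - s \<in> pR" using N(1)[OF t(1)] by (simp add: s_def q_def power_mult)
    ultimately have "(\<alpha> ^ q - (s ^ q + \<pi> ^ q)) + (s ^ q - s) + \<pi> ^ q \<in> pR"
      using piq by (intro p_idealD(3)[OF p_ideal_pR])
    then show ?thesis by simp
  qed
  \<comment> \<open>Since \<alpha>^q is congruent to \<open>s\<close>, the polynomial X - X^q takes
    the value \<pi> at \<alpha> modulo \<open>p\<close>.\<close>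
  define w where "w = [:0, 1:] - Polynomial.monom (1::int) q"
  have wpi: "\<pi> - int_eval w \<alpha> \<in> pR" using aq by (simp add: w_def poly_monom \<alpha>_def algebra_simps)
  have step: "\<exists>g. \<exists>r\<in>R. x - (int_eval g \<alpha> + \<pi> * r) \<in> pR" if x: "x \<in> R" for x
  proof -
    obtain h where h: "\<And>P. P \<in> max_ideals \<Longrightarrow> x - int_eval h t \<in> P" using gen_all[OF x] by blast
    have "x - int_eval h s \<in> P" if P: "P \<in> max_ideals" for P
    proof (rule p_ideal_cong_trans[OF max_ideal_p_ideal[OF P] h[OF P]])
      have "s - t \<in> P" unfolding s_def q_def by (rule N(3)[OF t(1) P])
      then have "t - s \<in> P" using p_ideal_uminus[OF max_ideal_p_ideal[OF P]] by fastforce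
      then show "int_eval h t - int_eval h s \<in> P" by (rule p_ideal_cong_int_eval[OF max_ideal_p_ideal[OF P] _ t(1) sR])
    qed
    then obtain r where r: "r \<in> R" "(x - int_eval h s) - \<pi> * r \<in> pR"
      using pi(3)[of "x - int_eval h s"] x int_eval_R[OF sR] diff_R by blast
    have "int_eval h (\<alpha> ^ q) - int_eval h s \<in> pR"
      by (rule p_ideal_cong_int_eval[OF p_ideal_pR aq]) (use aR sR in \<open>auto intro: power_R\<close>)
    from p_ideal_diff[OF p_ideal_pR r(2) this]
    have "x - (int_eval (pcompose h (Polynomial.monom 1 q)) \<alpha> + \<pi> * r) \<in> pR"
      by (simp add: int_eval_pcompose poly_monom algebra_simps)
    then show ?thesis using r(1) by blast
  qed
  \<comment> \<open>Successive approximation in powers of \<pi>; at k = q the remainder disappears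
    because \<pi>^q lies in \<open>pR\<close>.\<close>
  have "\<exists>g. \<exists>r\<in>R. x - (int_eval g \<alpha> + \<pi> ^ k * r) \<in> pR" if x: "x \<in> R" for x k
  proof (induction k)
    case 0
    then show ?case using x p_ideal_zero[OF p_ideal_pR] by (intro exI[of _ 0] bexI[of _ x]) simp_all
  next
    case (Suc k)
    then obtain g r where gr: "r \<in> R" "x - (int_eval g \<alpha> + \<pi> ^ k * r) \<in> pR" by blast
    obtain h r' where hr: "r' \<in> R" "r - (int_eval h \<alpha> + \<pi> * r') \<in> pR" using step[OF gr(1)] by blast
    have a: "\<pi> ^ k * (r - (int_eval h \<alpha> + \<pi> * r')) \<in> pR"
      by (rule p_idealD(4)[OF p_ideal_pR power_R[OF pi(1)] hr(2)])
    have "\<pi> ^ k - int_eval w \<alpha> ^ k \<in> pR" by (rule p_ideal_cong_power[OF p_ideal_pR wpi pi(1) int_eval_R[OF aR]])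
    then have b: "(\<pi> ^ k - int_eval w \<alpha> ^ k) * int_eval h \<alpha> \<in> pR" by (rule p_idealD(5)[OF p_ideal_pR _ int_eval_R[OF aR]])
    have evp: "int_eval (w ^ k) \<alpha> = int_eval w \<alpha> ^ k" by (induction k) simp_all
    have "x - (int_eval (g + w ^ k * h) \<alpha> + \<pi> ^ Suc k * r') =
      (x - (int_eval g \<alpha> + \<pi> ^ k * r)) + \<pi> ^ k * (r - (int_eval h \<alpha> + \<pi> * r')) + (\<pi> ^ k - int_eval w \<alpha> ^ k) * int_eval h \<alpha>"
      by (simp add: evp algebra_simps)
    also have "\<dots> \<in> pR" by (intro p_idealD(3)[OF p_ideal_pR] gr a b)
    finally show ?case using hr(1) by blast
  qed
  note * = this
  have "\<exists>g. x - int_eval g \<alpha> \<in> pR" if x: "x \<in> R" for x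
  proof -
    obtain g r where gr: "r \<in> R" "x - (int_eval g \<alpha> + \<pi> ^ q * r) \<in> pR" using *[OF x, of q] by blast
    have "(x - (int_eval g \<alpha> + \<pi> ^ q * r)) + \<pi> ^ q * r \<in> pR"
      by (rule p_idealD(3)[OF p_ideal_pR gr(2) p_idealD(5)[OF p_ideal_pR piq gr(1)]])
    then show ?thesis by auto
  qed
  then show ?thesis using aR by blast
qed

section \<open>A criterion for generation, and primes of degree one\<close>

lemma cancel_mod_p:
  assumes "\<not> int p dvd c" "x \<in> R" "of_int c * x \<in> pR"
  shows "x \<in> pR"
proof -
  obtain u v where uv: "u * int p + v * c = 1" using p_bezout  assms by blast
  have "x = of_int (u * int p + v * c) * x" unfolding uv by simp
  also have "\<dots> = of_nat p * (of_int u * x) + of_int v * (of_int c * x)"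
    by (simp add: algebra_simps)
  also have "\<dots> \<in> pR"
    by (rule p_idealD(3)[OF p_ideal_pR p_ideal_p_mult[OF p_ideal_pR] p_idealD(4)[OF p_ideal_pR of_int_R assms(3)]])
       (auto intro: mult_R assms)
  finally show ?thesis .
qed

text \<open>The \<open>n\<close> powers of \<alpha> together with \<open>x\<close> satisfy a
  primitive relation. The coefficient of \<open>x\<close> is prime to \<open>p\<close>, since
  otherwise independence would make all coefficients divisible by \<open>p\<close>.\<close>

lemma generates_if_indep:
  assumes \<alpha>: "\<alpha> \<in> R" and ind: "indep n \<alpha> pR" and n: "n > 0" and x: "x \<in> R"
  shows "\<exists>g. x - int_eval g \<alpha> \<in> pR"
proof -
  have xR: "(if i < n then \<alpha> ^ i else x) \<in> R" for i using \<alpha> x by (auto intro: power_R)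
  obtain m :: "nat \<Rightarrow> int" where m: "\<exists>i\<le>n. \<not> int p dvd m i"
    "(\<Sum>i\<le>n. of_int (m i) * (if i < n then \<alpha> ^ i else x)) = 0"
    using rank[of "\<lambda>i. if i < n then \<alpha> ^ i else x"] xR by blast
  define g where "g = (\<Sum>i<n. Polynomial.monom (m i) i)"
  have cg: "coeff g i = (if i < n then m i else 0)" for i
    by (simp add: g_def coeff_sum coeff_monom)
  have dg: "degree g < n" using n by (intro degree_lessI) (auto simp: cg)
  have "(\<Sum>i\<le>n. of_int (m i) * (if i < n then \<alpha> ^ i else x)) = int_eval g \<alpha> + of_int (m n) * x"
    by (simp add: lessThan_Suc_atMost[symmetric] g_def int_eval_sum poly_monom)
  then have rel: "of_int (m n) * x = - int_eval g \<alpha>" using m(2) by (simp add: eq_neg_iff_add_eq_0 add.commute)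
  have "\<not> int p dvd m n"
  proof
    assume d: "int p dvd m n"
    then have "- int_eval g \<alpha> \<in> pR" using p_ideal_dvd[OF p_ideal_pR d x] rel by simp
    then have "int_eval g \<alpha> \<in> pR" using p_ideal_uminus[OF p_ideal_pR] by fastforce
    then have "int p dvd coeff g i" for i using ind dg by (auto simp: indep_def)
    then have "int p dvd m i" if "i < n" for i using that cg by metis
    then show False using m(1) d by (metis nat_less_le)
  qed
  then obtain u v where uv: "u * int p + v * m n = 1" using p_bezout by blast
  have "x = of_int (u * int p + v * m n) * x" unfolding uv by simp
  also have "\<dots> = of_nat p * (of_int u * x) + of_int v * (of_int (m n) * x)"
    by (simp add: algebra_simps)
  finally have "x + of_int v * int_eval g \<alpha> = of_nat p * (of_int u * x)"
    unfolding rel by (metis add_uminus_conv_diff diff_add_cancel mult_minus_right)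
  moreover have "x - int_eval (Polynomial.smult (- v) g) \<alpha> = x + of_int v * int_eval g \<alpha>"
    unfolding int_eval_simps by simp
  moreover have "of_nat p * (of_int u * x) \<in> pR" by (intro p_ideal_p_mult[OF p_ideal_pR] mult_R of_int_R x)
  ultimately show ?thesis by metis
qed

lemma degree_one_frobenius:
  assumes "P \<in> max_ideals" "degree_one P" "z \<in> R"
  shows "z ^ p - z \<in> P"
proof -
  have PI: "p_ideal P" and P1: "1 \<notin> P" using assms max_ideal_p_ideal max_ideal_one by auto
  obtain m where m: "z - of_int m \<in> P" using assms by (auto simp: degree_one_def)
  have "int p dvd m ^ p - m"
  proof (cases "int p dvd m")
    case True
    then show ?thesis using p_pos by (auto intro: dvd_power dvd_diff dvd_trans)
  next
    case False
    obtain k where k: "k < p" "[m = int k] (mod int p)"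
    proof
      show "nat (m mod int p) < p" using p_pos by (simp add: nat_less_iff)
      show "[m = int (nat (m mod int p))] (mod int p)" using p_pos by (simp add: cong_def)
    qed
    then have "\<not> p dvd k" using False cong_dvd_iff by (metis int_dvd_int_iff cong_dvd_iff)
    then have "[k ^ (p - 1) = 1] (mod p)" using fermat_theorem prime_p by blast
    then have "[int k ^ (p - 1) = 1] (mod int p)" by (metis cong_int_iff of_nat_1 of_nat_power)
    then have "[m ^ (p - 1) = 1] (mod int p)" using k(2) cong_pow cong_trans by blast
    then have "[m ^ (p - 1) * m = 1 * m] (mod int p)" by (rule cong_scalar_right)
    moreover have "m ^ (p - 1) * m = m ^ p" using p_pos by (metis power_minus_mult)
    ultimately show ?thesis by (simp add: cong_iff_dvd_diff)
  qed
  then have "of_int m ^ p - of_int m \<in> P"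
    using of_int_in_p_ideal[OF PI P1, of "m ^ p - m"] by simp
  moreover have "z ^ p - of_int m ^ p \<in> P" by (rule p_ideal_cong_power[OF PI m assms(3) of_int_R])
  ultimately have "z ^ p - of_int m \<in> P" using p_ideal_cong_trans[OF PI] by blast
  moreover have "of_int m - z \<in> P" using p_ideal_uminus[OF PI m] by simp
  ultimately show ?thesis by (rule p_ideal_cong_trans[OF PI])
qed

text \<open>
  When \<open>n - 1\<close> primes of degree one lie over \<open>p\<close>, their intersection is at most one-dimensional
  modulo \<open>p\<close>, so every element acts on it as a scalar.
\<close>

lemma degree_one_scalar:
  assumes F: "F \<subseteq> max_ideals" "Suc (card F) = n" and w: "w \<in> R" "\<And>P. P \<in> F \<Longrightarrow> w \<in> P" and z: "z \<in> R"
  shows "\<exists>l::int. (z - of_int l) * w \<in> pR"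
proof -
  have finF: "finite F" using F finite_max_ideals finite_subset by blast
  have "\<forall>P\<in>F. \<exists>e. e \<in> R \<and> 1 - e \<in> P \<and> (\<forall>P'\<in>F - {P}. e \<in> P')"
    using max_ideal_separate_one[of "F - {P}" P for P] finF F by blast
  from bchoice[OF this] obtain e where
    e: "\<forall>P\<in>F. e P \<in> R \<and> 1 - e P \<in> P \<and> (\<forall>P'\<in>F - {P}. e P \<in> P')" by (elim exE)
  \<comment> \<open>The elements \<open>e P\<close> are n - 1 in number; with \<open>w\<close> and
    \<open>z * w\<close> there are n + 1, enough for a primitive relation.\<close>
  define x where "x i = (case i of Inl P \<Rightarrow> e P | Inr c \<Rightarrow> if c then z * w else w)" for i :: "'a set + bool"
  define I where "I = F <+> (UNIV :: bool set)"
  have I: "finite I" "card I > n" using finF F by (auto simp: I_def card_Plus)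
  have xR: "x i \<in> R" if "i \<in> I" for i
    using that e w z by (auto simp: I_def x_def intro: mult_R)
  obtain m :: "'a set + bool \<Rightarrow> int" where m: "\<exists>i\<in>I. \<not> int p dvd m i" "(\<Sum>i\<in>I. of_int (m i) * x i) = 0"
    using rank_finite[OF I, of x] xR by blast
  define c d where "c = m (Inr True)" and "d = m (Inr False)"
  have "(\<Sum>i\<in>I. of_int (m i) * x i) = (\<Sum>P\<in>F. of_int (m (Inl P)) * e P) + (of_int c * (z * w) + of_int d * w)"
    unfolding I_def using finF by (subst sum.Plus) (auto simp: x_def UNIV_bool c_def d_def)
  then have rel: "(\<Sum>P\<in>F. of_int (m (Inl P)) * e P) + (of_int c * (z * w) + of_int d * w) = 0" using m(2) by simp
  \<comment> \<open>Modulo \<open>P\<close> the element \<open>e P\<close> is 1 and all others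
    vanish, so the relation reduces to this one coefficient.\<close>
  have mP: "int p dvd m (Inl P)" if P: "P \<in> F" for P
  proof -
    have PI: "p_ideal P" "1 \<notin> P" using P F max_ideal_p_ideal max_ideal_one by auto
    have eP: "e P \<in> R" "1 - e P \<in> P" using e P by auto
    have "of_int (m (Inl P)) = of_int (m (Inl P)) * (1 - e P) -
       ((\<Sum>Q\<in>F - {P}. of_int (m (Inl Q)) * e Q) + (of_int c * (z * w) + of_int d * w))"
      using rel finF P by (simp add: sum.remove[of F P] algebra_simps add_eq_0_iff)
    also have "\<dots> \<in> P"
    proof (rule p_ideal_diff[OF PI(1) p_idealD(4)[OF PI(1) of_int_R eP(2)] p_idealD(3)[OF PI(1) p_ideal_sum[OF PI(1)]]])
      show "of_int (m (Inl Q)) * e Q \<in> P" if "Q \<in> F - {P}" for Q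
        using e that P by (intro p_idealD(4)[OF PI(1)]) auto
      show "of_int c * (z * w) + of_int d * w \<in> P"
        by (intro p_idealD(3)[OF PI(1)] p_idealD(4)[OF PI(1)] w(2)[OF P] z of_int_R)
    qed
    finally show ?thesis using of_int_in_p_ideal[OF PI] by blast
  qed
  have "- (\<Sum>P\<in>F. of_int (m (Inl P)) * e P) \<in> pR"
    using mP e by (intro p_ideal_uminus[OF p_ideal_pR] p_ideal_sum[OF p_ideal_pR] p_ideal_dvd[OF p_ideal_pR]) auto
  then have cd: "of_int c * (z * w) + of_int d * w \<in> pR" using rel by (simp add: add_eq_0_iff)
  show ?thesis
  proof (cases "int p dvd c")
    case True
    have "of_int c * (z * w) \<in> pR" by (rule p_ideal_dvd[OF p_ideal_pR True]) (use z w in \<open>auto intro: mult_R\<close>)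
    from p_ideal_diff[OF p_ideal_pR cd this] have "of_int d * w \<in> pR" by simp
    moreover have "\<not> int p dvd d" using m(1) mP True by (auto simp: I_def c_def d_def UNIV_bool)
    ultimately have "w \<in> pR" using cancel_mod_p w(1) by blast
    then have "(z - of_int 0) * w \<in> pR" using p_idealD(4)[OF p_ideal_pR z] by simp
    then show ?thesis by blast
  next
    case False
    then obtain u v where uv: "u * int p + v * c = 1" using p_bezout by blast
    have "(z - of_int (- (v * d))) * w = of_int (u * int p + v * c) * (z * w) + of_int (v * d) * w"
      unfolding uv by (simp add: algebra_simps)
    also have "\<dots> = of_nat p * (of_int u * (z * w)) + of_int v * (of_int c * (z * w) + of_int d * w)"
      by (simp add: algebra_simps)
    also have "\<dots> \<in> pR"
      by (rule p_idealD(3)[OF p_ideal_pR p_ideal_p_mult[OF p_ideal_pR] p_idealD(4)[OF p_ideal_pR of_int_R cd]])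
         (use z w in \<open>auto intro: mult_R\<close>)
    finally show ?thesis by blast
  qed
qed

lemma degree_one_polynomial:
  assumes F: "F \<subseteq> max_ideals" "Suc (card F) = n" "\<And>P. P \<in> F \<Longrightarrow> degree_one P" and z: "z \<in> R"
  shows "\<exists>l::int. (z - of_int l) * (z ^ p - z) \<in> pR"
  using F z degree_one_frobenius by (intro degree_one_scalar[OF F(1,2)]) (auto intro: diff_R power_R)

text \<open>By \<open>degree_one_scalar\<close>, \<open>z\<close> acts on itself as an integer
  \<open>l\<close>. If \<open>p\<close> divides \<open>l\<close> the claim is immediate; otherwise
  z^(k+1) is congruent to l^k z, which forces \<open>z\<close> itself into
  \<open>pR\<close>.\<close>

lemma degree_one_nilpotent:
  assumes F: "F \<subseteq> max_ideals" "Suc (card F) = n" and z: "z \<in> R" "z ^ k \<in> pR"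
  shows "z * z \<in> pR"
proof -
  have "z \<in> P" if "P \<in> F" for P
    using max_ideal_power[OF _ z(1)] p_idealD(1)[OF max_ideal_p_ideal z(2)] F(1) that by blast
  then obtain l :: int where l: "(z - of_int l) * z \<in> pR"
    using degree_one_scalar[OF F z(1) _ z(1)] by blast
  show ?thesis
  proof (cases "int p dvd l")
    case True
    have "(z - of_int l) * z + of_int l * z \<in> pR"
      by (rule p_idealD(3)[OF p_ideal_pR l p_ideal_dvd[OF p_ideal_pR True z(1)]])
    then show ?thesis by (simp add: algebra_simps)
  next
    case False
    have "z * z ^ j - of_int (l ^ j) * z \<in> pR" for j
    proof (induction j)
      case 0
      then show ?case using p_ideal_zero[OF p_ideal_pR] by simp
    next
      case (Suc j)
      have "z * z ^ Suc j - of_int (l ^ Suc j) * z =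
        z * (z * z ^ j - of_int (l ^ j) * z) + of_int (l ^ j) * ((z - of_int l) * z)"
        by (simp add: algebra_simps)
      also have "\<dots> \<in> pR"
        by (intro p_idealD(3)[OF p_ideal_pR] p_idealD(4)[OF p_ideal_pR] z(1) of_int_R Suc l)
      finally show ?case .
    qed
    from p_ideal_diff[OF p_ideal_pR p_idealD(4)[OF p_ideal_pR z(1,2)] this[of k]]
    have "of_int (l ^ k) * z \<in> pR" by simp
    moreover have "\<not> int p dvd l ^ k" using False prime_p prime_dvd_power by (metis prime_int_nat_transfer prime_nat_int_transfer)
    ultimately have "z \<in> pR" using cancel_mod_p z(1) by blast
    then show ?thesis using p_idealD(4)[OF p_ideal_pR z(1)] by simp
  qed
qed

lemma indepI:
  assumes "\<And>c. (\<Sum>k<d. of_int (c k) * s ^ k) \<in> I \<Longrightarrow> \<forall>k<d. int p dvd c k"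
  shows "indep d s I"
  unfolding indep_def
proof (intro allI impI)
  fix g i assume g: "degree g < d" "int_eval g s \<in> I"
  have "g = (\<Sum>k<d. Polynomial.monom (coeff g k) k)"
    using g(1) by (intro poly_eqI) (auto simp: coeff_sum coeff_monom coeff_eq_0)
  then have "int_eval g s = int_eval (\<Sum>k<d. Polynomial.monom (coeff g k) k) s" by simp
  then have "(\<Sum>k<d. of_int (coeff g k) * s ^ k) \<in> I" using g(2) by (simp add: int_eval_sum poly_monom)
  then have "\<forall>k<d. int p dvd coeff g k" by (rule assms)
  then show "int p dvd coeff g i" using g(1) by (cases "i < d") (auto simp: coeff_eq_0)
qed

lemma card_max_ideals_le: "F \<subseteq> max_ideals \<Longrightarrow> card F \<le> n"
  using card_mult_indep_le[of F "\<lambda>_. 1" 1] indep_one finite_subset[OF _ finite_max_ideals] by fastforce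

end

section \<open>The field generated by a root of a septic trinomial\<close>

abbreviation rat_eval :: "rat poly \<Rightarrow> 'a::field_char_0 \<Rightarrow> 'a" where
  "rat_eval g x \<equiv> poly (map_poly of_rat g) x"

lemma rat_eval_add: "rat_eval (g + h) x = rat_eval g x + rat_eval h x"
  by (simp add: of_rat_hom.map_poly_hom_add)

lemma rat_eval_diff: "rat_eval (g - h) x = rat_eval g x - rat_eval h x"
  using rat_eval_add[of "g - h" h x] by simp

lemma rat_eval_smult: "rat_eval (Polynomial.smult c g) x = of_rat c * rat_eval g x"
  by (simp add: of_rat_hom.map_poly_hom_smult)

lemma rat_eval_pCons: "rat_eval (pCons c g) x = of_rat c + x * rat_eval g x"
  by (simp add: of_rat_hom.map_poly_pCons_hom)

lemma rat_eval_mult: "rat_eval (g * h) x = rat_eval g x * rat_eval h x"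
  by (induction g) (simp_all add: rat_eval_add rat_eval_smult rat_eval_pCons algebra_simps)

lemma rat_eval_simps [simp]:
  "rat_eval 0 x = 0" "rat_eval 1 x = 1" "rat_eval (pCons c g) x = of_rat c + x * rat_eval g x"
  "rat_eval (g + h) x = rat_eval g x + rat_eval h x" "rat_eval (g - h) x = rat_eval g x - rat_eval h x" "rat_eval (g * h) x = rat_eval g x * rat_eval h x"
  "rat_eval (Polynomial.smult c g) x = of_rat c * rat_eval g x"
  by (simp_all add: rat_eval_pCons rat_eval_add rat_eval_diff rat_eval_mult rat_eval_smult)

lemma rat_eval_monom: "rat_eval (Polynomial.monom c k) x = of_rat c * x ^ k"
  by (simp add: map_poly_monom poly_monom)

lemma rat_eval_sum: "rat_eval (\<Sum>i\<in>I. g i) x = (\<Sum>i\<in>I. rat_eval (g i) x)"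
  by (induction I rule: infinite_finite_induct) auto

lemma rat_eval_of_int_poly: "rat_eval (map_poly of_int g) x = int_eval g x"
  by (induction g) (auto simp: of_int_hom.map_poly_pCons_hom)

lemma rat_eval_pcompose: "rat_eval (pcompose g h) x = rat_eval g (rat_eval h x)"
  by (induction g) (auto simp: pcompose_pCons)

lemma ring_of_type_algebra_simps [simp]:
  "carrier ring_of_type_algebra = UNIV" "x \<otimes>\<^bsub>ring_of_type_algebra\<^esub> y = x * y"
  "x \<oplus>\<^bsub>ring_of_type_algebra\<^esub> y = x + y" "\<one>\<^bsub>ring_of_type_algebra\<^esub> = 1" "\<zero>\<^bsub>ring_of_type_algebra\<^esub> = 0"
  by (auto simp: ring_of_type_algebra_def)

lemma ring_of_type_algebra_minus [simp]: "\<ominus>\<^bsub>ring_of_type_algebra\<^esub> x = - (x :: 'a::comm_ring_1)"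
proof -
  interpret ring "ring_of_type_algebra :: 'a ring" by (rule ring_from_type_algebra)
  show ?thesis by (rule minus_equality) auto
qed

lemma ring_of_type_algebra_inv: "(x :: 'a::Fields.field) \<noteq> 0 \<Longrightarrow> inv\<^bsub>ring_of_type_algebra\<^esub> x = inverse x"
proof -
  interpret cring "ring_of_type_algebra :: 'a ring" by (rule cring_from_type_algebra)
  show "x \<noteq> 0 \<Longrightarrow> ?thesis" by (rule comm_inv_char) auto
qed

lemma int_adjoin_eq: "int_adjoin \<alpha> = range (\<lambda>g. int_eval g \<alpha>)"
proof (intro equalityI subsetI)
  fix x assume "x \<in> int_adjoin \<alpha>"
  then show "x \<in> range (\<lambda>g. int_eval g \<alpha>)"
    unfolding int_adjoin_def
  proof (induction rule: generate_ring.induct)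
    case one
    then show ?case by (auto intro: image_eqI[of _ _ 1])
  next
    case (incl h)
    then show ?case by (auto intro!: image_eqI[of _ _ "[:0, 1:]"])
  next
    case (a_inv h)
    then obtain g where "h = int_eval g \<alpha>" by auto
    then show ?case by (auto intro!: image_eqI[of _ _ "0 - g"] simp del: diff_0)
  next
    case (eng_add h1 h2)
    then obtain g k where "h1 = int_eval g \<alpha>" "h2 = int_eval k \<alpha>" by auto
    then show ?case by (auto intro!: image_eqI[of _ _ "g + k"])
  next
    case (eng_mult h1 h2)
    then obtain g k where "h1 = int_eval g \<alpha>" "h2 = int_eval k \<alpha>" by auto
    then show ?case by (auto intro!: image_eqI[of _ _ "g * k"])
  qed
next
  fix x assume "x \<in> range (\<lambda>g. int_eval g \<alpha>)"
  then obtain g where x: "x = int_eval g \<alpha>" by auto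
  have add: "y + z \<in> int_adjoin \<alpha>" if "y \<in> int_adjoin \<alpha>" "z \<in> int_adjoin \<alpha>" for y z
    using generate_ring.eng_add[of y ring_of_type_algebra "{\<alpha>}" z] that by (simp add: int_adjoin_def)
  have mult: "y * z \<in> int_adjoin \<alpha>" if "y \<in> int_adjoin \<alpha>" "z \<in> int_adjoin \<alpha>" for y z
    using generate_ring.eng_mult[of y ring_of_type_algebra "{\<alpha>}" z] that by (simp add: int_adjoin_def)
  have neg: "- y \<in> int_adjoin \<alpha>" if "y \<in> int_adjoin \<alpha>" for y
    using generate_ring.a_inv[of y ring_of_type_algebra "{\<alpha>}"] that by (simp add: int_adjoin_def)
  have one: "1 \<in> int_adjoin \<alpha>"
    using generate_ring.one[of ring_of_type_algebra "{\<alpha>}"] by (simp add: int_adjoin_def)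
  have al: "\<alpha> \<in> int_adjoin \<alpha>"
    using generate_ring.incl[of \<alpha> "{\<alpha>}" ring_of_type_algebra] by (simp add: int_adjoin_def)
  have zero: "0 \<in> int_adjoin \<alpha>" using add[OF one neg[OF one]] by simp
  have int: "of_int m \<in> int_adjoin \<alpha>" for m
    using int_mult_mem[OF zero add neg one, of m] by simp
  show "x \<in> int_adjoin \<alpha>" unfolding x
    by (induction g) (auto intro!: add mult zero int al)
qed

text \<open>Linear dependence over the rationals, after clearing denominators by \<open>d\<close>
  and dividing by the gcd \<open>g\<close> of the coefficients; what remains cannot be divisible by
  \<open>p\<close> throughout. Repeated values give a relation with coefficients 1 and -1.\<close>

lemma primitive_relation:
  fixes x :: "nat \<Rightarrow> 'a::field_char_0"
  assumes B: "finite B" "card B \<le> n" and x: "\<And>i. i \<le> n \<Longrightarrow> \<exists>c. x i = (\<Sum>v\<in>B. of_rat (c v) * v)"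
    and p: "prime (p :: nat)"
  shows "\<exists>m :: nat \<Rightarrow> int. (\<exists>i\<le>n. \<not> int p dvd m i) \<and> (\<Sum>i\<le>n. of_int (m i) * x i) = 0"
proof (cases "inj_on x {..n}")
  case False
  then obtain i j where ij: "i \<le> n" "j \<le> n" "i \<noteq> j" "x i = x j" by (auto simp: inj_on_def)
  define m :: "nat \<Rightarrow> int" where "m k = (if k = i then 1 else if k = j then -1 else 0)" for k
  have "(\<Sum>k\<le>n. of_int (m k) * x k) = (\<Sum>k\<in>{i, j}. of_int (m k) * x k)"
    by (rule sum.mono_neutral_right) (use ij in \<open>auto simp: m_def\<close>)
  also have "\<dots> = 0" using ij by (simp add: m_def)
  finally have "(\<Sum>k\<le>n. of_int (m k) * x k) = 0" .
  moreover have "\<not> int p dvd m i" using p by (auto simp: m_def)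
  ultimately show ?thesis using ij(1) by blast
next
  case True
  interpret V: vector_space "\<lambda>r (v::'a). of_rat r * v"
    by unfold_locales (auto simp: algebra_simps of_rat_add of_rat_mult)
  have "x i \<in> V.span B" if i: "i \<le> n" for i
  proof -
    obtain c where "x i = (\<Sum>v\<in>B. of_rat (c v) * v)" using x[OF i] by (elim exE)
    then show ?thesis by (simp add: V.span_sum V.span_scale V.span_base)
  qed
  then have sub: "x ` {..n} \<subseteq> V.span B" by auto
  have "card (x ` {..n}) = Suc n" using card_image[OF True] by simp
  then have "V.dependent (x ` {..n})" using V.independent_span_bound[OF B(1) _ sub] B(2) by auto
  then obtain T u v0 where T: "finite T" "T \<subseteq> x ` {..n}" "(\<Sum>v\<in>T. of_rat (u v) * v) = 0" "v0 \<in> T" "u v0 \<noteq> 0"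
    unfolding V.dependent_explicit by blast
  define c where "c i = (if x i \<in> T then u (x i) else 0)" for i
  have "(\<Sum>i\<le>n. of_rat (c i) * x i) = (\<Sum>v\<in>x ` {..n}. of_rat (if v \<in> T then u v else 0) * v)"
    by (subst sum.reindex[OF True]) (simp add: c_def)
  also have "\<dots> = (\<Sum>v\<in>T. of_rat (u v) * v)"
    by (rule sum.mono_neutral_cong_right) (use T in auto)
  finally have c0: "(\<Sum>i\<le>n. of_rat (c i) * x i) = 0" using T by simp
  obtain i0 where i0: "i0 \<le> n" "c i0 \<noteq> 0" using T by (auto simp: c_def)
  define d where "d = (\<Prod>i\<le>n. snd (quotient_of (c i)))"
  have d: "d > 0" unfolding d_def by (intro prod_pos) (auto simp: quotient_of_denom_pos')
  have "\<exists>k::int. of_int d * c i = of_int k" if "i \<le> n" for i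
  proof -
    have q: "c i = of_int (fst (quotient_of (c i))) / of_int (snd (quotient_of (c i)))"
      by (metis prod.collapse quotient_of_div)
    have "snd (quotient_of (c i)) dvd d" unfolding d_def using that by (intro dvd_prodI) auto
    then obtain k where "d = snd (quotient_of (c i)) * k" by (auto elim: dvdE)
    then have "of_int d * c i = of_int (k * fst (quotient_of (c i)))"
      using q quotient_of_denom_pos'[of "c i"] by (simp add: field_simps)
    then show ?thesis by blast
  qed
  then obtain k :: "nat \<Rightarrow> int" where k: "\<And>i. i \<le> n \<Longrightarrow> of_int d * c i = of_int (k i)" by metis
  define g where "g = Gcd (k ` {..n})"
  have "k i0 \<noteq> 0" using k[OF i0(1)] i0(2) d by auto
  then have g0: "g \<noteq> 0" unfolding g_def using i0(1) by auto
  have gd: "g dvd k i" if "i \<le> n" for i unfolding g_def using that by auto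
  define m where "m i = k i div g" for i
  have mg: "k i = g * m i" if "i \<le> n" for i using gd[OF that] by (simp add: m_def)
  have "\<exists>i\<le>n. \<not> int p dvd m i"
  proof (rule ccontr)
    assume "\<not> ?thesis"
    then have "g * int p dvd k i" if "i \<le> n" for i using mg[OF that] that by simp
    then have "g * int p dvd g" unfolding g_def by (intro Gcd_greatest) auto
    then show False using g0 p by auto
  qed
  moreover have "of_int g * (\<Sum>i\<le>n. of_int (m i) * x i) = (\<Sum>i\<le>n. of_int (k i) * x i)"
    unfolding sum_distrib_left by (rule sum.cong) (auto simp: mg)
  moreover have "(\<Sum>i\<le>n. of_int (k i) * x i) = of_int d * (\<Sum>i\<le>n. of_rat (c i) * x i)"
    unfolding sum_distrib_left
    by (rule sum.cong) (auto simp flip: k[THEN arg_cong[of _ _ of_rat], unfolded of_rat_of_int_eq] simp: of_rat_mult)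
  ultimately show ?thesis using c0 g0 by auto
qed

text \<open>The quantity in \<open>disc\<close> is, up to sign, the discriminant of the trinomial;
  it makes the seven roots distinct.\<close>

locale trinomial =
  fixes a b :: int and \<theta> :: complex
  assumes irr: "Factorial_Ring.irreducible [:rat_of_int b, rat_of_int a, 0, 0, 0, 0, 0, 1:]"
    and root: "\<theta> ^ 7 = - of_int a * \<theta> - of_int b"
    and disc: "7 ^ 7 * b ^ 6 + 6 ^ 6 * a ^ 7 \<noteq> 0" and b0: "b \<noteq> 0"
begin

definition F :: "rat poly" where "F = [:of_int b, of_int a, 0, 0, 0, 0, 0, 1:]"

lemma degree_F: "degree F = 7" and irr_F: "Factorial_Ring.irreducible F"
  using irr by (simp_all add: F_def)

lemma rat_eval_F: "rat_eval F x = x ^ 7 + of_int a * x + of_int b"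
  by (simp add: F_def algebra_simps power_numeral_reduce)

lemma rat_eval_F_root: "rat_eval F \<theta> = 0"
  by (simp add: rat_eval_F root)

lemma F_coprime_or_dvd: "F dvd g \<or> (\<exists>u v. u * F + v * g = 1)"
proof (cases "F dvd g")
  case False
  have "prime_elem F" using irr_F by (rule irreducible_imp_prime_elem)
  then have "coprime F g" using False by (rule prime_elem_imp_coprime)
  then have "gcd F g = 1" by simp
  then show ?thesis using bezout_coefficients_fst_snd[of F g] by metis
qed simp

lemma F_dvd_iff: "rat_eval g \<theta> = 0 \<longleftrightarrow> F dvd g"
proof
  assume g: "rat_eval g \<theta> = 0"
  show "F dvd g"
  proof (rule ccontr)
    assume "\<not> F dvd g"
    then obtain u v where "u * F + v * g = 1" using F_coprime_or_dvd by blast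
    then have "rat_eval (u * F + v * g) \<theta> = rat_eval 1 \<theta>" by simp
    then show False using g rat_eval_F_root by simp
  qed
qed (auto simp: rat_eval_F_root elim!: dvdE)

section \<open>The field \<open>K\<close> and its power basis\<close>

definition K :: "complex set" where "K = range (\<lambda>g. rat_eval g \<theta>)"

lemma K_add: "x \<in> K \<Longrightarrow> y \<in> K \<Longrightarrow> x + y \<in> K"
proof -
  assume "x \<in> K" "y \<in> K"
  then obtain g h where "x = rat_eval g \<theta>" "y = rat_eval h \<theta>" unfolding K_def by blast
  then have "x + y = rat_eval (g + h) \<theta>" by simp
  then show ?thesis unfolding K_def by blast
qed

lemma K_mult: "x \<in> K \<Longrightarrow> y \<in> K \<Longrightarrow> x * y \<in> K"
proof -
  assume "x \<in> K" "y \<in> K"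
  then obtain g h where "x = rat_eval g \<theta>" "y = rat_eval h \<theta>" unfolding K_def by blast
  then have "x * y = rat_eval (g * h) \<theta>" by simp
  then show ?thesis unfolding K_def by blast
qed

lemma K_diff: "x \<in> K \<Longrightarrow> y \<in> K \<Longrightarrow> x - y \<in> K"
proof -
  assume "x \<in> K" "y \<in> K"
  then obtain g h where "x = rat_eval g \<theta>" "y = rat_eval h \<theta>" unfolding K_def by blast
  then have "x - y = rat_eval (g - h) \<theta>" by simp
  then show ?thesis unfolding K_def by blast
qed

lemma K_of_rat [simp]: "of_rat r \<in> K"
  unfolding K_def by (rule range_eqI[of _ _ "[:r:]"]) simp

lemma K_of_int [simp]: "of_int m \<in> K"
  using K_of_rat[of "of_int m"] by simp

lemma K_0 [simp]: "0 \<in> K" and K_1 [simp]: "1 \<in> K"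
  using K_of_int[of 0] K_of_int[of 1] by simp_all

lemma K_root [simp]: "\<theta> \<in> K"
  unfolding K_def by (rule range_eqI[of _ _ "[:0, 1:]"]) simp

lemma K_power: "x \<in> K \<Longrightarrow> x ^ k \<in> K"
  by (induction k) (auto intro: K_mult)

lemma K_inverse: "x \<in> K \<Longrightarrow> inverse x \<in> K"
proof (cases "x = 0")
  case False
  assume "x \<in> K"
  then obtain g where g: "x = rat_eval g \<theta>" by (auto simp: K_def)
  then obtain u v where "u * F + v * g = 1" using F_coprime_or_dvd[of g] F_dvd_iff[of g] False by blast
  then have "rat_eval (u * F + v * g) \<theta> = rat_eval 1 \<theta>" by simp
  then have "rat_eval v \<theta> * x = 1" using g rat_eval_F_root by simp
  then have "inverse x = rat_eval v \<theta>" using False by (simp add: field_simps)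
  then show ?thesis by (simp add: K_def)
qed simp

lemma K_divide: "x \<in> K \<Longrightarrow> y \<in> K \<Longrightarrow> x / y \<in> K"
  unfolding divide_inverse by (intro K_mult K_inverse)

lemma rat_adjoin_subset:
  assumes "\<alpha> \<in> K"
  shows "rat_adjoin \<alpha> \<subseteq> K"
proof
  fix x assume "x \<in> rat_adjoin \<alpha>"
  then show "x \<in> K"
    unfolding rat_adjoin_def
  proof (induction rule: generate_field.induct)
    case (m_inv h)
    then show ?case by (simp add: ring_of_type_algebra_inv K_inverse)
  next
    case (a_inv h)
    then show ?case using K_diff[of 0 h] by simp
  qed (use assms in \<open>auto intro: K_add K_mult\<close>)
qed

lemma rat_eval_in_rat_adjoin: "rat_eval g (\<alpha> :: complex) \<in> rat_adjoin \<alpha>"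
proof -
  have add: "y + z \<in> rat_adjoin \<alpha>" if "y \<in> rat_adjoin \<alpha>" "z \<in> rat_adjoin \<alpha>" for y z
    using generate_field.eng_add[of y ring_of_type_algebra "{\<alpha>}" z] that by (simp add: rat_adjoin_def)
  have mult: "y * z \<in> rat_adjoin \<alpha>" if "y \<in> rat_adjoin \<alpha>" "z \<in> rat_adjoin \<alpha>" for y z
    using generate_field.eng_mult[of y ring_of_type_algebra "{\<alpha>}" z] that by (simp add: rat_adjoin_def)
  have neg: "- y \<in> rat_adjoin \<alpha>" if "y \<in> rat_adjoin \<alpha>" for y
    using generate_field.a_inv[of y ring_of_type_algebra "{\<alpha>}"] that by (simp add: rat_adjoin_def)
  have inv: "inverse y \<in> rat_adjoin \<alpha>" if "y \<in> rat_adjoin \<alpha>" "y \<noteq> 0" for y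
    using generate_field.m_inv[of y ring_of_type_algebra "{\<alpha>}"] that
    by (simp add: rat_adjoin_def ring_of_type_algebra_inv)
  have one: "1 \<in> rat_adjoin \<alpha>"
    using generate_field.one[of ring_of_type_algebra "{\<alpha>}"] by (simp add: rat_adjoin_def)
  have al: "\<alpha> \<in> rat_adjoin \<alpha>"
    using generate_field.incl[of \<alpha> "{\<alpha>}" ring_of_type_algebra] by (simp add: rat_adjoin_def)
  have zero: "0 \<in> rat_adjoin \<alpha>" using add[OF one neg[OF one]] by simp
  have int: "of_int m \<in> rat_adjoin \<alpha>" for m
    using int_mult_mem[OF zero add neg one, of m] by simp
  have rat: "of_rat r \<in> rat_adjoin \<alpha>" for r
  proof (cases r)
    case (Fract m k)
    then have "of_rat r = of_int m * inverse (of_int k :: complex)"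
      by (simp add: of_rat_rat divide_inverse)
    then show ?thesis using mult[OF int inv[OF int]] Fract by simp
  qed
  show ?thesis by (induction g) (auto intro!: add mult zero rat al)
qed

lemma rat_adjoin_root: "rat_adjoin \<theta> = K"
  using rat_adjoin_subset[OF K_root] rat_eval_in_rat_adjoin unfolding K_def by blast

lemma K_basis: "x \<in> K \<Longrightarrow> \<exists>c :: nat \<Rightarrow> rat. x = (\<Sum>k<7. of_rat (c k) * \<theta> ^ k)"
proof -
  assume "x \<in> K"
  then obtain g where g: "x = rat_eval g \<theta>" by (auto simp: K_def)
  define h where "h = g mod F"
  have "g = g div F * F + h" unfolding h_def by (rule div_mult_mod_eq[symmetric])
  then have "x = rat_eval (g div F * F + h) \<theta>" using g by simp
  then have x: "x = rat_eval h \<theta>" using rat_eval_F_root by simp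
  have "F \<noteq> 0" using degree_F by auto
  then have dh: "degree h < 7" using degree_mod_less[of F g] degree_F by (auto simp: h_def)
  have "h = (\<Sum>k<7. Polynomial.monom (coeff h k) k)"
    using dh by (intro poly_eqI) (auto simp: coeff_sum coeff_monom coeff_eq_0)
  then have "rat_eval h \<theta> = rat_eval (\<Sum>k<7. Polynomial.monom (coeff h k) k) \<theta>" by simp
  then show ?thesis unfolding x by (auto simp: rat_eval_sum rat_eval_monom simp del: of_rat_hom.map_poly_hom_monom)
qed

lemma sum7: "(\<Sum>k<(7::nat). g k) = g 0 + g 1 + g 2 + g 3 + g 4 + g 5 + (g 6 :: 'c::comm_monoid_add)"
  by (simp add: eval_nat_numeral add_ac)

lemma K_relation:
  assumes "prime (p :: nat)" "\<And>i. i \<le> 7 \<Longrightarrow> x i \<in> K"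
  shows "\<exists>m :: nat \<Rightarrow> int. (\<exists>i\<le>7. \<not> int p dvd m i) \<and> (\<Sum>i\<le>7. of_int (m i) * x i) = 0"
proof (rule primitive_relation[OF _ _ _ assms(1)])
  let ?B = "(\<lambda>k. \<theta> ^ k) ` {..<7}"
  show "finite ?B" by simp
  show "card ?B \<le> 7" using card_image_le[of "{..<7}" "\<lambda>k. \<theta> ^ k"] by simp
  have inj: "inj_on (\<lambda>k. \<theta> ^ k) {..<7}"
  proof (rule inj_onI, rule ccontr)
    fix i j :: nat assume ij: "i \<in> {..<7}" "j \<in> {..<7}" "\<theta> ^ i = \<theta> ^ j" "i \<noteq> j"
    define g where "g = Polynomial.monom (1::rat) i - Polynomial.monom 1 j"
    have "rat_eval g \<theta> = 0" using ij by (simp add: g_def poly_monom)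
    then have "F dvd g" by (simp add: F_dvd_iff)
    moreover have "coeff g i \<noteq> 0" using ij by (simp add: g_def coeff_monom)
    then have "g \<noteq> 0" by auto
    ultimately have "7 \<le> degree g" using dvd_imp_degree_le degree_F by metis
    moreover have "degree g < 7"
      unfolding g_def using ij by (intro degree_diff_less) (auto intro: le_less_trans[OF degree_monom_le])
    ultimately show False by simp
  qed
  fix i :: nat assume "i \<le> 7"
  then obtain c where c: "x i = (\<Sum>k<7. of_rat (c k) * \<theta> ^ k)" using K_basis[OF assms(2)] by blast
  have "(\<Sum>v\<in>?B. of_rat (c (the_inv_into {..<7} (\<lambda>k. \<theta> ^ k) v)) * v) = x i"
    unfolding c by (subst sum.reindex[OF inj]) (simp add: the_inv_into_f_f[OF inj])
  then show "\<exists>c. x i = (\<Sum>v\<in>?B. of_rat (c v) * v)" by metis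
qed

section \<open>Conjugates, power sums and the trace\<close>

definition Z :: "complex set" where "Z = {z. rat_eval F z = 0}"

lemma Z_iff: "z \<in> Z \<longleftrightarrow> z ^ 7 + of_int a * z + of_int b = 0"
  by (simp add: Z_def rat_eval_F)

definition Fc :: "complex poly" where "Fc = [:of_int b, of_int a, 0, 0, 0, 0, 0, 1:]"

lemma Fc: "poly Fc x = rat_eval F x" "degree Fc = 7" "Fc \<noteq> 0"
  by (simp_all add: Fc_def F_def)

lemma Fc_rsquarefree: "rsquarefree Fc"
proof -
  have "\<not> (poly Fc z = 0 \<and> poly (pderiv Fc) z = 0)" for z
  proof
    assume z: "poly Fc z = 0 \<and> poly (pderiv Fc) z = 0"
    have 1: "z ^ 7 + of_int a * z + of_int b = 0" using z by (simp add: Fc(1) rat_eval_F)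
    have 2: "7 * z ^ 6 + of_int a = 0" using z
      by (simp add: Fc_def pderiv_pCons algebra_simps power_numeral_reduce)
    have "6 * of_int a * z - - 7 * of_int b = 7 * (z ^ 7 + of_int a * z + of_int b) - z * (7 * z ^ 6 + of_int a)"
      by (simp add: algebra_simps power_numeral_reduce)
    then have "6 * of_int a * z - - 7 * of_int b = 0" unfolding 1 2 by simp
    then have 3: "6 * of_int a * z = - 7 * of_int b" by (simp only: right_minus_eq)
    have "6 ^ 6 * of_int a ^ 6 * (7 * z ^ 6 + of_int a) = 7 * (6 * of_int a * z) ^ 6 + 6 ^ 6 * of_int a ^ 7"
      by (simp add: power_mult_distrib algebra_simps power_numeral_reduce)
    then have "7 * (- 7 * of_int b) ^ 6 + 6 ^ 6 * of_int a ^ 7 = (0 :: complex)"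
      unfolding 2 3 by simp
    then have "of_int (7 ^ 7 * b ^ 6 + 6 ^ 6 * a ^ 7) = (0 :: complex)"
      by (simp add: power_mult_distrib)
    then show False using disc by (simp only: of_int_eq_0_iff)
  qed
  then show ?thesis by (simp add: rsquarefree_roots)
qed

lemma finite_Z: "finite Z"
  unfolding Z_def Fc(1)[symmetric] using poly_roots_finite[OF Fc(3)] by simp

lemma Fc_prod: "Fc = (\<Prod>z\<in>Z. [:- z, 1:])"
proof -
  have "Polynomial.smult (lead_coeff Fc) (\<Prod>z|poly Fc z = 0. [:- z, 1:]) = Fc"
    by (rule complex_poly_decompose_rsquarefree[OF Fc_rsquarefree])
  moreover have "lead_coeff Fc = 1" by (simp add: Fc_def)
  ultimately show ?thesis by (simp add: Z_def Fc(1))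
qed

lemma card_Z: "card Z = 7"
proof -
  have "degree (\<Prod>z\<in>Z. [:- z, 1:]) = (\<Sum>z\<in>Z. degree [:- z, 1:])"
    by (rule degree_prod_eq_sum_degree) simp
  then show ?thesis using Fc(2) Fc_prod by simp
qed

text \<open>Newton's identities, read off from the derivative as the sum of the quotients of
  \<open>Fc\<close> by X - z. The quotient \<open>s z\<close>, found by synthetic division, has z^k
  as coefficient of X^(6-k), with \<open>a\<close> added when k = 6.\<close>

lemma power_sums: "(\<Sum>z\<in>Z. z ^ 6) = - 6 * of_int a" "k \<in> {1..5} \<Longrightarrow> (\<Sum>z\<in>Z. z ^ k) = 0"
proof -
  define s where "s z = [:z ^ 6 + of_int a, z ^ 5, z ^ 4, z ^ 3, z ^ 2, z, 1 :: complex:]" for z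
  have s: "(\<Prod>w\<in>Z - {z}. [:- w, 1:]) = s z" if z: "z \<in> Z" for z
  proof -
    have "[:- z, 1:] * s z = [:- (z ^ 7 + of_int a * z), of_int a, 0, 0, 0, 0, 0, 1:]"
      by (simp add: s_def algebra_simps power_numeral_reduce)
    also have "- (z ^ 7 + of_int a * z) = of_int b"
      using z unfolding Z_iff by (metis add.inverse_unique add.commute)
    also have "[:of_int b, of_int a, 0, 0, 0, 0, 0, 1:] = [:- z, 1:] * (\<Prod>w\<in>Z - {z}. [:- w, 1:])"
      using Fc_prod finite_Z z by (simp add: Fc_def prod.remove[of Z z])
    finally show ?thesis by (metis mult_cancel_left pCons_eq_0_iff one_neq_zero)
  qed
  have "pderiv Fc = (\<Sum>z\<in>Z. s z)"
    unfolding Fc_prod pderiv_prod using s by (intro sum.cong) (auto simp: pderiv_pCons)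
  then have c: "coeff (pderiv Fc) i = (\<Sum>z\<in>Z. coeff (s z) i)" for i by (simp add: coeff_sum)
  have "coeff (pderiv Fc) 0 = of_int a" by (simp add: Fc_def pderiv_pCons)
  moreover have "(\<Sum>z\<in>Z. coeff (s z) 0) = (\<Sum>z\<in>Z. z ^ 6) + 7 * of_int a"
    by (simp add: s_def sum.distrib card_Z)
  ultimately have "(\<Sum>z\<in>Z. z ^ 6) = of_int a - 7 * of_int a" using c[of 0]
    by (metis add_diff_cancel_right')
  then show "(\<Sum>z\<in>Z. z ^ 6) = - 6 * of_int a" by simp
  assume "k \<in> {1..5}"
  then have k: "k = 1 \<or> k = 2 \<or> k = 3 \<or> k = 4 \<or> k = 5" by auto
  have "coeff (pderiv Fc) (6 - k) = 0" using k
    by (auto simp: Fc_def pderiv_pCons coeff_pCons numeral_eq_Suc)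
  moreover have "coeff (s z) (6 - k) = z ^ k" for z using k
    by (auto simp: s_def coeff_pCons numeral_eq_Suc)
  ultimately show "(\<Sum>z\<in>Z. z ^ k) = 0" using c[of "6 - k"] by simp
qed

lemma conjugate_algebraic_int:
  assumes "algebraic_int (rat_eval h \<theta>)" "z \<in> Z"
  shows "algebraic_int (rat_eval h z)"
proof -
  obtain P :: "int poly" where P: "int_eval P (rat_eval h \<theta>) = 0" "lead_coeff P = 1"
    using assms(1) unfolding algebraic_int_altdef_ipoly by auto
  have "rat_eval (pcompose (map_poly of_int P) h) \<theta> = 0" by (simp add: rat_eval_pcompose rat_eval_of_int_poly P)
  then obtain g where "pcompose (map_poly of_int P) h = F * g" by (auto simp: F_dvd_iff elim: dvdE)
  then have "rat_eval (pcompose (map_poly of_int P) h) z = 0" using assms(2) by (simp add: Z_def)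
  then have "int_eval P (rat_eval h z) = 0" by (simp add: rat_eval_pcompose rat_eval_of_int_poly)
  then show ?thesis using P(2) unfolding algebraic_int_altdef_ipoly by blast
qed

text \<open>The expression is the trace, the sum over all conjugates: only the power sums of
  exponents 0 and 6 contribute. It is a rational algebraic integer, hence an integer.\<close>

lemma trace_integral:
  assumes "algebraic_int (\<Sum>k<7. of_rat (c k) * \<theta> ^ k)"
  shows "7 * c 0 - 6 * of_int a * c 6 \<in> \<int>"
proof -
  define h where "h = (\<Sum>k<7. Polynomial.monom (c k) k)"
  have h: "rat_eval h z = (\<Sum>k<7. of_rat (c k) * z ^ k)" for z :: complex
    by (simp add: h_def rat_eval_sum rat_eval_monom del: of_rat_hom.map_poly_hom_monom)
  have "algebraic_int (rat_eval h \<theta>)" unfolding h by (rule assms)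
  from conjugate_algebraic_int[OF this] have "algebraic_int (\<Sum>z\<in>Z. rat_eval h z)"
    by (rule algebraic_int_sum)
  also have "(\<Sum>z\<in>Z. rat_eval h z) = (\<Sum>k<7. of_rat (c k) * (\<Sum>z\<in>Z. z ^ k))"
    unfolding h sum_distrib_left by (rule sum.swap)
  also have "\<dots> = 7 * of_rat (c 0) - 6 * of_int a * of_rat (c 6)"
    using power_sums(1) power_sums(2)[of 1] power_sums(2)[of 2] power_sums(2)[of 3]
      power_sums(2)[of 4] power_sums(2)[of 5]
    unfolding sum7 by (simp add: card_Z)
  also have "\<dots> = of_rat (7 * c 0 - 6 * of_int a * c 6)"
    by (simp add: of_rat_diff of_rat_mult)
  finally have "of_rat (7 * c 0 - 6 * of_int a * c 6) \<in> (\<int> :: complex set)"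
    by (rule rational_algebraic_int_is_int) simp
  then obtain m where "of_rat (7 * c 0 - 6 * of_int a * c 6) = (of_int m :: complex)" by (auto elim: Ints_cases)
  then have "of_rat (7 * c 0 - 6 * of_int a * c 6) = (of_rat (of_int m) :: complex)" by simp
  then have "7 * c 0 - 6 * of_int a * c 6 = of_int m" by (simp only: of_rat_eq_iff)
  then show ?thesis by simp
qed

section \<open>The ring of integers and its bounded denominators\<close>

definition O\<^sub>K :: "complex set" where "O\<^sub>K = {x \<in> K. algebraic_int x}"

lemma root_algebraic_int: "algebraic_int \<theta>"
proof -
  have "int_eval [:b, a, 0, 0, 0, 0, 0, 1:] \<theta> = \<theta> ^ 7 + of_int a * \<theta> + of_int b"
    by (simp add: of_int_hom.map_poly_pCons_hom algebra_simps power_numeral_reduce)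
  also have "\<dots> = 0" unfolding root by simp
  finally show ?thesis
    unfolding algebraic_int_altdef_ipoly by (intro exI[of _ "[:b, a, 0, 0, 0, 0, 0, 1:]"]) simp
qed

lemma OK_add: "x \<in> O\<^sub>K \<Longrightarrow> y \<in> O\<^sub>K \<Longrightarrow> x + y \<in> O\<^sub>K"
  and OK_diff: "x \<in> O\<^sub>K \<Longrightarrow> y \<in> O\<^sub>K \<Longrightarrow> x - y \<in> O\<^sub>K"
  and OK_mult: "x \<in> O\<^sub>K \<Longrightarrow> y \<in> O\<^sub>K \<Longrightarrow> x * y \<in> O\<^sub>K"
  and OK_of_int [simp]: "of_int m \<in> O\<^sub>K"
  and OK_root [simp]: "\<theta> \<in> O\<^sub>K"
  by (auto simp: O\<^sub>K_def intro: K_add K_diff K_mult algebraic_int_add algebraic_int_diff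
      algebraic_int_mult root_algebraic_int)

lemma OK_1 [simp]: "1 \<in> O\<^sub>K" and OK_0 [simp]: "0 \<in> O\<^sub>K"
  using OK_of_int[of 1] OK_of_int[of 0] by simp_all

lemma OK_power: "x \<in> O\<^sub>K \<Longrightarrow> x ^ k \<in> O\<^sub>K"
  by (induction k) (auto intro: OK_mult)

lemma OK_int_eval: "x \<in> O\<^sub>K \<Longrightarrow> int_eval g x \<in> O\<^sub>K"
  by (induction g) (auto intro!: OK_add OK_mult)

lemma OK_K: "x \<in> O\<^sub>K \<Longrightarrow> x \<in> K"
  by (simp add: O\<^sub>K_def)

lemma trace_OK:
  assumes "(\<Sum>k<7. of_rat (c k) * \<theta> ^ k) \<in> O\<^sub>K"
  shows "7 * c 0 - 6 * of_int a * c 6 \<in> \<int>"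
  using trace_integral assms by (simp add: O\<^sub>K_def)

text \<open>Multiplication by \<theta> on coordinates in the power basis, with \<theta>^7 reduced by
  the trinomial.\<close>

definition shift :: "(nat \<Rightarrow> rat) \<Rightarrow> nat \<Rightarrow> rat" where
  "shift c k = (if k = 0 then - of_int b * c 6 else if k = 1 then c 0 - of_int a * c 6 else c (k - 1))"

lemma shift_mult: "\<theta> * (\<Sum>k<7. of_rat (c k) * \<theta> ^ k) = (\<Sum>k<7. of_rat (shift c k) * \<theta> ^ k)"
proof -
  have "\<theta> * (\<Sum>k<7. of_rat (c k) * \<theta> ^ k) = of_rat (c 0) * \<theta> + of_rat (c 1) * \<theta> ^ 2 + of_rat (c 2) * \<theta> ^ 3
    + of_rat (c 3) * \<theta> ^ 4 + of_rat (c 4) * \<theta> ^ 5 + of_rat (c 5) * \<theta> ^ 6 + of_rat (c 6) * \<theta> ^ 7"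
    unfolding sum7 by (simp add: algebra_simps power_numeral_reduce)
  then show ?thesis
    unfolding root sum7 by (simp add: shift_def of_rat_diff of_rat_mult of_rat_minus algebra_simps)
qed

text \<open>A common denominator for the coordinates of algebraic integers: the discriminant up to
  sign, times the factors picked up by back substitution in the trace system.\<close>

definition \<Delta> :: int where "\<Delta> = 7 * (7 * b) ^ 5 * (7 ^ 7 * b ^ 6 + 6 ^ 6 * a ^ 7)"

lemma \<Delta>_nz: "\<Delta> \<noteq> 0"
  using disc b0 by (simp add: \<Delta>_def)

text \<open>
  The traces of \<open>x \<theta>\<^sup>j\<close> for \<open>j \<le> 6\<close> form a linear system for the coordinates of \<open>x\<close>, solved here by hand.
\<close>

lemma bounded_coordinates:
  assumes x: "(\<Sum>k<7. of_rat (c k) * \<theta> ^ k) \<in> O\<^sub>K" and k: "k < 7"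
  shows "of_int \<Delta> * c k \<in> \<int>"
proof -
  have sh: "(\<Sum>k<7. of_rat ((shift ^^ j) c k) * \<theta> ^ k) \<in> O\<^sub>K" for j
  proof (induction j)
    case (Suc j)
    have "\<theta> * (\<Sum>k<7. of_rat ((shift ^^ j) c k) * \<theta> ^ k) \<in> O\<^sub>K" using Suc by (intro OK_mult) simp_all
    then show ?case by (simp add: shift_mult)
  qed (use x in simp)
  define A B where "A = (of_int a :: rat)" and "B = (of_int b :: rat)"
  have AB: "A \<in> \<int>" "B \<in> \<int>" by (auto simp: A_def B_def)
  define T where "T j = 7 * (shift ^^ j) c 0 - 6 * A * (shift ^^ j) c 6" for j
  have T: "T j \<in> \<int>" for j unfolding T_def A_def using trace_OK[OF sh] .
  have T0: "T 0 = 7 * c 0 - 6 * A * c 6" by (simp add: T_def)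
  have T1: "T 1 = - 7 * B * c 6 - 6 * A * c 5" by (simp add: T_def shift_def B_def)
  have T2: "T 2 = - 7 * B * c 5 - 6 * A * c 4" by (simp add: T_def shift_def B_def numeral_2_eq_2)
  have T3: "T 3 = - 7 * B * c 4 - 6 * A * c 3" by (simp add: T_def shift_def B_def numeral_3_eq_3)
  have T4: "T 4 = - 7 * B * c 3 - 6 * A * c 2" by (simp add: T_def shift_def B_def eval_nat_numeral)
  have T5: "T 5 = - 7 * B * c 2 - 6 * A * c 1" by (simp add: T_def shift_def B_def eval_nat_numeral)
  have T6: "T 6 = - 7 * B * c 1 - 6 * A * c 0 + 6 * A ^ 2 * c 6"
    by (simp add: T_def shift_def B_def A_def eval_nat_numeral algebra_simps)
  define D where "D = 7 ^ 7 * B ^ 6 + 6 ^ 6 * A ^ 7"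
  \<comment> \<open>Each of \<open>T 1\<close> to \<open>T 5\<close> involves two neighbouring
    coordinates, and the weighted sum in the last bracket telescopes to \<open>c 6\<close> and
    \<open>c 1\<close>. Since \<open>7 * T 6 + 6 * A * T 0\<close> also involves only these two,
    \<open>c 6\<close> can be eliminated.\<close>
  have "D * c 1 = - ((7 * B) ^ 5 * (7 * T 6 + 6 * A * T 0)) - 6 * A ^ 2 * ((7 * B) ^ 4 * T 1
     + (7 * B) ^ 3 * (- 6 * A) * T 2 + (7 * B) ^ 2 * (- 6 * A) ^ 2 * T 3
     + (7 * B) * (- 6 * A) ^ 3 * T 4 + (- 6 * A) ^ 4 * T 5)"
    unfolding T0 T1 T2 T3 T4 T5 T6 D_def by (simp add: algebra_simps eval_nat_numeral)
  also have "\<dots> \<in> \<int>" using AB T by (intro Ints_diff Ints_minus Ints_mult Ints_add Ints_power Ints_numeral) auto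
  finally have c1: "D * c 1 \<in> \<int>" .
  have DZ: "D \<in> \<int>" using AB by (auto simp: D_def)
  \<comment> \<open>Back substitution through \<open>T 5\<close>, ..., \<open>T 1\<close>: each step
    costs one more factor \<open>7 * B\<close>, and the final one through \<open>T 0\<close> a
    factor 7.\<close>
  have "7 * B * D * c 2 = - (D * T 5) - 6 * A * (D * c 1)" unfolding T5 by (simp add: algebra_simps)
  also have "\<dots> \<in> \<int>" by (intro Ints_diff[OF Ints_minus Ints_mult[OF _ c1]] Ints_minus Ints_mult Ints_power AB T DZ Ints_numeral)
  finally have c2: "7 * B * D * c 2 \<in> \<int>" .
  have "(7 * B) ^ 2 * D * c 3 = - ((7 * B) * D * T 4) - 6 * A * (7 * B * D * c 2)" unfolding T4 by (simp add: algebra_simps eval_nat_numeral)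
  also have "\<dots> \<in> \<int>" by (intro Ints_diff[OF Ints_minus Ints_mult[OF _ c2]] Ints_minus Ints_mult Ints_power AB T DZ Ints_numeral)
  finally have c3: "(7 * B) ^ 2 * D * c 3 \<in> \<int>" .
  have "(7 * B) ^ 3 * D * c 4 = - ((7 * B) ^ 2 * D * T 3) - 6 * A * ((7 * B) ^ 2 * D * c 3)" unfolding T3 by (simp add: algebra_simps eval_nat_numeral)
  also have "\<dots> \<in> \<int>" by (intro Ints_diff[OF Ints_minus Ints_mult[OF _ c3]] Ints_minus Ints_mult Ints_power AB T DZ Ints_numeral)
  finally have c4: "(7 * B) ^ 3 * D * c 4 \<in> \<int>" .
  have "(7 * B) ^ 4 * D * c 5 = - ((7 * B) ^ 3 * D * T 2) - 6 * A * ((7 * B) ^ 3 * D * c 4)" unfolding T2 by (simp add: algebra_simps eval_nat_numeral)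
  also have "\<dots> \<in> \<int>" by (intro Ints_diff[OF Ints_minus Ints_mult[OF _ c4]] Ints_minus Ints_mult Ints_power AB T DZ Ints_numeral)
  finally have c5: "(7 * B) ^ 4 * D * c 5 \<in> \<int>" .
  have "(7 * B) ^ 5 * D * c 6 = - ((7 * B) ^ 4 * D * T 1) - 6 * A * ((7 * B) ^ 4 * D * c 5)" unfolding T1 by (simp add: algebra_simps eval_nat_numeral)
  also have "\<dots> \<in> \<int>" by (intro Ints_diff[OF Ints_minus Ints_mult[OF _ c5]] Ints_minus Ints_mult Ints_power AB T DZ Ints_numeral)
  finally have c6: "(7 * B) ^ 5 * D * c 6 \<in> \<int>" .
  have "7 * (7 * B) ^ 5 * D * c 0 = (7 * B) ^ 5 * D * T 0 + 6 * A * ((7 * B) ^ 5 * D * c 6)" unfolding T0 by (simp add: algebra_simps eval_nat_numeral)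
  also have "\<dots> \<in> \<int>" by (intro Ints_add[OF Ints_mult Ints_mult[OF _ c6]] Ints_mult Ints_power AB T DZ Ints_numeral)
  finally have c0: "7 * (7 * B) ^ 5 * D * c 0 \<in> \<int>" .
  have \<Delta>: "of_int \<Delta> = 7 * (7 * B) ^ 5 * D" by (simp add: \<Delta>_def A_def B_def D_def)
  have "7 * (7 * B) ^ 5 * (D * c 1) \<in> \<int>" "7 * (7 * B) ^ 4 * (7 * B * D * c 2) \<in> \<int>"
    "7 * (7 * B) ^ 3 * ((7 * B) ^ 2 * D * c 3) \<in> \<int>" "7 * (7 * B) ^ 2 * ((7 * B) ^ 3 * D * c 4) \<in> \<int>"
    "7 * (7 * B) * ((7 * B) ^ 4 * D * c 5) \<in> \<int>" "7 * ((7 * B) ^ 5 * D * c 6) \<in> \<int>"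
    by (intro Ints_mult[OF _ c1] Ints_mult[OF _ c2] Ints_mult[OF _ c3] Ints_mult[OF _ c4]
        Ints_mult[OF _ c5] Ints_mult[OF _ c6] Ints_mult Ints_power AB Ints_numeral)+
  moreover have "k = 0 \<or> k = 1 \<or> k = 2 \<or> k = 3 \<or> k = 4 \<or> k = 5 \<or> k = 6" using k by auto
  ultimately show ?thesis unfolding \<Delta> using c0
    by (elim disjE) (simp_all add: power_numeral_reduce mult_ac)
qed

lemma bounded_denominator:
  assumes "x \<in> O\<^sub>K"
  shows "\<exists>m :: nat \<Rightarrow> int. of_int \<Delta> * x = (\<Sum>k<7. of_int (m k) * \<theta> ^ k)"
proof -
  obtain c where c: "x = (\<Sum>k<7. of_rat (c k) * \<theta> ^ k)" using K_basis OK_K assms by blast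
  have "\<forall>k. \<exists>m. k < 7 \<longrightarrow> of_int \<Delta> * c k = of_int m"
    using bounded_coordinates[of c] assms c by (metis Ints_cases)
  then obtain m where m: "\<And>k. k < 7 \<Longrightarrow> of_int \<Delta> * c k = of_int (m k)" by metis
  have "of_int \<Delta> * x = (\<Sum>k<7. of_rat (of_int \<Delta> * c k) * \<theta> ^ k)"
    unfolding c by (simp add: sum_distrib_left of_rat_mult mult.assoc)
  also have "\<dots> = (\<Sum>k<7. of_int (m k) * \<theta> ^ k)" by (intro sum.cong) (auto simp: m)
  finally show ?thesis by blast
qed

text \<open>After multiplication by \<Delta> the coordinates are integers. Elements with equal
  coordinates modulo |\<Delta>| N differ by N times an element with integer coordinates, and there
  are finitely many residue vectors.\<close>

lemma finite_quotient:
  assumes "N > (0 :: int)"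
  shows "\<exists>T. finite T \<and> T \<subseteq> O\<^sub>K \<and> (\<forall>x\<in>O\<^sub>K. \<exists>t\<in>T. \<exists>y\<in>O\<^sub>K. x - t = of_int N * y)"
proof -
  have "\<forall>x. \<exists>m :: nat \<Rightarrow> int. x \<in> O\<^sub>K \<longrightarrow> of_int \<Delta> * x = (\<Sum>k<7. of_int (m k) * \<theta> ^ k)"
    using bounded_denominator by blast
  from choice[OF this] obtain m :: "complex \<Rightarrow> nat \<Rightarrow> int" where
    m': "\<forall>x. x \<in> O\<^sub>K \<longrightarrow> of_int \<Delta> * x = (\<Sum>k<7. of_int (m x k) * \<theta> ^ k)" by (elim exE)
  have m: "\<And>x. x \<in> O\<^sub>K \<Longrightarrow> of_int \<Delta> * x = (\<Sum>k<7. of_int (m x k) * \<theta> ^ k)" using m' by blast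
  define M where "M = \<bar>\<Delta>\<bar> * N"
  have M: "M > 0" using assms \<Delta>_nz by (simp add: M_def)
  define \<phi> where "\<phi> x = (\<lambda>k\<in>{..<7::nat}. m x k mod M)" for x
  have "\<phi> ` O\<^sub>K \<subseteq> ({..<7} \<rightarrow>\<^sub>E {0..<M})" using M by (auto simp: \<phi>_def split: if_splits)
  then have fin: "finite (\<phi> ` O\<^sub>K)" by (rule finite_subset) (intro finite_PiE; simp)
  define s where "s v = (SOME x. x \<in> O\<^sub>K \<and> \<phi> x = v)" for v
  have s: "s (\<phi> x) \<in> O\<^sub>K" "\<phi> (s (\<phi> x)) = \<phi> x" if "x \<in> O\<^sub>K" for x
    using someI[of "\<lambda>y. y \<in> O\<^sub>K \<and> \<phi> y = \<phi> x" x] that by (auto simp: s_def)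
  have "\<exists>y\<in>O\<^sub>K. x - t = of_int N * y" if x: "x \<in> O\<^sub>K" "t \<in> O\<^sub>K" "\<phi> x = \<phi> t" for x t
  proof -
    have "M dvd m x k - m t k" if "k < 7" for k
      using fun_cong[OF x(3), of k] that by (simp add: \<phi>_def mod_eq_dvd_iff)
    then have "\<forall>k. \<exists>l. k < 7 \<longrightarrow> m x k - m t k = M * l" by (meson dvdE)
    then obtain l where l: "\<And>k. k < 7 \<Longrightarrow> m x k - m t k = M * l k" by metis
    define y where "y = of_int (sgn \<Delta>) * (\<Sum>k<7. of_int (l k) * \<theta> ^ k)"
    have y: "y \<in> O\<^sub>K" unfolding y_def sum7 by (intro OK_mult OK_add OK_power OK_of_int OK_root)
    have "of_int \<Delta> * (x - t) = (\<Sum>k<7. of_int (m x k - m t k) * \<theta> ^ k)"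
      using m x by (simp add: algebra_simps sum_subtractf)
    also have "\<dots> = (\<Sum>k<7. of_int M * (of_int (l k) * \<theta> ^ k))"
      by (intro sum.cong) (auto simp: l)
    also have "\<dots> = of_int (\<Delta> * N) * y"
      by (simp add: sum_distrib_left[symmetric] y_def M_def abs_sgn)
    finally have "of_int \<Delta> * (x - t) = of_int \<Delta> * (of_int N * y)" by (simp add: mult.assoc)
    then show ?thesis using \<Delta>_nz y by auto
  qed
  then show ?thesis using fin s by (intro exI[of _ "s ` \<phi> ` O\<^sub>K"]) (auto, metis)
qed

end

section \<open>Indices\<close>

text \<open>A surjective map of a finite set to itself is injective, so no g other than \<one> has
  g^p = \<one>; a subgroup of order \<open>p\<close> from Sylow's theorem would contain one.\<close>

lemma (in group) not_dvd_order_if_power_surj: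
  assumes fin: "finite (carrier G)" and p: "prime (p :: nat)"
    and surj: "\<And>x. x \<in> carrier G \<Longrightarrow> \<exists>y\<in>carrier G. x = y [^] p"
  shows "\<not> p dvd order G"
proof
  assume "p dvd order G"
  then obtain m where "order G = p ^ 1 * m" by (auto elim: dvdE)
  then obtain P where P: "subgroup P G" "card P = p"
    using sylow_thm[OF p is_group, of 1 m] fin by auto
  have inj: "inj_on (\<lambda>y. y [^] p) (carrier G)"
  proof (rule eq_card_imp_inj_on[OF fin])
    have "(\<lambda>y. y [^] p) ` carrier G = carrier G" using surj by auto
    then show "card ((\<lambda>y. y [^] p) ` carrier G) = card (carrier G)" by simp
  qed
  have "card P > 1" using P p prime_gt_1_nat by simp
  have "\<exists>g\<in>P. g \<noteq> \<one>"
  proof (rule ccontr)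
    assume "\<not> ?thesis"
    then have "P \<subseteq> {\<one>}" by auto
    then have "card P \<le> card {\<one>}" by (intro card_mono) auto
    then show False using \<open>card P > 1\<close> by simp
  qed
  then obtain g where g: "g \<in> P" "g \<noteq> \<one>" by blast
  interpret P: group "G\<lparr>carrier := P\<rparr>" using P(1) by (rule subgroup_imp_group)
  have "g [^]\<^bsub>G\<lparr>carrier := P\<rparr>\<^esub> order (G\<lparr>carrier := P\<rparr>) = \<one>"
    using P.pow_order_eq_1[of g] g by simp
  then have "g [^] p = \<one>" using P(2) by (simp add: Coset.order_def nat_pow_consistent[symmetric])
  moreover have "\<one> [^] p = \<one>" by simp
  ultimately show False using inj_onD[OF inj, of g \<one>] g subgroup.mem_carrier[OF P(1)] by auto
qed

context trinomial
begin

lemma carrier_ring_of_integers: "carrier (ring_of_integers K) = O\<^sub>K"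
  by (simp add: ring_of_integers_def O\<^sub>K_def)

text \<open>By \<open>generates\<close>, multiplication by \<open>p\<close> is onto the quotient of
  \<open>O\<^sub>K\<close> by \<open>int_adjoin \<beta>\<close>. The bound \<open>bd\<close> makes
  this quotient finite, which matters because the cardinality of an infinite one would be 0, a
  multiple of \<open>p\<close>.\<close>

lemma index_not_dvd:
  assumes p: "prime (p :: nat)" and \<beta>: "\<beta> \<in> O\<^sub>K" and N: "N > (0 :: int)"
    and bd: "\<And>x. x \<in> O\<^sub>K \<Longrightarrow> of_int N * x \<in> int_adjoin \<beta>"
    and generates: "\<And>x. x \<in> O\<^sub>K \<Longrightarrow> \<exists>g. \<exists>y\<in>O\<^sub>K. x = int_eval g \<beta> + of_nat p * y"
  shows "\<not> p dvd ind K \<beta>"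
proof -
  define S where "S = ring_of_integers K"
  define H where "H = int_adjoin \<beta>"
  have S [simp]: "carrier S = O\<^sub>K" "x \<otimes>\<^bsub>S\<^esub> y = x * y" "x \<oplus>\<^bsub>S\<^esub> y = x + y" "\<one>\<^bsub>S\<^esub> = 1" "\<zero>\<^bsub>S\<^esub> = 0" for x y
    using carrier_ring_of_integers by (auto simp: S_def ring_of_integers_def ring_of_type_algebra_def)
  have HE: "H = range (\<lambda>g. int_eval g \<beta>)" by (simp add: H_def int_adjoin_eq)
  have neg: "- x \<in> O\<^sub>K" if "x \<in> O\<^sub>K" for x using OK_diff[of 0 x] that by simp
  interpret S: abelian_group S
    by (rule abelian_groupI) (auto intro: OK_add neg bexI[of _ "- _"] simp: add_ac)
  have cgrp: "comm_group (add_monoid S)" by (rule S.a_comm_group)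
  then have grp: "group (add_monoid S)" by (simp add: comm_group_def)
  have invS: "inv\<^bsub>add_monoid S\<^esub> x = - x" if "x \<in> O\<^sub>K" for x
    by (rule group.inv_equality[OF grp]) (use that in \<open>auto intro: neg\<close>)
  have H: "subgroup H (add_monoid S)"
  proof (rule group.subgroupI[OF grp])
    show "H \<subseteq> carrier (add_monoid S)" using OK_int_eval[OF \<beta>] by (auto simp: HE)
    show "H \<noteq> {}" by (auto simp: HE)
    fix x assume x: "x \<in> H"
    then obtain g where g: "x = int_eval g \<beta>" by (auto simp: HE)
    have "- x = int_eval (0 - g) \<beta>" unfolding int_eval_simps g by simp
    then have "- x \<in> H" unfolding HE by (rule range_eqI)
    then show "inv\<^bsub>add_monoid S\<^esub> x \<in> H" using invS[of x] OK_int_eval[OF \<beta>] g by simp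
    fix y assume "y \<in> H"
    then obtain h where "y = int_eval h \<beta>" by (auto simp: HE)
    then have "x + y = int_eval (g + h) \<beta>" using g by simp
    then have "x + y \<in> H" unfolding HE by (rule range_eqI)
    then show "x \<otimes>\<^bsub>add_monoid S\<^esub> y \<in> H" by simp
  qed
  interpret N: normal H "add_monoid S" by (rule comm_group.normal_iff_subgroup[OF cgrp, THEN iffD2, OF H])
  interpret Q: group "add_monoid S Mod H" by (rule N.factorgroup_is_group)
  interpret h: group_hom "add_monoid S" "add_monoid S Mod H" "\<lambda>x. H #>\<^bsub>add_monoid S\<^esub> x"
    using N.r_coset_hom_Mod by unfold_locales
  have carr: "carrier (add_monoid S Mod H) = (\<lambda>x. H #>\<^bsub>add_monoid S\<^esub> x) ` O\<^sub>K"
    by (auto simp: FactGroup_def RCOSETS_def)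
  have cong: "H #>\<^bsub>add_monoid S\<^esub> x = H #>\<^bsub>add_monoid S\<^esub> y" if "x \<in> O\<^sub>K" "y \<in> O\<^sub>K" "x - y \<in> H" for x y
  proof -
    have "x \<otimes>\<^bsub>add_monoid S\<^esub> inv\<^bsub>add_monoid S\<^esub> y \<in> H"
      unfolding invS[OF that(2)] using that by simp
    then have "x \<in> H #>\<^bsub>add_monoid S\<^esub> y"
      by (rule N.rcos_module_rev[OF grp, rotated 2]) (use that in auto)
    then show ?thesis using group.repr_independence[OF grp, of x H y] that H by simp
  qed
  obtain T where T: "finite T" "T \<subseteq> O\<^sub>K" "\<And>x. x \<in> O\<^sub>K \<Longrightarrow> \<exists>t\<in>T. \<exists>y\<in>O\<^sub>K. x - t = of_int N * y"
    using finite_quotient[OF N] by metis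
  have "carrier (add_monoid S Mod H) \<subseteq> (\<lambda>x. H #>\<^bsub>add_monoid S\<^esub> x) ` T"
  proof
    fix C assume "C \<in> carrier (add_monoid S Mod H)"
    then obtain x where x: "x \<in> O\<^sub>K" "C = H #>\<^bsub>add_monoid S\<^esub> x" using carr by auto
    obtain t y where t: "t \<in> T" "y \<in> O\<^sub>K" "x - t = of_int N * y" using T(3)[OF x(1)] by auto
    then have "x - t \<in> H" using bd by (simp add: H_def)
    then show "C \<in> (\<lambda>x. H #>\<^bsub>add_monoid S\<^esub> x) ` T" using cong[of x t] x t T(2) by auto
  qed
  then have fin: "finite (carrier (add_monoid S Mod H))" by (rule finite_subset) (use T(1) in simp)
  have pow: "y [^]\<^bsub>add_monoid S\<^esub> (k::nat) = of_nat k * y" for y k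
    by (induction k) (auto simp: algebra_simps)
  have "\<not> p dvd order (add_monoid S Mod H)"
  proof (rule Q.not_dvd_order_if_power_surj[OF fin p])
    fix C assume "C \<in> carrier (add_monoid S Mod H)"
    then obtain x where x: "x \<in> O\<^sub>K" "C = H #>\<^bsub>add_monoid S\<^esub> x" using carr by auto
    obtain g y where gy: "y \<in> O\<^sub>K" "x = int_eval g \<beta> + of_nat p * y" using generates[OF x(1)] by blast
    have "of_nat p * y \<in> O\<^sub>K" using OK_mult[OF OK_of_int[of "int p"] gy(1)] by simp
    then have "C = H #>\<^bsub>add_monoid S\<^esub> (of_nat p * y)"
      unfolding x(2) using cong[of x "of_nat p * y"] x gy by (simp add: HE)
    also have "\<dots> = H #>\<^bsub>add_monoid S\<^esub> (y [^]\<^bsub>add_monoid S\<^esub> p)" unfolding pow ..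
    also have "\<dots> = (H #>\<^bsub>add_monoid S\<^esub> y) [^]\<^bsub>add_monoid S Mod H\<^esub> p"
      by (rule h.hom_nat_pow) (use gy in simp)
    finally show "\<exists>D\<in>carrier (add_monoid S Mod H). C = D [^]\<^bsub>add_monoid S Mod H\<^esub> p"
      using gy(1) carr by blast
  qed
  then show ?thesis by (simp add: ind_def Coset.order_def FactGroup_def A_RCOSETS_def S_def H_def)
qed

lemma p_order_OK:
  assumes "prime p"
  shows "p_order O\<^sub>K p 7"
proof
  show "prime p" by fact
  show "\<exists>m :: nat \<Rightarrow> int. (\<exists>i\<le>7. \<not> int p dvd m i) \<and> (\<Sum>i\<le>7. of_int (m i) * x i) = 0"
    if "\<And>i. i \<le> 7 \<Longrightarrow> x i \<in> O\<^sub>K" for x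
    using K_relation[OF assms] OK_K that by blast
  show "t \<in> O\<^sub>K" if q: "\<And>i. coeff q i \<in> O\<^sub>K" "lead_coeff q = 1" "poly q t = 0" "of_nat p * t \<in> O\<^sub>K" for q t
  proof -
    have "algebraic_int t" by (rule algebraic_int_integral[OF _ q(2,3)]) (use q(1) in \<open>simp add: O\<^sub>K_def\<close>)
    moreover have "of_nat p * t / of_int (int p) \<in> K" by (rule K_divide[OF OK_K[OF q(4)] K_of_int])
    then have "t \<in> K" using assms prime_gt_0_nat by (simp add: field_simps)
    ultimately show ?thesis by (simp add: O\<^sub>K_def)
  qed
  show "\<exists>T. finite T \<and> T \<subseteq> O\<^sub>K \<and> (\<forall>x\<in>O\<^sub>K. \<exists>t\<in>T. \<exists>y\<in>O\<^sub>K. x - t = of_nat p * y)"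
    using finite_quotient[of "int p"] prime_gt_0_nat[OF assms] by simp
  show "1 / of_nat p \<notin> O\<^sub>K"
  proof
    assume "1 / of_nat p \<in> O\<^sub>K"
    then have "algebraic_int (1 / of_nat p :: complex)" by (simp add: O\<^sub>K_def)
    moreover have "(1 / of_nat p :: complex) \<in> \<rat>" by simp
    ultimately have "(1 / of_nat p :: complex) \<in> \<int>" by (rule rational_algebraic_int_is_int)
    then obtain m where m: "(1 / of_nat p :: complex) = of_int m" by (auto elim: Ints_cases)
    have "p > 0" using assms prime_gt_0_nat by blast
    then have "(1 :: complex) = of_int (m * int p)" using m by (simp add: field_simps)
    then have "m * int p = 1" by (metis of_int_1 of_int_eq_iff)
    then have "int p dvd 1" by (metis dvd_triv_right)
    then show False using assms by simp
  qed
qed (auto intro: OK_diff OK_mult)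

text \<open>The primitive element argument: \<open>m\<close> is chosen so that the shifted element
  has seven distinct conjugates. It then satisfies no nonzero rational relation of degree below 7,
  so a relation between its first seven powers and \<theta> must involve \<theta>.\<close>

lemma generator_shift:
  assumes \<alpha>: "\<alpha> \<in> K" and q: "q \<noteq> (0 :: int)"
  shows "\<exists>m :: int. \<exists>g n. n \<noteq> 0 \<and> of_int n * \<theta> = int_eval g (\<alpha> + of_int (q * m) * \<theta>)"
proof -
  obtain h where h: "\<alpha> = rat_eval h \<theta>" using \<alpha> by (auto simp: K_def)
  \<comment> \<open>The values of \<open>m\<close> at which two conjugates collide. Pairs with z = w
    contribute 0, the value of division by zero, which merely excludes m = 0 as well.\<close>
  define B where "B = (\<lambda>(z, w). (rat_eval h z - rat_eval h w) / (of_int q * (w - z))) ` (Z \<times> Z)"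
  have "finite B" using finite_Z by (auto simp: B_def)
  then have "finite ((of_int :: int \<Rightarrow> complex) -` B)" by (rule finite_vimageI) (auto intro: injI)
  then obtain m :: int where m: "of_int m \<notin> B" using ex_new_if_finite[OF infinite_UNIV_int] by auto
  define \<beta> where "\<beta> = \<alpha> + of_int (q * m) * \<theta>"
  define k where "k = h + Polynomial.smult (of_int (q * m)) [:0, 1:]"
  have k: "rat_eval k z = rat_eval h z + of_int (q * m) * z" for z :: complex by (simp add: k_def of_rat_mult)
  have \<beta>: "\<beta> = rat_eval k \<theta>" by (simp add: k \<beta>_def h)
  have inj: "inj_on (\<lambda>z. rat_eval k z) Z"
  proof (rule inj_onI, rule ccontr)
    fix z w assume zw: "z \<in> Z" "w \<in> Z" "rat_eval k z = rat_eval k w" "z \<noteq> w"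
    then have "rat_eval h z - rat_eval h w = of_int m * (of_int q * (w - z))" by (simp add: k algebra_simps)
    then have "of_int m = (rat_eval h z - rat_eval h w) / (of_int q * (w - z))" using zw q by (simp add: field_simps)
    then show False using m zw by (auto simp: B_def)
  qed
  have deg: "g = 0" if g: "degree g < 7" "rat_eval g \<beta> = 0" for g
  proof (rule ccontr)
    assume "g \<noteq> 0"
    define gc :: "complex poly" where "gc = map_poly of_rat g"
    have gc: "gc \<noteq> 0" "degree gc = degree g" using \<open>g \<noteq> 0\<close> by (simp_all add: gc_def)
    have "rat_eval (pcompose g k) \<theta> = 0" using g(2) \<beta> by (simp add: rat_eval_pcompose)
    then obtain u where "pcompose g k = F * u" by (auto simp: F_dvd_iff elim: dvdE)
    then have "rat_eval (pcompose g k) z = 0" if "z \<in> Z" for z using that by (simp add: Z_def)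
    then have "(\<lambda>z. rat_eval k z) ` Z \<subseteq> {x. poly gc x = 0}" by (auto simp: rat_eval_pcompose gc_def)
    then have "card ((\<lambda>z. rat_eval k z) ` Z) \<le> card {x. poly gc x = 0}"
      using poly_roots_finite[OF gc(1)] by (intro card_mono)
    also have "\<dots> \<le> degree gc" by (rule card_poly_roots_bound[OF gc(1)])
    finally show False using card_image[OF inj] card_Z gc(2) g(1) by simp
  qed
  have bK: "\<beta> \<in> K" unfolding \<beta>_def by (intro K_add K_mult \<alpha> K_of_int K_root)
  have xK: "(if i < 7 then \<beta> ^ i else \<theta>) \<in> K" for i :: nat using bK by (auto intro: K_power)
  \<comment> \<open>The prime 2 is arbitrary; only a nontrivial integer relation is wanted.\<close>
  have "\<exists>c :: nat \<Rightarrow> int. (\<exists>i\<le>7. \<not> int 2 dvd c i) \<and>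
      (\<Sum>i\<le>7. of_int (c i) * (if i < 7 then \<beta> ^ i else \<theta>)) = 0"
    by (rule K_relation[OF two_is_prime_nat xK])
  then obtain c :: "nat \<Rightarrow> int" where "(\<exists>i\<le>7. \<not> int 2 dvd c i) \<and>
      (\<Sum>i\<le>7. of_int (c i) * (if i < 7 then \<beta> ^ i else \<theta>)) = 0" by (elim exE)
  then have c: "\<exists>i\<le>7. \<not> int 2 dvd c i"
    "(\<Sum>i\<le>7. of_int (c i) * (if i < 7 then \<beta> ^ i else \<theta>)) = 0" by (rule conjunct1, rule conjunct2)
  define g where "g = (\<Sum>i<7. Polynomial.monom (c i) i)"
  have cg: "coeff g i = (if i < 7 then c i else 0)" for i
    by (simp add: g_def coeff_sum coeff_monom)
  have dg: "degree g < 7" by (intro degree_lessI) (auto simp: cg)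
  have "{..7} = insert 7 {..<7::nat}" by auto
  then have "(\<Sum>i\<le>7. of_int (c i) * (if i < 7 then \<beta> ^ i else \<theta>)) = int_eval g \<beta> + of_int (c 7) * \<theta>"
    by (simp add: g_def int_eval_sum poly_monom)
  then have rel: "of_int (c 7) * \<theta> = - int_eval g \<beta>" using c(2) by (simp add: eq_neg_iff_add_eq_0 add.commute)
  have "c 7 \<noteq> 0"
  proof
    assume c7: "c 7 = 0"
    then have "rat_eval (map_poly of_int g) \<beta> = 0" using rel by (simp add: rat_eval_of_int_poly)
    then have "map_poly of_int g = (0 :: rat poly)" using dg by (intro deg) simp_all
    then have "g = 0" by simp
    then have "c i = 0" if "i < 7" for i using cg[of i] that by simp
    then show False using c(1) c7 by (metis dvd_0_right nat_less_le)
  qed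
  moreover have "of_int (c 7) * \<theta> = int_eval (0 - g) \<beta>" unfolding rel int_eval_simps by simp
  ultimately show ?thesis unfolding \<beta>_def by blast
qed

text \<open>Adding a multiple of \<open>p\<close> times \<theta> makes \<alpha> a generator of the
  field without changing it modulo \<open>p\<close>, so generation modulo \<open>p\<close> is
  inherited by \<beta>.\<close>

theorem exists_index_not_dvd:
  assumes p: "prime (p :: nat)" and \<alpha>: "\<alpha> \<in> O\<^sub>K"
    and generates: "\<And>x. x \<in> O\<^sub>K \<Longrightarrow> \<exists>g. x - int_eval g \<alpha> \<in> p_order.pR O\<^sub>K p"
  shows "\<exists>\<beta>\<in>carrier (ring_of_integers K). K = rat_adjoin \<beta> \<and> \<not> p dvd ind K \<beta>"
proof -
  interpret p_order O\<^sub>K p 7 by (rule p_order_OK[OF p])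
  have "int p \<noteq> 0" using p_pos by simp
  then obtain m g n where n: "n \<noteq> 0" "of_int n * \<theta> = int_eval g (\<alpha> + of_int (int p * m) * \<theta>)"
    using generator_shift[OF OK_K[OF \<alpha>]] by blast
  define \<beta> where "\<beta> = \<alpha> + of_int (int p * m) * \<theta>"
  have \<beta>: "\<beta> \<in> O\<^sub>K" unfolding \<beta>_def by (intro OK_add OK_mult \<alpha> OK_of_int OK_root)
  have \<theta>: "of_int n * \<theta> = int_eval g \<beta>" using n(2) by (simp only: \<beta>_def)
  have KQ: "K = rat_adjoin \<beta>"
  proof
    define u where "u = Polynomial.smult (1 / of_int n) (map_poly of_int g :: rat poly)"
    have "rat_eval u \<beta> = \<theta>" using \<theta> n(1)
      by (simp add: u_def rat_eval_of_int_poly of_rat_divide field_simps)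
    then have "rat_eval h \<theta> = rat_eval (pcompose h u) \<beta>" for h by (simp add: rat_eval_pcompose)
    then show "K \<subseteq> rat_adjoin \<beta>" using rat_eval_in_rat_adjoin unfolding K_def by (metis image_subsetI)
    show "rat_adjoin \<beta> \<subseteq> K" by (rule rat_adjoin_subset[OF OK_K[OF \<beta>]])
  qed
  \<comment> \<open>\<Delta> makes the coordinates integral; as \<open>of_int n * \<theta>\<close>
    is a polynomial in \<beta>, \<open>n ^ 6\<close> clears the denominators of \<theta>^k for all k
    \<le> 6.\<close>
  define N where "N = \<bar>\<Delta>\<bar> * n ^ 6 * n ^ 6"
  have N: "N > 0" using \<Delta>_nz n(1) by (simp add: N_def zero_less_mult_iff)
  have bd: "of_int N * x \<in> int_adjoin \<beta>" if x: "x \<in> O\<^sub>K" for x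
  proof -
    obtain c :: "nat \<Rightarrow> int" where c: "of_int \<Delta> * x = (\<Sum>k<7. of_int (c k) * \<theta> ^ k)"
      using bounded_denominator[OF x] by blast
    define h where "h = (\<Sum>k<7. Polynomial.smult (c k * n ^ (6 - k)) (g ^ k))"
    have evp: "int_eval (g ^ k) \<beta> = int_eval g \<beta> ^ k" for k by (induction k) simp_all
    have "of_int (n ^ 6) * (of_int \<Delta> * x) = (\<Sum>k<7. of_int (n ^ 6) * (of_int (c k) * \<theta> ^ k))"
      unfolding c sum_distrib_left ..
    also have "\<dots> = int_eval h \<beta>"
      unfolding h_def int_eval_sum
    proof (rule sum.cong)
      fix k :: nat assume "k \<in> {..<7}"
      then have "n ^ 6 = n ^ (6 - k) * n ^ k" by (simp flip: power_add)
      then have "of_int (n ^ 6) * (of_int (c k) * \<theta> ^ k) = of_int (c k * n ^ (6 - k)) * (of_int n * \<theta>) ^ k"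
        by (simp add: power_mult_distrib)
      then show "of_int (n ^ 6) * (of_int (c k) * \<theta> ^ k) = int_eval (Polynomial.smult (c k * n ^ (6 - k)) (g ^ k)) \<beta>"
        unfolding \<theta> int_eval_simps evp .
    qed simp
    finally have "of_int (n ^ 6 * \<Delta>) * x = int_eval h \<beta>" by (simp add: mult.assoc)
    moreover have "N = sgn \<Delta> * n ^ 6 * (n ^ 6 * \<Delta>)" by (simp add: N_def abs_sgn)
    then have "of_int N * x = of_int (sgn \<Delta> * n ^ 6) * (of_int (n ^ 6 * \<Delta>) * x)"
      by (simp only: of_int_mult mult.assoc)
    ultimately have "of_int N * x = int_eval (Polynomial.smult (sgn \<Delta> * n ^ 6) h) \<beta>"
      by (simp only: int_eval_simps)
    then show ?thesis unfolding int_adjoin_eq by blast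
  qed
  have "\<exists>g. \<exists>y\<in>O\<^sub>K. x = int_eval g \<beta> + of_nat p * y" if x: "x \<in> O\<^sub>K" for x
  proof -
    obtain u where u: "x - int_eval u \<alpha> \<in> pR" using generates[OF x] by blast
    have "\<alpha> - \<beta> = of_nat p * (of_int (- m) * \<theta>)" by (simp add: \<beta>_def)
    moreover have "of_nat p * (of_int (- m) * \<theta>) \<in> pR" by (intro p_ideal_p_mult[OF p_ideal_pR] OK_mult OK_of_int OK_root)
    ultimately have "\<alpha> - \<beta> \<in> pR" by simp
    then have "int_eval u \<alpha> - int_eval u \<beta> \<in> pR" by (rule p_ideal_cong_int_eval[OF p_ideal_pR _ \<alpha> \<beta>])
    then have "x - int_eval u \<beta> \<in> pR" by (rule p_ideal_cong_trans[OF p_ideal_pR u])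
    then obtain y where "y \<in> O\<^sub>K" "x - int_eval u \<beta> = of_nat p * y" unfolding pR_def by blast
    then have "x = int_eval u \<beta> + of_nat p * y" by (simp add: algebra_simps)
    then show ?thesis using \<open>y \<in> O\<^sub>K\<close> by blast
  qed
  from index_not_dvd[OF p \<beta> N bd this] show ?thesis using KQ \<beta> carrier_ring_of_integers by blast
qed

text \<open>The trace of \<open>p\<close> times an algebraic integer is a multiple of
  \<open>p\<close>. Used contrapositively to show that an explicit element is not divisible by
  \<open>p\<close>, hence the spelled-out coefficients.\<close>

lemma trace_mod_p:
  assumes p: "prime (p :: nat)"
    and x: "of_rat r0 + of_rat r1 * \<theta> + of_rat r2 * \<theta> ^ 2 + of_rat r3 * \<theta> ^ 3 + of_rat r4 * \<theta> ^ 4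
      + of_rat r5 * \<theta> ^ 5 + of_rat r6 * \<theta> ^ 6 \<in> p_order.pR O\<^sub>K p" (is "?x \<in> _")
  shows "\<exists>m. 7 * r0 - 6 * of_int a * r6 = of_int (int p * m)"
proof -
  interpret p_order O\<^sub>K p 7 by (rule p_order_OK[OF p])
  obtain y where y: "y \<in> O\<^sub>K" "?x = of_nat p * y" using x unfolding pR_def by blast
  define c where "c k = [r0, r1, r2, r3, r4, r5, r6] ! k / of_nat p" for k
  have p0: "(of_nat p :: rat) \<noteq> 0" "(of_nat p :: complex) \<noteq> 0" using p_pos by auto
  have "(\<Sum>k<7. of_rat (c k) * \<theta> ^ k) = ?x / of_nat p"
    unfolding sum7 by (simp add: c_def of_rat_divide add_divide_distrib)
  also have "\<dots> = y" using y(2) p0 by simp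
  finally have "7 * c 0 - 6 * of_int a * c 6 \<in> \<int>" using trace_OK[of c] y(1) by simp
  then obtain m where "7 * c 0 - 6 * of_int a * c 6 = of_int m" by (auto elim: Ints_cases)
  then have "7 * r0 - 6 * of_int a * r6 = of_int (int p * m)"
    using p0 by (simp add: c_def field_simps)
  then show ?thesis by blast
qed

lemma OK_nth_root: "x \<in> K \<Longrightarrow> x ^ k \<in> O\<^sub>K \<Longrightarrow> k > 0 \<Longrightarrow> x \<in> O\<^sub>K"
proof -
  assume x: "x \<in> K" "x ^ k \<in> O\<^sub>K" "k > 0"
  have "algebraic_int x"
    by (rule algebraic_int_root[of "x ^ k" "Polynomial.monom 1 k"])
       (use x in \<open>auto simp: O\<^sub>K_def poly_monom coeff_monom degree_monom_eq\<close>)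
  then show "x \<in> O\<^sub>K" using x by (simp add: O\<^sub>K_def)
qed

section \<open>The individual primes\<close>

lemma index_large_prime:
  assumes p: "prime (p :: nat)" "p \<ge> 7"
  shows "\<exists>\<beta>\<in>carrier (ring_of_integers K). K = rat_adjoin \<beta> \<and> \<not> p dvd ind K \<beta>"
proof -
  interpret p_order O\<^sub>K p 7 by (rule p_order_OK[OF p(1)])
  have "\<exists>\<alpha>\<in>O\<^sub>K. \<forall>x\<in>O\<^sub>K. \<exists>g. x - int_eval g \<alpha> \<in> pR"
  proof (rule monogenic_mod_p)
    show "7 < 2 * p" using p by simp
    fix F assume "F \<subseteq> max_ideals" "card F = p + 1"
    then show "\<exists>P\<in>F. \<not> degree_one P" using card_max_ideals_le[of F] p by simp
  qed
  then obtain \<alpha> where "\<alpha> \<in> O\<^sub>K" "\<And>x. x \<in> O\<^sub>K \<Longrightarrow> \<exists>g. x - int_eval g \<alpha> \<in> pR" by blast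
  then show ?thesis by (rule exists_index_not_dvd[OF p(1)])
qed

lemma index_three:
  assumes a: "3 dvd a" and b: "3 dvd b" "\<not> 9 dvd b"
  shows "\<exists>\<beta>\<in>carrier (ring_of_integers K). K = rat_adjoin \<beta> \<and> \<not> 3 dvd ind K \<beta>"
proof -
  have p: "prime (3 :: nat)" by simp
  interpret p_order O\<^sub>K 3 7 by (rule p_order_OK[OF p])
  obtain a' b' where ab: "a = 3 * a'" "b = 3 * b'" using a b by (auto elim!: dvdE)
  have b': "\<not> 3 dvd b'" using b ab by auto
  have t7: "\<theta> ^ 7 = of_nat 3 * (of_int (- a') * \<theta> + of_int (- b'))" unfolding root by (simp add: ab)
  have "of_nat 3 * (of_int (- a') * \<theta> + of_int (- b')) \<in> pR"
    by (intro p_ideal_p_mult[OF p_ideal_pR] OK_add OK_mult OK_of_int OK_root)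
  then have t7p: "\<theta> ^ 7 \<in> pR" unfolding t7 .
  have t6: "\<theta> ^ 6 \<notin> pR"
  proof
    assume "\<theta> ^ 6 \<in> pR"
    then obtain x where x: "x \<in> O\<^sub>K" "\<theta> ^ 6 = of_nat 3 * x" unfolding pR_def by blast
    have "of_nat 3 * (x * \<theta>) = \<theta> ^ 6 * \<theta>" using x by simp
    also have "\<dots> = \<theta> ^ 7" by (simp add: power_numeral_reduce)
    finally have "of_nat 3 * (x * \<theta>) = of_nat 3 * (of_int (- a') * \<theta> + of_int (- b'))" unfolding t7 .
    then have "x * \<theta> = of_int (- a') * \<theta> + of_int (- b')" by (subst (asm) mult_left_cancel) simp_all
    \<comment> \<open>\<theta> lies in every prime over 3, so divisibility of \<theta>^6 by 3 would
      put \<open>b'\<close> into such a prime.\<close>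
    then have eq: "of_int (- b') = (x + of_int a') * \<theta>" by (simp add: algebra_simps)
    obtain P where P: "P \<in> max_ideals" using max_ideal_exists[OF p_ideal_pR one_notin_pR] by blast
    have PI: "p_ideal P" "1 \<notin> P" using P max_ideal_p_ideal max_ideal_one by auto
    have "\<theta> \<in> P" using max_ideal_power[OF P OK_root] p_idealD(1)[OF PI(1) t7p] by blast
    then have "of_int (- b') \<in> P" unfolding eq by (intro p_idealD(4)[OF PI(1)] OK_add x OK_of_int)
    then show False using of_int_in_p_ideal[OF PI, of "- b'"] b' by simp
  qed
  have "indep 7 \<theta> pR"
  proof (rule indepI, rule ccontr)
    fix c :: "nat \<Rightarrow> int"
    assume c: "(\<Sum>k<7. of_int (c k) * \<theta> ^ k) \<in> pR" and "\<not> (\<forall>k<7. int 3 dvd c k)"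
    then have ex: "\<exists>k. k < 7 \<and> \<not> int 3 dvd c k" by blast
    \<comment> \<open>Multiplying by \<theta>^(6-j) moves the terms beyond \<open>j\<close> to
      exponents at least 7, while those below have coefficients divisible by 3; only the multiple of
      \<theta>^6 is left.\<close>
    define j where "j = (LEAST k. k < 7 \<and> \<not> int 3 dvd c k)"
    have j: "j < 7" "\<not> int 3 dvd c j" using LeastI_ex[OF ex] by (auto simp: j_def)
    have lt: "int 3 dvd c k" if "k < j" for k
      using not_less_Least[of k "\<lambda>k. k < 7 \<and> \<not> int 3 dvd c k"] that j(1) unfolding j_def[symmetric] by auto
    have "(\<Sum>k\<in>{..<7} - {j}. of_int (c k) * (\<theta> ^ (6 - j) * \<theta> ^ k)) \<in> pR"
    proof (rule p_ideal_sum[OF p_ideal_pR])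
      fix k assume k: "k \<in> {..<7} - {j}"
      show "of_int (c k) * (\<theta> ^ (6 - j) * \<theta> ^ k) \<in> pR"
      proof (cases "k < j")
        case True
        show ?thesis by (rule p_ideal_dvd[OF p_ideal_pR lt[OF True]]) (intro OK_mult OK_power OK_root)
      next
        case False
        then have "6 - j + k = 7 + (k - j - 1)" using k j by auto
        then have "\<theta> ^ (6 - j) * \<theta> ^ k = \<theta> ^ 7 * \<theta> ^ (k - j - 1)" by (simp flip: power_add)
        then show ?thesis using p_idealD(4,5)[OF p_ideal_pR] t7p OK_power[OF OK_root] by simp
      qed
    qed
    moreover have "\<theta> ^ (6 - j) * (\<Sum>k<7. of_int (c k) * \<theta> ^ k) \<in> pR"
      by (rule p_idealD(4)[OF p_ideal_pR _ c]) (intro OK_power OK_root)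
    moreover have "\<theta> ^ (6 - j) * (\<Sum>k<7. of_int (c k) * \<theta> ^ k) =
      (\<Sum>k\<in>{..<7} - {j}. of_int (c k) * (\<theta> ^ (6 - j) * \<theta> ^ k)) + of_int (c j) * \<theta> ^ 6"
    proof -
      have "\<theta> ^ (6 - j) * \<theta> ^ j = \<theta> ^ 6" using j by (simp flip: power_add)
      then have "of_int (c j) * (\<theta> ^ (6 - j) * \<theta> ^ j) = of_int (c j) * \<theta> ^ 6" by simp
      moreover have "\<theta> ^ (6 - j) * (\<Sum>k<7. of_int (c k) * \<theta> ^ k) = (\<Sum>k<7. of_int (c k) * (\<theta> ^ (6 - j) * \<theta> ^ k))"
        unfolding sum_distrib_left by (simp add: mult_ac)
      ultimately show ?thesis using j by (simp add: sum.remove[of "{..<7}" j])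
    qed
    ultimately have "of_int (c j) * \<theta> ^ 6 \<in> pR"
      using p_ideal_diff[OF p_ideal_pR, of _ "\<Sum>k\<in>{..<7} - {j}. of_int (c k) * (\<theta> ^ (6 - j) * \<theta> ^ k)"] by fastforce
    from cancel_mod_p[OF j(2) OK_power[OF OK_root] this] show False using t6 by simp
  qed
  then have "\<exists>g. x - int_eval g \<theta> \<in> pR" if "x \<in> O\<^sub>K" for x
    using generates_if_indep[OF OK_root _ _ that] by simp
  then show ?thesis by (rule exists_index_not_dvd[OF p OK_root])
qed

text \<open>The case distinction follows the Newton polygon of the trinomial at 5: one side of
  length 7, or a side of length 6 given by the valuation \<open>e\<close> of \<open>A\<close>. A
  quotient of a power of \<open>t\<close> by a power of 5 is nilpotent modulo 5, yet its square
  cannot be divisible by 5; only \<open>e = 3\<close> needs a different element.\<close>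

lemma index_five_aux:
  assumes t: "t \<in> O\<^sub>K" and t7: "t ^ 7 = - of_int A * t - of_int B" and B: "B \<noteq> 0"
    and norm: "\<not> (5 ^ 6 dvd A \<and> 5 ^ 7 dvd B)"
    and trace: "\<And>r0 r1 r2 r3 r4 r5 r6. of_rat r0 + of_rat r1 * t + of_rat r2 * t ^ 2 + of_rat r3 * t ^ 3
      + of_rat r4 * t ^ 4 + of_rat r5 * t ^ 5 + of_rat r6 * t ^ 6 \<in> p_order.pR O\<^sub>K 5
      \<Longrightarrow> \<exists>m. 7 * r0 - 6 * of_int A * r6 = of_int (5 * m)"
    and Fs: "Fs \<subseteq> p_order.max_ideals O\<^sub>K 5" "card Fs = 6" "\<And>P. P \<in> Fs \<Longrightarrow> p_order.degree_one O\<^sub>K P"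
  shows False
proof -
  have p: "prime (5 :: nat)" by simp
  interpret p_order O\<^sub>K 5 7 by (rule p_order_OK[OF p])
  have F7: "Suc (card Fs) = 7" using Fs by simp
  have scalar: "\<exists>l::int. (z - of_int l) * (z ^ 5 - z) \<in> pR" if "z \<in> O\<^sub>K" for z
    by (rule degree_one_polynomial[OF Fs(1) F7 Fs(3) that])
  have nilpotent: "\<exists>w\<in>O\<^sub>K. z * z = 5 * w" if "z \<in> O\<^sub>K" "z ^ k \<in> pR" for z k
    using degree_one_nilpotent[OF Fs(1) F7 that] unfolding pR_def by auto
  have tK: "t \<in> K" using t OK_K by simp
  have pmul: "5 * x \<in> pR" if "x \<in> O\<^sub>K" for x using p_ideal_p_mult[OF p_ideal_pR that] by simp
  obtain P where P: "P \<in> max_ideals" using max_ideal_exists[OF p_ideal_pR one_notin_pR] by blast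
  have PI: "p_ideal P" "1 \<notin> P" using P max_ideal_p_ideal max_ideal_one by auto
  have int_P: "of_int m \<in> P \<longleftrightarrow> 5 dvd m" for m using of_int_in_p_ideal[OF PI] by simp
  have five_A: "5 dvd A" and five_B: "5 dvd B"
  proof -
    \<comment> \<open>In (t - l) (t^5 - t) the coefficient of t^6 is 1 and the constant term 0, so
      the trace gives 5 | 6 A. Multiplying by \<open>t\<close> brings in t^7 and with it
      \<open>B\<close>.\<close>
    obtain l where l: "(t - of_int l) * (t ^ 5 - t) \<in> pR" using scalar[OF t] by blast
    have "(t - of_int l) * (t ^ 5 - t) = of_rat 0 + of_rat (of_int l) * t + of_rat (- 1) * t ^ 2 + of_rat 0 * t ^ 3
      + of_rat 0 * t ^ 4 + of_rat (- of_int l) * t ^ 5 + of_rat 1 * t ^ 6"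
      by (simp add: of_rat_minus algebra_simps power_numeral_reduce)
    then obtain m where m: "7 * 0 - 6 * of_int A * 1 = (of_int (5 * m) :: rat)" using trace l by metis
    then have "(of_int (- 6 * A) :: rat) = of_int (5 * m)" by simp
    then have "- 6 * A = 5 * m" by (simp only: of_int_eq_iff)
    then show A: "5 dvd A" by presburger
    have "t * ((t - of_int l) * (t ^ 5 - t)) \<in> pR" by (rule p_idealD(4)[OF p_ideal_pR t l])
    moreover have "t * ((t - of_int l) * (t ^ 5 - t)) = t ^ 7 - of_int l * t ^ 6 - t ^ 3 + of_int l * t ^ 2"
      by (simp add: algebra_simps power_numeral_reduce)
    moreover have "\<dots> = of_rat (- of_int B) + of_rat (- of_int A) * t + of_rat (of_int l) * t ^ 2 + of_rat (- 1) * t ^ 3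
      + of_rat 0 * t ^ 4 + of_rat 0 * t ^ 5 + of_rat (- of_int l) * t ^ 6"
      unfolding t7 by (simp add: of_rat_minus)
    ultimately obtain m where "7 * (- of_int B) - 6 * of_int A * (- of_int l) = (of_int (5 * m) :: rat)" using trace by metis
    then have "(of_int (- 7 * B + 6 * A * l) :: rat) = of_int (5 * m)" by simp
    then have "- 7 * B + 6 * A * l = 5 * m" by (simp only: of_int_eq_iff)
    then have "7 * B = 6 * A * l - 5 * m" by simp
    moreover have "5 dvd 6 * A * l - 5 * m" using A by simp
    ultimately have "5 dvd 7 * B" by simp
    then show "5 dvd B" by presburger
  qed
  have "t ^ 7 \<in> pR"
  proof -
    obtain A' B' where "A = 5 * A'" "B = 5 * B'" using five_A five_B by (auto elim!: dvdE)
    then have *: "t ^ 7 = 5 * (of_int (- A') * t + of_int (- B'))" unfolding t7 by simp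
    have "of_int (- A') * t + of_int (- B') \<in> O\<^sub>K" by (intro OK_add OK_mult OK_of_int t)
    then show ?thesis unfolding * by (rule pmul)
  qed
  then have tP: "t \<in> P" using max_ideal_power[OF P t] p_idealD(1)[OF PI(1)] by blast
  define \<beta> where "\<beta> = multiplicity 5 B"
  have p5: "prime (5 :: int)" by simp
  obtain B' where B': "B = 5 ^ \<beta> * B'" "\<not> 5 dvd B'"
    using multiplicity_decompose'[of B 5] B unfolding \<beta>_def by auto
  have \<beta>: "\<beta> \<ge> 1" using five_B B' by (cases \<beta>) auto
  show False
  \<comment> \<open>The first case is the polygon with a single side. The solutions of
    \<open>i * \<beta> = 7 * j + 1\<close> exist because \<beta> is prime to 7, and they make the
    seventh power of \<open>\<pi>\<close> equal to 5 u^i.\<close>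
  proof (cases "\<beta> \<le> 6 \<and> 5 ^ \<beta> dvd A")
    case True
    then obtain A' where A': "A = 5 ^ \<beta> * A'" by (auto elim: dvdE)
    define u where "u = - of_int A' * t - of_int B'"
    have u: "u \<in> O\<^sub>K" using OK_mult[OF OK_of_int[of "- A'"] t] OK_diff by (simp add: u_def)
    have t7u: "t ^ 7 = 5 ^ \<beta> * u" unfolding t7 u_def A' B'(1) by (simp add: algebra_simps)
    have "\<beta> = 1 \<or> \<beta> = 2 \<or> \<beta> = 3 \<or> \<beta> = 4 \<or> \<beta> = 5 \<or> \<beta> = 6" using True \<beta> by auto
    then have "\<exists>i j. i * \<beta> = 7 * j + 1"
    proof (elim disjE)
      assume "\<beta> = 1" then show ?thesis by (intro exI[of _ 1] exI[of _ 0]) simp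
    next
      assume "\<beta> = 2" then show ?thesis by (intro exI[of _ 4] exI[of _ 1]) simp
    next
      assume "\<beta> = 3" then show ?thesis by (intro exI[of _ 5] exI[of _ 2]) simp
    next
      assume "\<beta> = 4" then show ?thesis by (intro exI[of _ 2] exI[of _ 1]) simp
    next
      assume "\<beta> = 5" then show ?thesis by (intro exI[of _ 3] exI[of _ 2]) simp
    next
      assume "\<beta> = 6" then show ?thesis by (intro exI[of _ 6] exI[of _ 5]) simp
    qed
    then obtain i j where ij: "i * \<beta> = 7 * j + 1" by blast
    define \<pi> where "\<pi> = t ^ i / of_int (5 ^ j)"
    have piK: "\<pi> \<in> K" unfolding \<pi>_def by (intro K_divide K_power tK K_of_int)
    have "\<pi> ^ 7 * 5 ^ (7 * j) = (\<pi> * 5 ^ j) ^ 7" by (simp add: power_mult_distrib mult.commute flip: power_mult)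
    also have "\<dots> = (t ^ 7) ^ i" by (simp add: \<pi>_def mult.commute flip: power_mult)
    also have "\<dots> = 5 ^ (i * \<beta>) * u ^ i" unfolding t7u by (simp add: power_mult_distrib mult.commute flip: power_mult)
    also have "\<dots> = 5 * u ^ i * 5 ^ (7 * j)" unfolding ij by simp
    finally have pi7: "\<pi> ^ 7 = 5 * u ^ i" by simp
    have "5 * u ^ i \<in> O\<^sub>K" using OK_mult[OF OK_of_int[of 5] OK_power[OF u]] by simp
    then have pi: "\<pi> \<in> O\<^sub>K" using pi7 by (intro OK_nth_root[OF piK, of 7]) simp_all
    have "\<pi> ^ 7 \<in> pR" unfolding pi7 by (rule pmul[OF OK_power[OF u]])
    then obtain w where w: "w \<in> O\<^sub>K" "\<pi> * \<pi> = 5 * w" using nilpotent[OF pi] by blast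
    \<comment> \<open>Comparing two expressions for \<pi>^14 shows that a power of \<open>u\<close>
      is divisible by 5, whereas \<open>u\<close> is congruent to -B' modulo \<open>P\<close> and B'
      is prime to 5.\<close>
    have "25 * (u ^ i) ^ 2 = (\<pi> ^ 7) ^ 2" unfolding pi7 by (simp add: power2_eq_square)
    also have "\<dots> = (\<pi> * \<pi>) ^ 7" by (simp add: power2_eq_square power_mult_distrib)
    also have "\<dots> = 25 * (5 * (625 * w ^ 7))" unfolding w(2) by (simp add: power_mult_distrib)
    finally have "(u ^ i) ^ 2 = 5 * (625 * w ^ 7)" by simp
    moreover have "5 * (625 * w ^ 7) \<in> pR"
      using OK_mult[OF OK_of_int[of 625] OK_power[OF w(1)]] by (intro pmul) simp
    ultimately have "(u ^ i) ^ 2 \<in> P" using p_idealD(1)[OF PI(1)] by simp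
    then have "u \<in> P" using max_ideal_power[OF P u] max_ideal_power[OF P OK_power[OF u]] by blast
    moreover have "of_int A' * t \<in> P" by (rule p_idealD(4)[OF PI(1) OK_of_int tP])
    ultimately have "- (u + of_int A' * t) \<in> P" by (intro p_ideal_uminus[OF PI(1)] p_idealD(3)[OF PI(1)])
    then have "of_int B' \<in> P" by (simp add: u_def)
    then show False using int_P B'(2) by simp
  next
    case False
    have A0: "A \<noteq> 0"
    proof
      assume "A = 0"
      then have "\<beta> \<ge> 7" using False by auto
      then have "(5::int) ^ 7 dvd B" unfolding B'(1) by (intro dvd_mult2 le_imp_power_dvd)
      then show False using norm \<open>A = 0\<close> by simp
    qed
    define e where "e = multiplicity 5 A"
    obtain A' where A': "A = 5 ^ e * A'" "\<not> 5 dvd A'"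
      using multiplicity_decompose'[of A 5] A0 unfolding e_def by auto
    have e1: "e \<ge> 1" using five_A A' by (cases e) auto
    have eb: "e < \<beta>" "e \<le> 5"
    proof -
      have "e < \<beta> \<and> e \<le> 5"
      proof (cases "\<beta> \<le> 6")
        case True
        have "e < \<beta>"
        proof (rule ccontr)
          assume "\<not> e < \<beta>"
          then have "(5::int) ^ \<beta> dvd A" unfolding A'(1) by (intro dvd_mult2 le_imp_power_dvd) simp
          then show False using False True by simp
        qed
        then show ?thesis using True by simp
      next
        case b7: False
        then have "(5::int) ^ 7 dvd B" unfolding B'(1) by (intro dvd_mult2 le_imp_power_dvd) simp
        then have "\<not> 5 ^ 6 dvd A" using norm by simp
        then have "e < 6" unfolding A'(1) by (meson dvd_mult2 le_imp_power_dvd not_less)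
        then show ?thesis using b7 by simp
      qed
      then show "e < \<beta>" "e \<le> 5" by auto
    qed
    define B1 where "B1 = 5 ^ (\<beta> - e - 1) * B'"
    have "\<beta> = e + 1 + (\<beta> - e - 1)" using eb by simp
    then have "(5::int) ^ \<beta> = 5 ^ e * 5 * 5 ^ (\<beta> - e - 1)" by (metis power_add power_one_right)
    then have B1: "B = 5 ^ e * (5 * B1)" unfolding B'(1) B1_def by simp
    \<comment> \<open>\<open>y\<close> has valuation zero along the side of length 6. Dividing the
      trinomial equation by 5^e relates \<open>t\<close> to \<open>y + A'\<close>, and the sixth
      power of this relation is free of \<open>t\<close>: a monic integer equation for
      \<open>y\<close>.\<close>
    define y where "y = t ^ 6 / of_int (5 ^ e)"
    have yK: "y \<in> K" unfolding y_def by (intro K_divide K_power tK K_of_int)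
    have t6: "t ^ 6 = 5 ^ e * y" by (simp add: y_def)
    have "5 ^ e * (t * (y + of_int A')) = t ^ 6 * t + of_int A * t" unfolding t6 A'(1) by (simp add: algebra_simps)
    also have "t ^ 6 * t = t ^ 7" by (simp add: power_numeral_reduce)
    also have "t ^ 7 + of_int A * t = 5 ^ e * (- 5 * of_int B1)" unfolding t7 B1 by simp
    finally have ty: "t * (y + of_int A') = - 5 * of_int B1" by (subst (asm) mult_left_cancel) simp_all
    define c where "c = 5 ^ (6 - e) * B1 ^ 6"
    have "5 ^ e * (y * (y + of_int A') ^ 6) = (t * (y + of_int A')) ^ 6"
      unfolding power_mult_distrib t6 by simp
    also have "\<dots> = 5 ^ 6 * of_int B1 ^ 6" unfolding ty by (simp add: power_mult_distrib)
    also have "(5 :: complex) ^ 6 = 5 ^ e * 5 ^ (6 - e)" using eb by (simp flip: power_add)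
    finally have yeq: "y * (y + of_int A') ^ 6 = of_int c" by (simp add: c_def)
    have y: "y \<in> O\<^sub>K"
    proof -
      define q where "q = [:- c, A' ^ 6, 6 * A' ^ 5, 15 * A' ^ 4, 20 * A' ^ 3, 15 * A' ^ 2, 6 * A', 1:]"
      have "int_eval q y = y * (y + of_int A') ^ 6 - of_int c"
        by (simp add: q_def algebra_simps eval_nat_numeral)
      then have "int_eval q y = 0" using yeq by simp
      moreover have "lead_coeff q = 1" by (simp add: q_def)
      ultimately show ?thesis unfolding O\<^sub>K_def using yK algebraic_int_altdef_ipoly by blast
    qed
    \<comment> \<open>The coefficient of t^6 in y^2 gives the trace 6 A'^2, which is prime to 5; so
      y^2 is not divisible by 5 and \<open>y\<close> is not nilpotent modulo 5.\<close>
    have "y * y = t ^ 5 * t ^ 7 / 5 ^ (2 * e)"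
      by (simp add: y_def mult_2 power_add flip: power_add)
    also have "\<dots> = - (of_int A / 5 ^ (2 * e)) * t ^ 6 - (of_int B / 5 ^ (2 * e)) * t ^ 5"
      unfolding t7 by (simp add: field_simps eval_nat_numeral)
    finally have yy: "y * y = - (of_int A / 5 ^ (2 * e)) * t ^ 6 - (of_int B / 5 ^ (2 * e)) * t ^ 5" .
    have trace6: False if m: "6 * of_int A * (of_int A / 5 ^ (2 * e)) = (of_int (5 * m) :: rat)" for m
    proof -
      have "6 * of_int A * (of_int A / 5 ^ (2 * e)) = (of_int (6 * A' * A') :: rat)"
        unfolding A'(1) by (simp add: mult_2 power_add)
      then have "6 * A' * A' = 5 * m" using m by (simp only: of_int_eq_iff)
      then have "5 dvd 6 * A' * A'" by simp
      then show False using A'(2) p5 by (auto simp: prime_dvd_mult_iff)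
    qed
    have ynil: False if "y ^ k \<in> pR" for k
    proof -
      obtain w where "w \<in> O\<^sub>K" "y * y = 5 * w" using nilpotent[OF y \<open>y ^ k \<in> pR\<close>] by blast
      then have "y * y \<in> pR" using pmul by simp
      moreover have "y * y = of_rat 0 + of_rat 0 * t + of_rat 0 * t ^ 2 + of_rat 0 * t ^ 3
        + of_rat 0 * t ^ 4 + of_rat (- (of_int B / 5 ^ (2 * e))) * t ^ 5 + of_rat (- (of_int A / 5 ^ (2 * e))) * t ^ 6"
        unfolding yy by (simp add: of_rat_minus of_rat_divide of_rat_power)
      ultimately obtain m where "7 * 0 - 6 * of_int A * (- (of_int A / 5 ^ (2 * e))) = (of_int (5 * m) :: rat)"
        using trace by metis
      then show False using trace6[of m] by simp
    qed
    show False
    proof (cases "e = 3")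
      case True
      \<comment> \<open>Here \<open>z\<close> is a cube root of \<open>y\<close>. In (z - l) (z^5 -
        z) only z^6 = y^2 contributes to t^6, and the constant term is zero, so the trace of y^2
        reappears and is prime to 5.\<close>
      define z where "z = t ^ 2 / of_int 5"
      have zK: "z \<in> K" unfolding z_def by (intro K_divide K_power tK K_of_int)
      have "z ^ 3 = y" unfolding z_def y_def True by (simp add: power_divide flip: power_mult)
      then have z: "z \<in> O\<^sub>K" using y by (intro OK_nth_root[OF zK, of 3]) simp_all
      obtain l where l: "(z - of_int l) * (z ^ 5 - z) \<in> pR" using scalar[OF z] by blast
      have z6: "z ^ 6 = y * y" using \<open>z ^ 3 = y\<close> by (simp add: eval_nat_numeral mult.assoc)
      have z5: "z ^ 5 = t ^ 3 * t ^ 7 / 5 ^ 5" by (simp add: z_def power_divide flip: power_mult power_add)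
      have "(z - of_int l) * (z ^ 5 - z) = z ^ 6 - of_int l * z ^ 5 - z ^ 2 + of_int l * z"
        by (simp add: algebra_simps eval_nat_numeral)
      also have "\<dots> = of_rat 0 + of_rat 0 * t + of_rat (of_int l / 5) * t ^ 2 + of_rat (of_int l * of_int B / 5 ^ 5) * t ^ 3
        + of_rat (of_int l * of_int A / 5 ^ 5 - 1 / 25) * t ^ 4 + of_rat (- (of_int B / 5 ^ (2 * e))) * t ^ 5
        + of_rat (- (of_int A / 5 ^ (2 * e))) * t ^ 6"
        unfolding z6 z5 yy t7
        by (simp add: z_def of_rat_minus of_rat_divide of_rat_power of_rat_mult of_rat_diff field_simps eval_nat_numeral)
      finally obtain m where "7 * 0 - 6 * of_int A * (- (of_int A / 5 ^ (2 * e))) = (of_int (5 * m) :: rat)"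
        using trace l by metis
      then show False using trace6[of m] by simp
    next
      case e3: False
      then have "e = 1 \<or> e = 2 \<or> e = 4 \<or> e = 5" using e1 eb by auto
      \<comment> \<open>The bound g \<le> 2 is essential: from \<pi>^2 = 5 w one gets y^i = 5^(3-g)
        w^3, and at least one factor 5 must remain. For \<open>e = 3\<close> every g would be a
        multiple of 3.\<close>
      then have "\<exists>i j g. i * e = 6 * j + g \<and> (g = 1 \<or> g = 2)"
      proof (elim disjE)
        assume "e = 1" then show ?thesis by (intro exI[of _ 1] exI[of _ 0] exI[of _ 1]) simp
      next
        assume "e = 2" then show ?thesis by (intro exI[of _ 1] exI[of _ 0] exI[of _ 2]) simp
      next
        assume "e = 4" then show ?thesis by (intro exI[of _ 2] exI[of _ 1] exI[of _ 2]) simp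
      next
        assume "e = 5" then show ?thesis by (intro exI[of _ 5] exI[of _ 4] exI[of _ 1]) simp
      qed
      then obtain i j g where ij: "i * e = 6 * j + g" "g = 1 \<or> g = 2" by blast
      define \<pi> where "\<pi> = t ^ i / of_int (5 ^ j)"
      have piK: "\<pi> \<in> K" unfolding \<pi>_def by (intro K_divide K_power tK K_of_int)
      have "\<pi> ^ 6 * 5 ^ (6 * j) = (\<pi> * 5 ^ j) ^ 6" by (simp add: power_mult_distrib mult.commute flip: power_mult)
      also have "\<dots> = (t ^ 6) ^ i" by (simp add: \<pi>_def mult.commute flip: power_mult)
      also have "\<dots> = 5 ^ (i * e) * y ^ i" unfolding t6 by (simp add: power_mult_distrib mult.commute flip: power_mult)
      also have "\<dots> = 5 ^ g * y ^ i * 5 ^ (6 * j)" unfolding ij(1) by (simp add: power_add)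
      finally have pi6: "\<pi> ^ 6 = 5 ^ g * y ^ i" by simp
      then have pi6': "\<pi> ^ 6 = 5 * (of_int (5 ^ (g - 1)) * y ^ i)" using ij(2) by auto
      have v: "of_int (5 ^ (g - 1)) * y ^ i \<in> O\<^sub>K" by (intro OK_mult OK_of_int OK_power y)
      then have "5 * (of_int (5 ^ (g - 1)) * y ^ i) \<in> O\<^sub>K" using OK_mult[OF OK_of_int[of 5]] by simp
      then have pi: "\<pi> \<in> O\<^sub>K" using pi6' by (intro OK_nth_root[OF piK, of 6]) simp_all
      have "\<pi> ^ 6 \<in> pR" unfolding pi6' by (rule pmul[OF v])
      then obtain w where w: "w \<in> O\<^sub>K" "\<pi> * \<pi> = 5 * w" using nilpotent[OF pi] by blast
      have "5 ^ g * y ^ i = (\<pi> * \<pi>) ^ 3" unfolding pi6[symmetric] by (simp add: eval_nat_numeral mult_ac)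
      also have "\<dots> = 5 ^ g * (5 * (of_int (5 ^ (2 - g)) * w ^ 3))"
        unfolding w(2) using ij(2) by (auto simp: power_mult_distrib)
      finally have "y ^ i = 5 * (of_int (5 ^ (2 - g)) * w ^ 3)" by simp
      moreover have "5 * (of_int (5 ^ (2 - g)) * w ^ 3) \<in> pR"
        by (intro pmul OK_mult OK_of_int OK_power w)
      ultimately show False using ynil[of i] by simp
    qed
  qed
qed

text \<open>\<theta> is divided by the largest 5^m for which the quotient still satisfies an
  integral trinomial equation; m is bounded because b is nonzero.\<close>

lemma index_five: "\<exists>\<beta>\<in>carrier (ring_of_integers K). K = rat_adjoin \<beta> \<and> \<not> 5 dvd ind K \<beta>"
proof -
  have p: "prime (5 :: nat)" by simp
  interpret p_order O\<^sub>K 5 7 by (rule p_order_OK[OF p])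
  define Q where "Q m \<longleftrightarrow> 5 ^ (6 * m) dvd a \<and> 5 ^ (7 * m) dvd b" for m
  have "\<exists>m. Q m \<and> \<not> Q (Suc m)"
  proof (rule ccontr)
    assume "\<not> ?thesis"
    then have step: "Q m \<Longrightarrow> Q (Suc m)" for m by blast
    have "Q m" for m by (induction m) (use step in \<open>simp_all add: Q_def[of 0]\<close>)
    from this[of "nat \<bar>b\<bar>"] have "5 ^ (7 * nat \<bar>b\<bar>) dvd b" unfolding Q_def by blast
    then have "(5::int) ^ (7 * nat \<bar>b\<bar>) \<le> \<bar>b\<bar>" using dvd_imp_le_int[OF b0] by force
    moreover have "int k < 5 ^ (7 * k)" for k
    proof -
      have "k < 5 ^ k" by (induction k) auto
      also have "(5::nat) ^ k \<le> 5 ^ (7 * k)" by (intro power_increasing) auto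
      finally have "k < 5 ^ (7 * k)" .
      then have "int k < int (5 ^ (7 * k))" by (simp only: of_nat_less_iff)
      then show ?thesis by simp
    qed
    from this[of "nat \<bar>b\<bar>"] have "\<bar>b\<bar> < 5 ^ (7 * nat \<bar>b\<bar>)" by simp
    ultimately show False by simp
  qed
  then obtain m where m: "Q m" "\<not> Q (Suc m)" by blast
  obtain A B where AB: "a = 5 ^ (6 * m) * A" "b = 5 ^ (7 * m) * B" using m(1) by (auto simp: Q_def elim!: dvdE)
  have norm: "\<not> (5 ^ 6 dvd A \<and> 5 ^ 7 dvd B)"
  proof
    assume "5 ^ 6 dvd A \<and> 5 ^ 7 dvd B"
    then have "5 ^ (6 * m) * 5 ^ 6 dvd a" "5 ^ (7 * m) * 5 ^ 7 dvd b" unfolding AB by (auto intro: mult_dvd_mono)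
    then have "Q (Suc m)" by (simp add: Q_def power_add mult.commute)
    then show False using m(2) by simp
  qed
  have B: "B \<noteq> 0" using b0 AB by auto
  define t where "t = \<theta> / of_int (5 ^ m)"
  have t\<theta>: "\<theta> = 5 ^ m * t" by (simp add: t_def)
  have "5 ^ (7 * m) * t ^ 7 = \<theta> ^ 7" unfolding t\<theta> by (simp add: power_mult_distrib mult.commute flip: power_mult)
  also have "\<dots> = - of_int a * (5 ^ m * t) - of_int b" unfolding root t\<theta>[symmetric] ..
  also have "\<dots> = 5 ^ (7 * m) * (- of_int A * t - of_int B)"
  proof -
    have e: "(5::complex) ^ (7 * m) = 5 ^ (6 * m) * 5 ^ m" by (simp flip: power_add)
    show ?thesis unfolding AB of_int_mult of_int_power of_int_numeral e by (simp add: algebra_simps)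
  qed
  finally have t7: "t ^ 7 = - of_int A * t - of_int B" by simp
  have tK: "t \<in> K" unfolding t_def by (intro K_divide K_root K_of_int)
  have t: "t \<in> O\<^sub>K"
  proof -
    have "int_eval [:B, A, 0, 0, 0, 0, 0, 1:] t = t ^ 7 + of_int A * t + of_int B"
      by (simp add: algebra_simps eval_nat_numeral)
    also have "\<dots> = 0" unfolding t7 by simp
    finally have "int_eval [:B, A, 0, 0, 0, 0, 0, 1:] t = 0" .
    moreover have "lead_coeff [:B, A, 0, 0, 0, 0, 0, 1:] = 1" by simp
    ultimately show ?thesis unfolding O\<^sub>K_def using tK algebraic_int_altdef_ipoly by blast
  qed
  have trace: "\<exists>n. 7 * r0 - 6 * of_int A * r6 = of_int (5 * n)"
    if x: "of_rat r0 + of_rat r1 * t + of_rat r2 * t ^ 2 + of_rat r3 * t ^ 3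
      + of_rat r4 * t ^ 4 + of_rat r5 * t ^ 5 + of_rat r6 * t ^ 6 \<in> pR" for r0 r1 r2 r3 r4 r5 r6
  proof -
    \<comment> \<open>Passing from \<open>t\<close> to \<theta> divides the sixth coefficient by
      5^(6m), which turns \<open>a\<close> into \<open>A\<close> in the trace and leaves its form
      unchanged.\<close>
    have r: "of_rat r * t ^ k = of_rat (r / 5 ^ (k * m)) * \<theta> ^ k" for r k
      unfolding t\<theta> by (simp add: of_rat_divide of_rat_power power_mult_distrib mult.commute flip: power_mult)
    have "of_rat r0 + of_rat (r1 / 5 ^ (1 * m)) * \<theta> + of_rat (r2 / 5 ^ (2 * m)) * \<theta> ^ 2 + of_rat (r3 / 5 ^ (3 * m)) * \<theta> ^ 3
      + of_rat (r4 / 5 ^ (4 * m)) * \<theta> ^ 4 + of_rat (r5 / 5 ^ (5 * m)) * \<theta> ^ 5 + of_rat (r6 / 5 ^ (6 * m)) * \<theta> ^ 6 \<in> pR"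
      using x r[of r1 1] unfolding r[of r2] r[of r3] r[of r4] r[of r5] r[of r6] by simp
    from trace_mod_p[OF p this] show ?thesis by (simp add: AB mult.assoc)
  qed
  have "\<exists>\<alpha>\<in>O\<^sub>K. \<forall>x\<in>O\<^sub>K. \<exists>g. x - int_eval g \<alpha> \<in> pR"
  proof (rule monogenic_mod_p)
    fix Fs assume Fs: "Fs \<subseteq> max_ideals" "card Fs = 5 + 1"
    show "\<exists>P\<in>Fs. \<not> degree_one P"
    proof (rule ccontr)
      assume "\<not> ?thesis"
      then have s: "\<And>P. P \<in> Fs \<Longrightarrow> degree_one P" by blast
      show False by (rule index_five_aux[OF t t7 B norm trace Fs(1) _ s]) (use Fs in simp_all)
    qed
  qed simp
  then obtain \<alpha> where "\<alpha> \<in> O\<^sub>K" "\<And>x. x \<in> O\<^sub>K \<Longrightarrow> \<exists>g. x - int_eval g \<alpha> \<in> pR" by blast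
  then show ?thesis by (rule exists_index_not_dvd[OF p])
qed

text \<open>The three factors of the characteristic polynomial are realised by ideals
  \<open>M1\<close>, \<open>M2\<close>, \<open>M4\<close> in which \<theta> becomes 0, 1 and a
  primitive cube root of unity. Only their properness is used: together they give 1 + 2 + 4 parity
  conditions on a relation among the powers of \<alpha>.\<close>

lemma index_two:
  assumes a: "a = 8 * a1 - 1" and b: "b = 4 * (2 * b2 + 1)"
  shows "\<exists>\<beta>\<in>carrier (ring_of_integers K). K = rat_adjoin \<beta> \<and> \<not> 2 dvd ind K \<beta>"
proof -
  have p: "prime (2 :: nat)" by simp
  interpret p_order O\<^sub>K 2 7 by (rule p_order_OK[OF p])
  have two: "2 * x \<in> I" if "p_ideal I" "x \<in> O\<^sub>K" for x I using p_ideal_p_mult[OF that] by simp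
  define \<alpha> where "\<alpha> = (\<theta> ^ 4 - \<theta>) / 2"
  have \<alpha>2: "2 * \<alpha> = \<theta> ^ 4 - \<theta>" by (simp add: \<alpha>_def)
  have "2 * (\<alpha> * (\<theta> ^ 3 + 1)) = 2 * \<alpha> * (\<theta> ^ 3 + 1)" by simp
  also have "\<dots> = \<theta> ^ 7 - \<theta>" unfolding \<alpha>2 by (simp add: algebra_simps eval_nat_numeral)
  also have "\<dots> = 2 * (2 * (- (2 * of_int a1 * \<theta> + of_int (2 * b2 + 1))))"
    unfolding root by (simp add: a b algebra_simps)
  finally have rel1: "\<alpha> * (\<theta> ^ 3 + 1) = 2 * (- (2 * of_int a1 * \<theta> + of_int (2 * b2 + 1)))"
    by (subst (asm) mult_left_cancel) simp_all
  have "2 * (\<alpha> * (\<alpha> + \<theta>)) = \<alpha> * (2 * \<alpha> + 2 * \<theta>)" by (simp add: algebra_simps)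
  also have "\<dots> = \<theta> * (\<alpha> * (\<theta> ^ 3 + 1))" unfolding \<alpha>2 by (simp add: algebra_simps eval_nat_numeral)
  also have "\<dots> = 2 * (- (2 * of_int a1 * \<theta> ^ 2 + of_int (2 * b2 + 1) * \<theta>))"
    unfolding rel1 by (simp add: algebra_simps power2_eq_square)
  finally have rel2: "\<alpha> * (\<alpha> + \<theta>) = - (2 * of_int a1 * \<theta> ^ 2 + of_int (2 * b2 + 1) * \<theta>)"
    by (subst (asm) mult_left_cancel) simp_all
  have \<alpha>: "\<alpha> \<in> O\<^sub>K"
  proof -
    define v where "v = of_int (2 * a1) * \<theta> ^ 2 + of_int (2 * b2 + 1) * \<theta>"
    have v: "v \<in> O\<^sub>K" unfolding v_def by (intro OK_add OK_mult OK_of_int OK_power OK_root)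
    have "algebraic_int \<alpha>"
    proof (rule algebraic_int_integral[of "[:v, \<theta>, 1:]"])
      show "algebraic_int (coeff [:v, \<theta>, 1:] i)" for i
        using v OK_root by (auto simp: coeff_pCons O\<^sub>K_def split: nat.splits)
      have "poly [:v, \<theta>, 1:] \<alpha> = v + \<alpha> * (\<alpha> + \<theta>)" by (simp add: algebra_simps)
      then show "poly [:v, \<theta>, 1:] \<alpha> = 0" unfolding rel2 v_def by simp
    qed simp
    moreover have "\<alpha> \<in> K" unfolding \<alpha>_def
      using K_divide[OF K_diff[OF K_power[OF K_root] K_root] K_of_int[of 2], of 4] by simp
    ultimately show ?thesis by (simp add: O\<^sub>K_def)
  qed
  note OK = OK_add OK_mult OK_diff OK_power OK_root OK_of_int \<alpha> OK_1 minus_R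
  have OK_num: "numeral k \<in> O\<^sub>K" for k using OK_of_int[of "numeral k"] by simp
  note OK = OK OK_num
  have c1: "\<alpha> * (\<theta> ^ 3 + 1) \<in> pR" unfolding rel1 by (intro two[OF p_ideal_pR] OK)
  have r0: "\<alpha> ^ 2 - \<theta> * \<alpha> - \<theta> \<in> pR"
  proof -
    have "\<alpha> ^ 2 - \<theta> * \<alpha> - \<theta> = \<alpha> * (\<alpha> + \<theta>) - 2 * (\<theta> * \<alpha>) - \<theta>"
      by (simp add: algebra_simps power2_eq_square)
    also have "\<dots> = 2 * (- (of_int a1 * \<theta> ^ 2 + of_int b2 * \<theta> + \<theta> + \<theta> * \<alpha>))"
      unfolding rel2 by (simp add: algebra_simps)
    also have "\<dots> \<in> pR" by (intro two[OF p_ideal_pR] OK)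
    finally show ?thesis .
  qed
  have t7: "\<theta> ^ 7 - \<theta> \<in> pR"
  proof -
    have "\<theta> ^ 7 - \<theta> = 2 * (- (of_int (4 * a1) * \<theta> + of_int (2 * (2 * b2 + 1))))"
      unfolding root by (simp add: a b algebra_simps)
    also have "\<dots> \<in> pR" by (intro two[OF p_ideal_pR] OK)
    finally show ?thesis .
  qed
  \<comment> \<open>If some \<open>e\<close> that is nonzero modulo 2 kills \<open>s\<close> modulo
    2, then \<open>s\<close> is not invertible modulo 2. Each \<open>e\<close> below is a cofactor
    of \<open>s\<close> in \<theta>^7 - \<theta> or in a multiple of \<alpha> (\<theta>^3 - 1), and
    an odd trace shows that 2 does not divide it.\<close>
  have proper: "\<exists>M. p_ideal M \<and> 1 \<notin> M \<and> s \<in> M"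
    if s: "s \<in> O\<^sub>K" "e \<in> O\<^sub>K" "e * s \<in> pR" "e \<notin> pR" for s e
  proof -
    define M where "M = {i + s * r | i r. i \<in> pR \<and> r \<in> O\<^sub>K}"
    have "p_ideal M" unfolding M_def by (rule p_ideal_adjoin[OF p_ideal_pR s(1)])
    moreover have "s \<in> M"
      unfolding M_def using p_ideal_zero[OF p_ideal_pR] by (intro CollectI exI[of _ 0] exI[of _ 1]) simp
    moreover have "1 \<notin> M"
    proof
      assume "1 \<in> M"
      then obtain i r where ir: "i \<in> pR" "r \<in> O\<^sub>K" "1 = i + s * r" unfolding M_def by blast
      have "e * (i + s * r) = e * i + (e * s) * r" by (simp add: algebra_simps)
      then have "e = e * i + (e * s) * r" unfolding ir(3)[symmetric] by simp
      also have "\<dots> \<in> pR" by (rule p_idealD(3)[OF p_ideal_pR p_idealD(4)[OF p_ideal_pR s(2) ir(1)] p_idealD(5)[OF p_ideal_pR s(3) ir(2)]])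
      finally show False using s(4) by simp
    qed
    ultimately show ?thesis by blast
  qed
  have odd_trace: "7 * r0 - 6 * of_int a * r6 \<noteq> (of_int (int 2 * m) :: rat)"
    if "7 * r0 - 6 * of_int a * r6 = of_int (2 * k + 1)" for r0 r6 m k
  proof
    assume "7 * r0 - 6 * of_int a * r6 = (of_int (int 2 * m) :: rat)"
    then have "of_int (2 * k + 1) = (of_int (int 2 * m) :: rat)" using that by simp
    then have "2 * k + 1 = int 2 * m" by (simp only: of_int_eq_iff)
    then show False by presburger
  qed
  have "\<theta> ^ 6 - 1 \<in> O\<^sub>K" by (intro OK)
  moreover have "\<theta> ^ 6 - 1 \<notin> pR"
  proof
    assume "\<theta> ^ 6 - 1 \<in> pR"
    moreover have "\<theta> ^ 6 - 1 = of_rat (- 1) + of_rat 0 * \<theta> + of_rat 0 * \<theta> ^ 2 + of_rat 0 * \<theta> ^ 3 + of_rat 0 * \<theta> ^ 4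
      + of_rat 0 * \<theta> ^ 5 + of_rat 1 * \<theta> ^ 6" by (simp add: of_rat_minus)
    ultimately obtain m where "7 * (- 1) - 6 * of_int a * 1 = (of_int (int 2 * m) :: rat)"
      using trace_mod_p[OF p] by metis
    moreover have "7 * (- 1) - 6 * of_int a * 1 = (of_int (2 * (- 4 - 3 * a) + 1) :: rat)" by simp
    ultimately show False using odd_trace by blast
  qed
  moreover have "(\<theta> ^ 6 - 1) * \<theta> \<in> pR" using t7 by (simp add: algebra_simps eval_nat_numeral)
  ultimately obtain M1 where M1: "p_ideal M1" "1 \<notin> M1" "\<theta> \<in> M1"
    using proper[OF OK_root, of "\<theta> ^ 6 - 1"] by blast
  have cube: "\<alpha> * (\<theta> ^ 3 - 1) \<in> pR"
  proof -
    have "\<alpha> * (\<theta> ^ 3 + 1) - 2 * \<alpha> \<in> pR" by (intro p_ideal_diff[OF p_ideal_pR c1] two[OF p_ideal_pR] OK)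
    then show ?thesis by (simp add: algebra_simps)
  qed
  have "\<theta> - 1 \<in> O\<^sub>K" "\<alpha> * (\<theta> ^ 2 + \<theta> + 1) \<in> O\<^sub>K" by (intro OK)+
  moreover have "\<alpha> * (\<theta> ^ 2 + \<theta> + 1) \<notin> pR"
  proof
    assume "\<alpha> * (\<theta> ^ 2 + \<theta> + 1) \<in> pR"
    moreover have "\<alpha> * (\<theta> ^ 2 + \<theta> + 1) = of_rat 0 + of_rat (- 1 / 2) * \<theta> + of_rat (- 1 / 2) * \<theta> ^ 2 + of_rat (- 1 / 2) * \<theta> ^ 3
      + of_rat (1 / 2) * \<theta> ^ 4 + of_rat (1 / 2) * \<theta> ^ 5 + of_rat (1 / 2) * \<theta> ^ 6"
      by (simp add: \<alpha>_def of_rat_minus of_rat_divide field_simps eval_nat_numeral)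
    ultimately obtain m where "7 * 0 - 6 * of_int a * (1 / 2) = (of_int (int 2 * m) :: rat)"
      using trace_mod_p[OF p] by metis
    moreover have "7 * 0 - 6 * of_int a * (1 / 2) = (of_int (2 * (1 - 12 * a1) + 1) :: rat)" by (simp add: a field_simps)
    ultimately show False using odd_trace by blast
  qed
  moreover have "\<alpha> * (\<theta> ^ 2 + \<theta> + 1) * (\<theta> - 1) \<in> pR" using cube by (simp add: algebra_simps eval_nat_numeral)
  ultimately obtain M2 where M2: "p_ideal M2" "1 \<notin> M2" "\<theta> - 1 \<in> M2"
    using proper[of "\<theta> - 1" "\<alpha> * (\<theta> ^ 2 + \<theta> + 1)"] by blast
  have "\<theta> ^ 2 + \<theta> + 1 \<in> O\<^sub>K" "\<alpha> * (\<theta> ^ 2 - \<theta>) \<in> O\<^sub>K" by (intro OK)+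
  moreover have "\<alpha> * (\<theta> ^ 2 - \<theta>) \<notin> pR"
  proof
    assume "\<alpha> * (\<theta> ^ 2 - \<theta>) \<in> pR"
    moreover have "\<alpha> * (\<theta> ^ 2 - \<theta>) = of_rat 0 + of_rat 0 * \<theta> + of_rat (1 / 2) * \<theta> ^ 2 + of_rat (- 1 / 2) * \<theta> ^ 3
      + of_rat 0 * \<theta> ^ 4 + of_rat (- 1 / 2) * \<theta> ^ 5 + of_rat (1 / 2) * \<theta> ^ 6"
      by (simp add: \<alpha>_def of_rat_minus of_rat_divide field_simps eval_nat_numeral)
    ultimately obtain m where "7 * 0 - 6 * of_int a * (1 / 2) = (of_int (int 2 * m) :: rat)"
      using trace_mod_p[OF p] by metis
    moreover have "7 * 0 - 6 * of_int a * (1 / 2) = (of_int (2 * (1 - 12 * a1) + 1) :: rat)" by (simp add: a field_simps)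
    ultimately show False using odd_trace by blast
  qed
  moreover have "\<alpha> * (\<theta> ^ 2 - \<theta>) * (\<theta> ^ 2 + \<theta> + 1) \<in> pR"
    using p_idealD(5)[OF p_ideal_pR cube OK_root] by (simp add: algebra_simps eval_nat_numeral)
  ultimately obtain M4 where M4: "p_ideal M4" "1 \<notin> M4" "\<theta> ^ 2 + \<theta> + 1 \<in> M4"
    using proper[of "\<theta> ^ 2 + \<theta> + 1" "\<alpha> * (\<theta> ^ 2 - \<theta>)"] by blast
  have even_iff: "of_int m \<in> I \<longleftrightarrow> even m" if "p_ideal I" "1 \<notin> I" for I m
    using of_int_in_p_ideal[OF that] by simp
  have even_mult: "of_int m * x \<in> I" if "p_ideal I" "even m" "x \<in> O\<^sub>K" for I m x
    using p_ideal_dvd[OF that(1) _ that(3), of m] that(2) by simp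
  \<comment> \<open>X^2 + X + 1 is irreducible modulo 2: a residue of \<open>x\<close> in the prime
    field would make u^2 - u + 1 even.\<close>
  have indep2: "even u \<and> even v"
    if I: "p_ideal I" "1 \<notin> I" and x: "x \<in> O\<^sub>K" "x * x + x + 1 \<in> I" and uv: "of_int u + of_int v * x \<in> I" for I x u v
  proof -
    have "even v"
    proof (rule ccontr)
      assume "odd v"
      then obtain k where k: "v = 2 * k + 1" by (auto elim: oddE)
      have "of_int u + x = (of_int u + of_int v * x) - 2 * (of_int k * x)" by (simp add: k algebra_simps)
      also have "\<dots> \<in> I" by (intro p_ideal_diff[OF I(1) uv] two[OF I(1)] OK x)
      finally have ux: "of_int u + x \<in> I" .
      have "of_int (u * u - u + 1) = (x * x + x + 1) - (x + (1 - of_int u)) * (of_int u + x)"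
        by (simp add: algebra_simps)
      also have "\<dots> \<in> I" by (intro p_ideal_diff[OF I(1) x(2)] p_idealD(4)[OF I(1) _ ux] OK x)
      finally have "even (u * u - u + 1)" by (simp only: even_iff[OF I])
      then show False by simp
    qed
    moreover have "of_int u \<in> I" using p_ideal_diff[OF I(1) uv even_mult[OF I(1) \<open>even v\<close> x(1)]] by simp
    ultimately show ?thesis using even_iff[OF I] by simp
  qed
  have "indep 7 \<alpha> pR"
  proof (rule indepI)
    fix c :: "nat \<Rightarrow> int" assume "(\<Sum>k<7. of_int (c k) * \<alpha> ^ k) \<in> pR"
    then have S: "of_int (c 0) + of_int (c 1) * \<alpha> + of_int (c 2) * \<alpha> ^ 2 + of_int (c 3) * \<alpha> ^ 3 + of_int (c 4) * \<alpha> ^ 4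
      + of_int (c 5) * \<alpha> ^ 5 + of_int (c 6) * \<alpha> ^ 6 \<in> pR" (is "?S \<in> pR") unfolding sum7 by simp
    have SI: "?S \<in> I" if "p_ideal I" for I using p_idealD(1)[OF that S] .
    have e0: "even (c 0)"
    proof -
      have "\<alpha> = \<alpha> * (\<theta> ^ 3 + 1) - (\<alpha> * \<theta> ^ 2) * \<theta>" by (simp add: algebra_simps eval_nat_numeral)
      also have "\<dots> \<in> M1" by (intro p_ideal_diff[OF M1(1)] p_idealD(1)[OF M1(1) c1] p_idealD(4)[OF M1(1) _ M1(3)] OK)
      finally have al: "\<alpha> \<in> M1" .
      have "of_int (c 0) = ?S - (of_int (c 1) + of_int (c 2) * \<alpha> + of_int (c 3) * \<alpha> ^ 2 + of_int (c 4) * \<alpha> ^ 3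
        + of_int (c 5) * \<alpha> ^ 4 + of_int (c 6) * \<alpha> ^ 5) * \<alpha>" by (simp add: algebra_simps eval_nat_numeral)
      also have "\<dots> \<in> M1" by (intro p_ideal_diff[OF M1(1) SI[OF M1(1)]] p_idealD(4)[OF M1(1) _ al] OK)
      finally show ?thesis using even_iff[OF M1(1,2)] by simp
    qed
    \<comment> \<open>Modulo \<open>M2\<close> the element \<alpha> satisfies x^2 + x + 1, so the
      exponents matter only modulo 3.\<close>
    have e2: "even (c 0 + c 3 + c 6 - c 2 - c 5) \<and> even (c 1 + c 4 - c 2 - c 5)"
    proof -
      have "\<alpha> * \<alpha> + \<alpha> + 1 = (\<alpha> ^ 2 - \<theta> * \<alpha> - \<theta>) + (\<alpha> + 1) * (\<theta> - 1) + 2 * (\<alpha> + 1)"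
        by (simp add: algebra_simps power2_eq_square)
      also have "\<dots> \<in> M2"
        by (intro p_idealD(3)[OF M2(1)] p_idealD(1)[OF M2(1) r0] p_idealD(4)[OF M2(1) _ M2(3)] two[OF M2(1)] OK)
      finally have q: "\<alpha> * \<alpha> + \<alpha> + 1 \<in> M2" .
      have "of_int (c 0 + c 3 + c 6 - c 2 - c 5) + of_int (c 1 + c 4 - c 2 - c 5) * \<alpha> =
        ?S - (of_int (c 2) + of_int (c 3) * (\<alpha> - 1) + of_int (c 4) * (\<alpha> * (\<alpha> - 1))
          + of_int (c 5) * (1 + \<alpha> ^ 2 * (\<alpha> - 1)) + of_int (c 6) * ((\<alpha> - 1) * (\<alpha> ^ 3 + 1))) * (\<alpha> * \<alpha> + \<alpha> + 1)"
        by (simp add: algebra_simps eval_nat_numeral)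
      also have "\<dots> \<in> M2" by (intro p_ideal_diff[OF M2(1) SI[OF M2(1)]] p_idealD(4)[OF M2(1) _ q] OK)
      finally show ?thesis by (rule indep2[OF M2(1,2) \<alpha> q])
    qed
    \<comment> \<open>Modulo \<open>M4\<close> all powers of \<alpha> are reduced to the basis 1,
      \<theta>, \<alpha>, \<theta> \<alpha> by means of \<alpha>^2 = \<theta> \<alpha> +
      \<theta>.\<close>
    have e4: "even (c 0 + c 3) \<and> even (c 2 + c 3 + c 4 + c 5) \<and> even (c 1 + c 3 + c 4) \<and> even (c 2 + c 6)"
    proof -
      note I = M4(1)
      have th: "\<theta> * \<theta> + \<theta> + 1 \<in> M4" using M4(3) by (simp add: power2_eq_square)
      have p2: "\<alpha> ^ 2 - (\<theta> * \<alpha> + \<theta>) \<in> M4" using p_idealD(1)[OF I r0] by (simp add: algebra_simps)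
      have "\<alpha> ^ 3 - (\<alpha> + \<theta> + 1) = (\<alpha> + \<theta>) * (\<alpha> ^ 2 - (\<theta> * \<alpha> + \<theta>)) + (\<alpha> + 1) * (\<theta> * \<theta> + \<theta> + 1) + 2 * (- (\<alpha> + \<theta> + 1))"
        by (simp add: algebra_simps eval_nat_numeral)
      also have "\<dots> \<in> M4" by (intro p_idealD(3)[OF I] p_idealD(4)[OF I _ p2] p_idealD(4)[OF I _ th] two[OF I] OK)
      finally have p3: "\<alpha> ^ 3 - (\<alpha> + \<theta> + 1) \<in> M4" .
      have "\<alpha> ^ 4 - (\<alpha> + \<theta>) = \<alpha> * (\<alpha> ^ 3 - (\<alpha> + \<theta> + 1)) + (\<alpha> ^ 2 - (\<theta> * \<alpha> + \<theta>)) + 2 * (\<theta> * \<alpha>)"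
        by (simp add: algebra_simps eval_nat_numeral)
      also have "\<dots> \<in> M4" by (intro p_idealD(3)[OF I] p_idealD(4)[OF I _ p3] p2 two[OF I] OK)
      finally have p4: "\<alpha> ^ 4 - (\<alpha> + \<theta>) \<in> M4" .
      have "\<alpha> ^ 5 - \<theta> = \<alpha> * (\<alpha> ^ 4 - (\<alpha> + \<theta>)) + (\<alpha> ^ 2 - (\<theta> * \<alpha> + \<theta>)) + 2 * (\<theta> * \<alpha>)"
        by (simp add: algebra_simps eval_nat_numeral)
      also have "\<dots> \<in> M4" by (intro p_idealD(3)[OF I] p_idealD(4)[OF I _ p4] p2 two[OF I] OK)
      finally have p5: "\<alpha> ^ 5 - \<theta> \<in> M4" .
      have "\<alpha> ^ 6 - \<theta> * \<alpha> = \<alpha> * (\<alpha> ^ 5 - \<theta>)" by (simp add: algebra_simps eval_nat_numeral)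
      also have "\<dots> \<in> M4" by (intro p_idealD(4)[OF I _ p5] OK)
      finally have p6: "\<alpha> ^ 6 - \<theta> * \<alpha> \<in> M4" .
      define w0 w1 w2 w3 where "w0 = c 0 + c 3" and "w1 = c 2 + c 3 + c 4 + c 5" and "w2 = c 1 + c 3 + c 4"
        and "w3 = c 2 + c 6"
      have "(of_int w0 + of_int w1 * \<theta>) + (of_int w2 + of_int w3 * \<theta>) * \<alpha> =
        ?S - (of_int (c 2) * (\<alpha> ^ 2 - (\<theta> * \<alpha> + \<theta>)) + of_int (c 3) * (\<alpha> ^ 3 - (\<alpha> + \<theta> + 1)) + of_int (c 4) * (\<alpha> ^ 4 - (\<alpha> + \<theta>))
          + of_int (c 5) * (\<alpha> ^ 5 - \<theta>) + of_int (c 6) * (\<alpha> ^ 6 - \<theta> * \<alpha>))"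
        unfolding w0_def w1_def w2_def w3_def by (simp add: algebra_simps)
      also have "\<dots> \<in> M4"
        by (intro p_ideal_diff[OF I SI[OF I]] p_idealD(3)[OF I] p_idealD(4)[OF I _ p2] p_idealD(4)[OF I _ p3] p_idealD(4)[OF I _ p4]
            p_idealD(4)[OF I _ p5] p_idealD(4)[OF I _ p6] OK)
      finally have W: "(of_int w0 + of_int w1 * \<theta>) + (of_int w2 + of_int w3 * \<theta>) * \<alpha> \<in> M4" .
      have w23: "even w2 \<and> even w3"
      proof (rule ccontr)
        assume o: "\<not> (even w2 \<and> even w3)"
        text \<open>The norm form \<open>x\<^sup>2 - x y + y\<^sup>2\<close> of the residue field of order 4 is odd here,
          so \<open>\<alpha>\<close> would lie in that field.\<close>
        define N where "N = w2 * w2 - w2 * w3 + w3 * w3"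
        have "odd N" using o by (auto simp: N_def)
        then obtain k where k: "N = 2 * k + 1" by (auto elim: oddE)
        \<comment> \<open>\<open>v\<close> is the conjugate of w2 + w3 \<theta>, with -1 - \<theta>
          in place of \<theta>; their product is N, and \<open>x0\<close>, \<open>x1\<close> are the
          coordinates obtained by solving for \<alpha>.\<close>
        define v where "v = of_int (w2 - w3) - of_int w3 * \<theta>"
        have v: "v \<in> O\<^sub>K" unfolding v_def by (intro OK)
        define x0 x1 where "x0 = - (w0 * (w2 - w3) + w1 * w3)" and "x1 = w0 * w3 - w1 * (w2 - w3) - w1 * w3"
        have "\<alpha> - (of_int x0 + of_int x1 * \<theta>) = v * ((of_int w0 + of_int w1 * \<theta>) + (of_int w2 + of_int w3 * \<theta>) * \<alpha>)
          + (of_int w3 * of_int w3 * \<alpha> + of_int w1 * of_int w3) * (\<theta> * \<theta> + \<theta> + 1) - 2 * (of_int k * \<alpha>)"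
        proof -
          have "\<alpha> + 2 * (of_int k * \<alpha>) = of_int N * \<alpha>" by (simp add: k algebra_simps)
          then show ?thesis by (simp add: N_def v_def x0_def x1_def algebra_simps)
        qed
        also have "\<dots> \<in> M4"
          by (intro p_ideal_diff[OF I] p_idealD(3)[OF I] p_idealD(4)[OF I v W] p_idealD(4)[OF I _ th] two[OF I] OK)
        finally have al: "\<alpha> - (of_int x0 + of_int x1 * \<theta>) \<in> M4" .
        define y where "y = of_int x0 + of_int x1 * \<theta>"
        have yO: "y \<in> O\<^sub>K" unfolding y_def by (intro OK)
        have al: "\<alpha> - y \<in> M4" using al by (simp add: y_def)
        have "y ^ 2 - (\<theta> * y + \<theta>) = (\<alpha> ^ 2 - (\<theta> * \<alpha> + \<theta>)) + (\<theta> - \<alpha> - y) * (\<alpha> - y)"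
          by (simp add: algebra_simps power2_eq_square)
        also have "\<dots> \<in> M4" by (intro p_idealD(3)[OF I p2] p_idealD(4)[OF I _ al] OK yO)
        finally have yy: "y ^ 2 - (\<theta> * y + \<theta>) \<in> M4" .
        \<comment> \<open>This expresses that x^2 - \<theta> x - \<theta> has no root in the field
          of order 4: the first coordinate has the parity of x0, the second that of x0 + 1.\<close>
        have "of_int (x0 * x0 - x1 * x1 + x1) + of_int (2 * x0 * x1 - x1 * x1 - x0 + x1 - 1) * \<theta> =
          (y ^ 2 - (\<theta> * y + \<theta>)) - (of_int x1 * of_int x1 - of_int x1) * (\<theta> * \<theta> + \<theta> + 1)"
          by (simp add: y_def algebra_simps power2_eq_square)
        also have "\<dots> \<in> M4" by (intro p_ideal_diff[OF I yy] p_idealD(4)[OF I _ th] OK)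
        finally have "even (x0 * x0 - x1 * x1 + x1) \<and> even (2 * x0 * x1 - x1 * x1 - x0 + x1 - 1)"
          by (rule indep2[OF M4(1,2) OK_root th])
        then show False by auto
      qed
      have "of_int w2 * \<alpha> + of_int w3 * (\<theta> * \<alpha>) \<in> M4"
        by (intro p_idealD(3)[OF I] even_mult[OF I] OK) (use w23 in auto)
      from p_ideal_diff[OF I W this] have "of_int w0 + of_int w1 * \<theta> \<in> M4" by (simp add: algebra_simps)
      then have "even w0 \<and> even w1" by (rule indep2[OF M4(1,2) OK_root th])
      then show ?thesis using w23 by (auto simp: w0_def w1_def w2_def w3_def)
    qed
    have "even (c 0) \<and> even (c 1) \<and> even (c 2) \<and> even (c 3) \<and> even (c 4) \<and> even (c 5) \<and> even (c 6)"
      using e0 e2 e4 by presburger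
    moreover have "k < 7 \<Longrightarrow> k = 0 \<or> k = 1 \<or> k = 2 \<or> k = 3 \<or> k = 4 \<or> k = 5 \<or> k = (6 :: nat)" for k by auto
    ultimately show "\<forall>k<7. int 2 dvd c k" by auto
  qed
  then have "\<exists>g. x - int_eval g \<alpha> \<in> pR" if "x \<in> O\<^sub>K" for x
    using generates_if_indep[OF \<alpha> _ _ that] by simp
  then show ?thesis by (rule exists_index_not_dvd[OF p \<alpha>])
qed

end

theorem corollary1p9:
  fixes a b :: int and f :: "int poly" and \<theta> :: complex and K :: "complex set"
  assumes "f = Polynomial.monom 1 7 + Polynomial.monom a 1 + [:b:]"
    and "Factorial_Ring.irreducible (map_poly of_int f :: rat poly)"
    and "poly (map_poly of_int f) \<theta> = 0"
    and "K = rat_adjoin \<theta>"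
    and "[a = 15] (mod 72)" and "[b = 12] (mod 72)"
  shows "field_index K = 1"
proof -
  have f: "f = [:b, a, 0, 0, 0, 0, 0, 1:]"
    by (simp add: assms(1) eval_nat_numeral monom_Suc monom_0)
  obtain s where s: "a = 15 + 72 * s" using assms(5) by (metis cong_iff_lin cong_sym)
  obtain r where r: "b = 12 + 72 * r" using assms(6) by (metis cong_iff_lin cong_sym)
  \<comment> \<open>A comparison at 3: the first summand is divisible by exactly 3^6, the second by
    3^7.\<close>
  have disc: "7 ^ 7 * b ^ 6 + 6 ^ 6 * a ^ 7 \<noteq> 0"
  proof
    define b' a' where "b' = 4 + 24 * r" and "a' = 5 + 24 * s"
    have ab: "a = 3 * a'" "b = 3 * b'" by (simp_all add: a'_def b'_def s r)
    assume "7 ^ 7 * b ^ 6 + 6 ^ 6 * a ^ 7 = 0"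
    then have "729 * (7 ^ 7 * b' ^ 6 + 3 * (6 ^ 6 * a' ^ 7)) = 0" unfolding ab by (simp add: power_mult_distrib)
    then have "7 ^ 7 * b' ^ 6 = 3 * - (6 ^ 6 * a' ^ 7)" by simp
    then have "3 dvd 7 ^ 7 * b' ^ 6" by (metis dvd_triv_left)
    then have "3 dvd b' ^ 6" by (auto simp: prime_dvd_mult_iff)
    then have "3 dvd b'" by (rule prime_dvd_power[rotated]) simp
    then show False unfolding b'_def by presburger
  qed
  interpret T: trinomial a b \<theta>
  proof
    show "Factorial_Ring.irreducible [:rat_of_int b, rat_of_int a, 0, 0, 0, 0, 0, 1:]"
      using assms(2) unfolding f by (simp add: of_int_hom.map_poly_pCons_hom)
    have "\<theta> ^ 7 + of_int a * \<theta> + of_int b = 0"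
      using assms(3) unfolding f by (simp add: of_int_hom.map_poly_pCons_hom algebra_simps eval_nat_numeral)
    moreover have "\<theta> ^ 7 = (\<theta> ^ 7 + of_int a * \<theta> + of_int b) - of_int a * \<theta> - of_int b" by simp
    ultimately show "\<theta> ^ 7 = - of_int a * \<theta> - of_int b" by simp
    show "7 ^ 7 * b ^ 6 + 6 ^ 6 * a ^ 7 \<noteq> 0" by (rule disc)
    show "b \<noteq> 0" using r by presburger
  qed
  have K: "K = T.K" using assms(4) T.rat_adjoin_root by simp
  have ex: "\<exists>\<beta>\<in>carrier (ring_of_integers K). K = rat_adjoin \<beta> \<and> \<not> p dvd ind K \<beta>" if p: "prime p" for p
  proof -
    consider "p = 2" | "p = 3" | "p = 5" | "p \<ge> 7"
    proof -
      have "p = 2 \<or> p = 3 \<or> p = 5 \<or> p \<ge> 7 \<or> p = 0 \<or> p = 1 \<or> p = 4 \<or> p = 6" by presburger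
      moreover have "\<not> prime (4::nat)" "\<not> prime (6::nat)" by simp_all
      ultimately show thesis using p that by auto
    qed
    then show ?thesis
    proof cases
      case 1
      have "a = 8 * (2 + 9 * s) - 1" "b = 4 * (2 * (1 + 9 * r) + 1)" using s r by simp_all
      then show ?thesis unfolding K 1 by (rule T.index_two)
    next
      case 2
      have "3 dvd a" "3 dvd b" "\<not> 9 dvd b" unfolding s r by presburger+
      then show ?thesis unfolding K 2 by (rule T.index_three)
    next
      case 3
      show ?thesis unfolding K 3 by (rule T.index_five)
    next
      case 4
      show ?thesis unfolding K by (rule T.index_large_prime[OF p 4])
    qed
  qed
  define I where "I = {ind K \<alpha> | \<alpha>. \<alpha> \<in> carrier (ring_of_integers K) \<and> K = rat_adjoin \<alpha>}"
  have "Gcd I = 1"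
  proof (rule ccontr)
    assume "Gcd I \<noteq> 1"
    then obtain p where p: "prime p" "p dvd Gcd I" using prime_factor_nat by blast
    obtain \<beta> where \<beta>: "\<beta> \<in> carrier (ring_of_integers K)" "K = rat_adjoin \<beta>" "\<not> p dvd ind K \<beta>"
      using ex[OF p(1)] by blast
    then have "ind K \<beta> \<in> I" unfolding I_def by blast
    then have "Gcd I dvd ind K \<beta>" by (rule Gcd_dvd)
    then show False using p(2) \<beta>(3) dvd_trans by blast
  qed
  then show ?thesis by (simp add: field_index_def I_def)
qed

end
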